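(* Let $k$ be any field of characteristic $p$ ($p=0$ allowed), let $d>1$ and $n\ge 1$ be integers, and let $s_0,\dots,s_{d-1},u_0,\dots,u_d,x$ be independent indeterminates over $k$. Put $$\mathfrak G(x)=x^d+s_{d-1}x^{d-1}+\dots+s_0,\qquad \Phi(x)=\frac{x^d+s_{d-1}x^{d-1}+\dots+s_0}{u_dx^d+u_{d-1}x^{d-1}+\dots+u_0}.$$ Then $\operatorname{Gal}(\Phi^n(x)/k(s_0,\dots,s_{d-1},u_0,\dots,u_d))\cong [S_d]^n$, and if $(d,p)\neq(2,2)$ then $\operatorname{Gal}(\mathfrak G^n(x)/k(s_0,\dots,s_{d-1}))\cong [S_d]^n$.
   Context: $\mathfrak G^n$ and $\Phi^n$ denote $n$-fold composition. For a rational function $\psi(x)$ over a field $K$, $\operatorname{Gal}(\psi(x)/K)$ denotes the Galois group over $K$ of the splitting field of $\psi(x)$, i.e. of the field generated by the zeros of $\psi$ (the roots of its numerator). Wreath products: if $G$ acts on $\{\alpha_1,\dots,\alpha_m\}$ and $H$ on $\{\beta_1,\dots,\beta_\ell\}$, then $G[H]$ is the set of tuples $(\pi,\tau_1,\dots,\tau_m)$ with $\pi\in G$, $\tau_i\in H$, acting on $\{\alpha_i\}\times\{\beta_r\}$ by $(\alpha_i,\beta_r)\mapsto(\alpha_{\pi(i)},\beta_{\tau_i(r)})$. The $n$-th wreath power is defined by $[S_d]^1=S_d$ and $[S_d]^n=[S_d]^{n-1}[S_d]$; equivalently it is the automorphism group of the $d$-ary rooted tree truncated at level $n$. *)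

theory Defs
  imports "HOL-Algebra.Algebraic_Closure_Type" "HOL-Library.Poly_Mapping"
begin

text \<open>k[X_0, X_1, ...] as finitely supported coefficient maps on monomials,
  and its fraction field k(X_0, X_1, ...).\<close>

type_synonym 'k mpoly = "(nat \<Rightarrow>\<^sub>0 nat) \<Rightarrow>\<^sub>0 'k"
type_synonym 'k ratfun = "'k mpoly fract"

definition indet :: "nat \<Rightarrow> 'k::field ratfun" where
  "indet i = Fract (Poly_Mapping.single (Poly_Mapping.single i 1) 1) 1"

definition cst :: "'k::field \<Rightarrow> 'k ratfun" where
  "cst c = Fract (Poly_Mapping.single 0 c) 1"

text \<open>Convention: s_i = X_i (i < d), u_i = X_(d+i) (i \<le> d).\<close>

definition s_var :: "nat \<Rightarrow> nat \<Rightarrow> 'k::field ratfun" where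
  "s_var d i = indet i"

definition u_var :: "nat \<Rightarrow> nat \<Rightarrow> 'k::field ratfun" where
  "u_var d i = indet (d + i)"

definition G_poly :: "nat \<Rightarrow> 'k::field ratfun poly" where
  "G_poly d = monom 1 d + (\<Sum>i<d. monom (s_var d i) i)"

definition Phi_den :: "nat \<Rightarrow> 'k::field ratfun poly" where
  "Phi_den d = (\<Sum>i\<le>d. monom (u_var d i) i)"

definition G_iter :: "nat \<Rightarrow> nat \<Rightarrow> 'k::field ratfun poly" where
  "G_iter d n = ((\<lambda>q. pcompose (G_poly d) q) ^^ n) [:0, 1:]"

text \<open>Phi^n(x) = N/D, computed by Phi^(m+1) = Phi o Phi^m, i.e.
  N' = D^d * A(N/D), D' = D^d * B(N/D) with A = G_poly d, B = Phi_den d.\<close>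
fun Phi_iter :: "nat \<Rightarrow> nat \<Rightarrow> 'k::field ratfun poly \<times> 'k ratfun poly" where
  "Phi_iter d 0 = ([:0, 1:], 1)"
| "Phi_iter d (Suc m) =
     (let (N, D) = Phi_iter d m in
       ((\<Sum>i\<le>d. smult (coeff (G_poly d) i) (N ^ i * D ^ (d - i))),
        (\<Sum>i\<le>d. smult (coeff (Phi_den d) i) (N ^ i * D ^ (d - i)))))"

text \<open>Numerator of Phi^n written in lowest terms (N = g * N', D = g * D', N' and D' coprime;
  N' is determined up to a nonzero constant, which does not affect its zeros).\<close>
definition Phi_numer :: "nat \<Rightarrow> nat \<Rightarrow> 'k::field ratfun poly" where
  "Phi_numer d n = (let (N, D) = Phi_iter d n in
      (SOME N'. \<exists>g D'. N = g * N' \<and> D = g * D' \<and> coprime N' D'))"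

definition gen_subfield :: "'a::field set \<Rightarrow> 'a set" where
  "gen_subfield A = \<Inter>{F. A \<subseteq> F \<and> 0 \<in> F \<and> 1 \<in> F \<and>
      (\<forall>x\<in>F. \<forall>y\<in>F. x + y \<in> F \<and> x * y \<in> F \<and> - x \<in> F \<and> inverse x \<in> F)}"

definition Gal_over :: "'a::field set \<Rightarrow> 'a set \<Rightarrow> ('a \<Rightarrow> 'a) monoid" where
  "Gal_over K E =
     \<lparr> carrier = {\<sigma> \<in> extensional E. bij_betw \<sigma> E E \<and>
                   (\<forall>x\<in>E. \<forall>y\<in>E. \<sigma> (x + y) = \<sigma> x + \<sigma> y \<and> \<sigma> (x * y) = \<sigma> x * \<sigma> y) \<and>
                   (\<forall>x\<in>K. \<sigma> x = x)},
       monoid.mult = (\<lambda>\<sigma> \<tau>. restrict (\<sigma> \<circ> \<tau>) E),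
       one = restrict id E \<rparr>"

definition Gal_poly :: "'a::field set \<Rightarrow> 'a poly \<Rightarrow> ('a \<Rightarrow> 'a) monoid" where
  "Gal_poly K P = Gal_over K (gen_subfield (K \<union> {\<alpha>. poly P \<alpha> = 0}))"

definition base_G :: "nat \<Rightarrow> 'k::field ratfun alg_closure set" where
  "base_G d = gen_subfield (to_ac ` (range cst \<union> s_var d ` {..<d}))"

definition base_Phi :: "nat \<Rightarrow> 'k::field ratfun alg_closure set" where
  "base_Phi d = gen_subfield (to_ac ` (range cst \<union> s_var d ` {..<d} \<union> u_var d ` {..d}))"

section \<open>The n-th wreath power of S_d as automorphism group of the truncated d-ary tree\<close>

definition tree_verts :: "nat \<Rightarrow> nat \<Rightarrow> nat list set" where
  "tree_verts d n = {xs. length xs \<le> n \<and> set xs \<subseteq> {..<d}}"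

definition wreath_power :: "nat \<Rightarrow> nat \<Rightarrow> (nat list \<Rightarrow> nat list) monoid" where
  "wreath_power d n =
     \<lparr> carrier = {f \<in> extensional (tree_verts d n).
                   bij_betw f (tree_verts d n) (tree_verts d n) \<and> f [] = [] \<and>
                   (\<forall>xs\<in>tree_verts d n. xs \<noteq> [] \<longrightarrow> f (butlast xs) = butlast (f xs))},
       monoid.mult = (\<lambda>f g. restrict (f \<circ> g) (tree_verts d n)),
       one = restrict id (tree_verts d n) \<rparr>"

end

theory Submission
  imports Defs "HOL-Computational_Algebra.Formal_Power_Series"
begin

text \<open>
  The preimages of \<open>0\<close> under the iterates form a \<open>d\<close>-ary tree on which the Galois group acts. By
  induction on the level, all tree automorphisms are realised once each level carries (a) a vertex
  whose \<open>d\<close> children are permuted doubly transitively, and (b) an element swapping two siblings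
  and fixing all other vertices of the level.

  Both come from embeddings of the field of coefficients. Write the generic map, up to conjugation by
  the translation by \<open>t\<close>, as \<open>g(x) = v + (x - y\<^sub>0)\<cdots>(x - y\<^sub>d\<^sub>-\<^sub>1)/B(x)\<close> with \<open>t = g\<^sup>N(v)\<close>. Then \<open>v\<close> lies at level
  \<open>N\<close>, its children are the \<open>y\<^sub>i\<close>, and permuting the \<open>y\<^sub>i\<close> fixes all coefficients; this gives (a).
  For (b) put \<open>y\<^sub>i = a\<^sub>i + \<tau> z\<^sub>i\<close> and similarly for \<open>v\<close> and \<open>B\<close>, with power series in \<open>\<tau>\<close>, such that at
  \<open>\<tau> = 0\<close> the map is ramified only over \<open>v\<close> and the orbit of \<open>v\<close> is injective. By Hensel's lemma every
  vertex other than the children of \<open>v\<close> is a power series determined by its constant term, and is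
  hence fixed by the permutations of the \<open>z\<^sub>i\<close>. The reduced map is \<open>v + x\<^sup>d\<close> if \<open>p\<close> does not divide \<open>d\<close>;
  otherwise \<open>v + x\<^sup>d/(1 + e x)\<close> for \<open>\<Phi>\<close> and \<open>v + x\<^sup>d - x\<^sup>d\<^sup>-\<^sup>1\<close>, which needs \<open>d > 2\<close>, for the polynomial.
\<close>

section \<open>Extension of homomorphisms\<close>

text \<open>The main obstacle is that the coefficients of the special map must be algebraically
  independent, since otherwise the generic coefficients could not be sent to them. No transcendence
  degree is counted. Instead a path in the generic tree from level \<open>N\<close> to the root is
  used to read the construction backwards: its first vertex serves as \<open>v\<close>, the children
  of that vertex as the \<open>y i\<close>, and the special coefficients become the indeterminates
  themselves. Such a path has to exist, and must not start at the value of the map at infinity; both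
  facts for level \<open>N + 1\<close> come from the embedding for level \<open>N\<close>, so levels
  and embeddings are built in one induction. Galois elements arise from one principle: an injective
  endomorphism of the power series that fixes the special coefficients extends to an algebraic
  closure, and two embeddings of the generic closure that agree on the base differ by an
  automorphism over the base. (a) and (b) put different demands on the constant terms: (a) wants all
  roots of the numerator to reduce to one point, (b) wants two of them to coincide and the other
  fibres to be separable. For the polynomial with \<open>p\<close> dividing \<open>d\<close> this
  takes two specialisations.\<close>

locale unital_hom =
  fixes h :: "'a::comm_ring_1 \<Rightarrow> 'b::comm_ring_1"
  assumes one [simp]: "h 1 = 1"
    and add [simp]: "h (x + y) = h x + h y"
    and mult [simp]: "h (x * y) = h x * h y"
begin

lemma zero [simp]: "h 0 = 0"
  using add[of 0 0] by simp

lemma uminus [simp]: "h (- x) = - h x"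
  using add[of x "- x"] by (simp add: eq_neg_iff_add_eq_0 add.commute)

lemma diff [simp]: "h (x - y) = h x - h y"
  using add[of x "- y"] by simp

lemma power [simp]: "h (x ^ n) = h x ^ n"
  by (induction n) auto

lemma sum [simp]: "h (\<Sum>i\<in>I. f i) = (\<Sum>i\<in>I. h (f i))"
  by (induction I rule: infinite_finite_induct) auto

lemma prod [simp]: "h (\<Prod>i\<in>I. f i) = (\<Prod>i\<in>I. h (f i))"
  by (induction I rule: infinite_finite_induct) auto

lemma poly_map_poly [simp]: "poly (map_poly h p) (h x) = h (poly p x)"
  by (induction p) (auto simp: map_poly_pCons)

lemma map_poly_pCons' [simp]: "map_poly h (pCons c p) = pCons (h c) (map_poly h p)"
  by (cases "c = 0 \<and> p = 0") (auto simp: map_poly_pCons)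

lemma map_poly_add: "map_poly h (p + q) = map_poly h p + map_poly h q"
  by (intro poly_eqI) (auto simp: coeff_map_poly)

lemma map_poly_mult: "map_poly h (p * q) = map_poly h p * map_poly h q"
  by (intro poly_eqI) (auto simp: coeff_map_poly coeff_mult)

lemma map_poly_smult: "map_poly h (smult c p) = smult (h c) (map_poly h p)"
  by (intro poly_eqI) (auto simp: coeff_map_poly)

lemma map_poly_pcompose: "map_poly h (pcompose p q) = pcompose (map_poly h p) (map_poly h q)"
  by (induction p) (auto simp: pcompose_pCons map_poly_add map_poly_mult)

lemma map_poly_prod: "map_poly h (\<Prod>i\<in>I. f i) = (\<Prod>i\<in>I. map_poly h (f i))"
  by (induction I rule: infinite_finite_induct) (auto simp: map_poly_mult)

end

lemma unital_hom_comp: "unital_hom g \<Longrightarrow> unital_hom h \<Longrightarrow> unital_hom (\<lambda>x. g (h x))"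
  by (simp add: unital_hom_def)

lemma unital_hom_inj:
  fixes h :: "'a::field \<Rightarrow> 'b::field"
  assumes "unital_hom h"
  shows "inj h"
proof -
  interpret unital_hom h by fact
  have "x = 0" if "h x = 0" for x
    using that mult[of x "inverse x"] by (cases "x = 0") auto
  then show ?thesis
    by (metis diff eq_iff_diff_eq_0 injI)
qed

lemma unital_hom_eq_0_iff:
  assumes "unital_hom h" "inj h"
  shows "h x = 0 \<longleftrightarrow> x = 0"
  using assms by (metis injD unital_hom.zero)

lemma unital_hom_divide:
  fixes h :: "'a::field \<Rightarrow> 'b::field"
  assumes "unital_hom h"
  shows "h (x / y) = h x / h y"
proof (cases "y = 0")
  case False
  then have "h y \<noteq> 0"
    using unital_hom_eq_0_iff[OF assms unital_hom_inj[OF assms]] by blast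
  moreover have "h (x / y) * h y = h x"
    using False by (simp flip: unital_hom.mult[OF assms])
  ultimately show ?thesis
    by (simp add: field_simps)
qed (simp add: unital_hom.zero[OF assms])

lemma unital_hom_to_ac: "unital_hom to_ac"
  by unfold_locales simp_all

definition frac_of :: "'a::idom \<Rightarrow> 'a fract" where
  "frac_of a = Fract a 1"

lemma unital_hom_frac_of: "unital_hom frac_of"
  by unfold_locales (simp_all add: frac_of_def One_fract_def)

lemma inj_frac_of: "inj frac_of"
  by (rule injI) (simp add: frac_of_def eq_fract)

lemma fract_hom_ext:
  fixes h :: "'a::idom \<Rightarrow> 'b::field"
  assumes "unital_hom h" "inj h"
  obtains H :: "'a fract \<Rightarrow> 'b" where "unital_hom H" "\<And>a. H (frac_of a) = h a"
proof -
  interpret unital_hom h by fact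
  note h0 = unital_hom_eq_0_iff[OF assms]
  define H where "H q = (THE r. \<exists>a b. b \<noteq> 0 \<and> q = Fract a b \<and> r = h a / h b)" for q
  have H: "H (Fract a b) = h a / h b" if "b \<noteq> 0" for a b
    unfolding H_def
  proof (rule the_equality)
    show "\<exists>a' b'. b' \<noteq> 0 \<and> Fract a b = Fract a' b' \<and> h a / h b = h a' / h b'"
      using that by blast
  next
    fix r assume "\<exists>a' b'. b' \<noteq> 0 \<and> Fract a b = Fract a' b' \<and> r = h a' / h b'"
    then obtain a' b' where *: "b' \<noteq> 0" "Fract a b = Fract a' b'" "r = h a' / h b'"
      by blast
    then have "h (a * b') = h (a' * b)"
      using that by (simp add: eq_fract)
    then show "r = h a / h b"
      using * that by (simp add: h0 frac_eq_eq)
  qed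
  have "unital_hom H"
  proof
    show "H 1 = 1"
      by (simp add: One_fract_def H)
    show "H (x + y) = H x + H y" for x y
      by (cases x; cases y) (simp add: H h0 field_simps)
    show "H (x * y) = H x * H y" for x y
      by (cases x; cases y) (simp add: H h0 field_simps)
  qed
  moreover have "H (frac_of a) = h a" for a
    by (simp add: frac_of_def H)
  ultimately show thesis ..
qed

text \<open>A subring of the product ring, read as the graph of a partial homomorphism. It may be
  many-valued, so substitutions with denominators can be handled before any map on them is
  constructed.\<close>

definition ring_rel :: "('a::comm_ring_1 \<times> 'b::comm_ring_1) set \<Rightarrow> bool" where
  "ring_rel S \<longleftrightarrow> (0, 0) \<in> S \<and> (1, 1) \<in> S \<and>
     (\<forall>x y x' y'. (x, y) \<in> S \<longrightarrow> (x', y') \<in> S \<longrightarrow>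
        (x + x', y + y') \<in> S \<and> (x - x', y - y') \<in> S \<and> (x * x', y * y') \<in> S)"

lemma ring_relD:
  assumes "ring_rel S"
  shows "(0, 0) \<in> S" "(1, 1) \<in> S"
    and "(x, y) \<in> S \<Longrightarrow> (x', y') \<in> S \<Longrightarrow> (x + x', y + y') \<in> S"
    and "(x, y) \<in> S \<Longrightarrow> (x', y') \<in> S \<Longrightarrow> (x - x', y - y') \<in> S"
    and "(x, y) \<in> S \<Longrightarrow> (x', y') \<in> S \<Longrightarrow> (x * x', y * y') \<in> S"
  using assms by (simp_all add: ring_rel_def)

lemma ring_rel_power: "ring_rel S \<Longrightarrow> (x, y) \<in> S \<Longrightarrow> (x ^ n, y ^ n) \<in> S"
  by (induction n) (simp_all add: ring_relD)

lemma ring_rel_sum: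
  "ring_rel S \<Longrightarrow> (\<And>i. i \<in> I \<Longrightarrow> (f i, g i) \<in> S) \<Longrightarrow> (sum f I, sum g I) \<in> S"
  by (induction I rule: infinite_finite_induct) (simp_all add: ring_relD)

lemma ring_rel_prod:
  "ring_rel S \<Longrightarrow> (\<And>i. i \<in> I \<Longrightarrow> (f i, g i) \<in> S) \<Longrightarrow> (prod f I, prod g I) \<in> S"
  by (induction I rule: infinite_finite_induct) (simp_all add: ring_relD)

definition poly_graph :: "('a::zero \<times> 'b::zero) set \<Rightarrow> ('a poly \<times> 'b poly) set" where
  "poly_graph S = {(p, q). \<forall>i. (coeff p i, coeff q i) \<in> S}"

lemma ring_rel_poly_graph:
  assumes S: "ring_rel S"
  shows "ring_rel (poly_graph S)"
  unfolding ring_rel_def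
proof (intro conjI allI impI)
  show "(0, 0) \<in> poly_graph S" "(1, 1) \<in> poly_graph S"
    by (auto simp: poly_graph_def ring_relD[OF S])
next
  fix p q p' q' assume "(p, q) \<in> poly_graph S" "(p', q') \<in> poly_graph S"
  then have pq: "(coeff p i, coeff q i) \<in> S" "(coeff p' i, coeff q' i) \<in> S" for i
    by (simp_all add: poly_graph_def)
  show "(p + p', q + q') \<in> poly_graph S" "(p - p', q - q') \<in> poly_graph S" "(p * p', q * q') \<in> poly_graph S"
    unfolding poly_graph_def by (simp_all add: coeff_mult ring_rel_sum[OF S] ring_relD[OF S] pq)
qed

lemma ring_rel_poly_graph_pCons:
  assumes "(a, b) \<in> S" "(p, q) \<in> poly_graph S"
  shows "(pCons a p, pCons b q) \<in> poly_graph S"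
  using assms by (auto simp: poly_graph_def coeff_pCons split: nat.splits)

lemma ring_rel_poly_graph_const:
  assumes "ring_rel S" "(a, b) \<in> S"
  shows "([:a:], [:b:]) \<in> poly_graph S"
  using ring_rel_poly_graph_pCons[OF assms(2)] ring_relD(1)[OF ring_rel_poly_graph[OF assms(1)]] by blast

lemma ring_rel_poly_graph_pcompose:
  assumes S: "ring_rel S" and "(p, q) \<in> poly_graph S" "(r, s) \<in> poly_graph S"
  shows "(pcompose p r, pcompose q s) \<in> poly_graph S"
  using assms(2)
proof (induction p arbitrary: q)
  case 0
  then show ?case
  \<comment> \<open>\<open>S\<close> may relate \<open>0\<close> to a nonzero element, so
    \<open>q\<close> can be longer than \<open>p\<close>.\<close>
  proof (induction q)
    case 0
    show ?case by (simp add: ring_relD[OF ring_rel_poly_graph[OF S]])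
  next
    case (pCons b q)
    have *: "(0, b) \<in> S" "(0, q) \<in> poly_graph S"
      using pCons.prems unfolding poly_graph_def
      by (auto dest: spec[of _ 0] spec[of _ "Suc _"] simp: coeff_pCons split: nat.splits)
    have "([:0:] + r * pcompose 0 r, [:b:] + s * pcompose q s) \<in> poly_graph S"
      using pCons.IH[OF *(2)] ring_rel_poly_graph_const[OF S *(1)] assms(3)
        ring_relD(3,5)[OF ring_rel_poly_graph[OF S]] by blast
    then show ?case
      by (simp add: pcompose_pCons)
  qed
next
  case (pCons a p)
  obtain b q' where q: "q = pCons b q'"
    by (cases q)
  have ab: "(a, b) \<in> S"
    using pCons.prems unfolding q poly_graph_def by (auto dest: spec[of _ 0])
  have pq: "(p, q') \<in> poly_graph S"
  proof -
    have "(coeff (pCons a p) (Suc i), coeff (pCons b q') (Suc i)) \<in> S" for i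
      using pCons.prems unfolding q poly_graph_def by blast
    then show ?thesis
      by (simp add: poly_graph_def)
  qed
  have "([:a:] + r * pcompose p r, [:b:] + s * pcompose q' s) \<in> poly_graph S"
    using pCons.IH[OF pq] ring_rel_poly_graph_const[OF S ab] assms(3)
      ring_relD(3,5)[OF ring_rel_poly_graph[OF S]] by blast
  then show ?case
    by (simp add: q pcompose_pCons)
qed

text \<open>The graph of an isomorphism between a subfield of \<open>'a\<close> and a subfield of
  \<open>'b\<close>: closure under differences together with the condition on zeros makes it
  single-valued and injective. With graphs in place of maps, the upper bound of a chain is a plain
  union.\<close>

definition hom_graph :: "('a::field \<times> 'b::field) set \<Rightarrow> bool" where
  "hom_graph S \<longleftrightarrow> (1, 1) \<in> S \<and>
     (\<forall>x y x' y'. (x, y) \<in> S \<longrightarrow> (x', y') \<in> S \<longrightarrow>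
        (x + x', y + y') \<in> S \<and> (x - x', y - y') \<in> S \<and> (x * x', y * y') \<in> S \<and> (x / x', y / y') \<in> S) \<and>
     (\<forall>x y. (x, y) \<in> S \<longrightarrow> (x = 0 \<longleftrightarrow> y = 0))"

lemma hom_graphD:
  assumes "hom_graph S"
  shows "(1, 1) \<in> S" "(0, 0) \<in> S"
    and "(x, y) \<in> S \<Longrightarrow> (x', y') \<in> S \<Longrightarrow> (x + x', y + y') \<in> S"
    and "(x, y) \<in> S \<Longrightarrow> (x', y') \<in> S \<Longrightarrow> (x - x', y - y') \<in> S"
    and "(x, y) \<in> S \<Longrightarrow> (x', y') \<in> S \<Longrightarrow> (x * x', y * y') \<in> S"
    and "(x, y) \<in> S \<Longrightarrow> (x', y') \<in> S \<Longrightarrow> (x / x', y / y') \<in> S"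
    and "(x, y) \<in> S \<Longrightarrow> x = 0 \<longleftrightarrow> y = 0"
proof -
  show "(0, 0) \<in> S"
    using assms unfolding hom_graph_def by (metis cancel_comm_monoid_add_class.diff_cancel)
qed (use assms in \<open>unfold hom_graph_def, blast+\<close>)

section \<open>Partial isomorphisms and polynomials over their domains\<close>

context
  fixes S :: "('a::field \<times> 'b::field) set"
  assumes S: "hom_graph S"
begin

lemma ring_rel_hom_graph: "ring_rel S"
  unfolding ring_rel_def using hom_graphD[OF S] by simp

lemmas poly_graph_0 = ring_relD(1)[OF ring_rel_poly_graph[OF ring_rel_hom_graph]]
  and poly_graph_add = ring_relD(3)[OF ring_rel_poly_graph[OF ring_rel_hom_graph]]
  and poly_graph_diff = ring_relD(4)[OF ring_rel_poly_graph[OF ring_rel_hom_graph]]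
  and poly_graph_mult = ring_relD(5)[OF ring_rel_poly_graph[OF ring_rel_hom_graph]]

lemma poly_graph_pCons_iff:
  "(pCons a p, pCons b q) \<in> poly_graph S \<longleftrightarrow> (a, b) \<in> S \<and> (p, q) \<in> poly_graph S"
  unfolding poly_graph_def by (auto simp: coeff_pCons split: nat.splits)

lemma poly_graph_smult:
  "(a, b) \<in> S \<Longrightarrow> (p, q) \<in> poly_graph S \<Longrightarrow> (smult a p, smult b q) \<in> poly_graph S"
  unfolding poly_graph_def by (auto intro!: hom_graphD[OF S])

lemma poly_graph_degree:
  assumes "(p, q) \<in> poly_graph S"
  shows "degree p = degree q" "p = 0 \<longleftrightarrow> q = 0"
proof -
  have *: "coeff p i = 0 \<longleftrightarrow> coeff q i = 0" for i
    using assms by (auto simp: poly_graph_def hom_graphD(7)[OF S])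
  show "p = 0 \<longleftrightarrow> q = 0"
    using * by (simp add: poly_eq_iff)
  show "degree p = degree q"
    using * by (simp add: Polynomial.degree_def)
qed

text \<open>Long division uses only field operations on the coefficients, and related polynomials
  have equal degrees, so both divisions run in parallel. Minimality arguments can thus be carried
  from one side to the other.\<close>

lemma poly_graph_div_mod:
  assumes "(m, m') \<in> poly_graph S" "(p, q) \<in> poly_graph S"
  shows "(p div m, q div m') \<in> poly_graph S \<and> (p mod m, q mod m') \<in> poly_graph S"
proof (cases "m = 0")
  case True
  then show ?thesis
    using assms poly_graph_degree(2)[OF assms(1)] by (auto simp: poly_graph_0)
next
  case False
  then have m': "m' \<noteq> 0" and deg: "degree m = degree m'"
    using poly_graph_degree[OF assms(1)] by auto
  have lc: "(lead_coeff m, lead_coeff m') \<in> S"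
    using assms(1) by (auto simp: poly_graph_def deg)
  show ?thesis
    using assms(2)
  proof (induction p arbitrary: q)
    case 0
    then have "q = 0"
      using poly_graph_degree(2) by blast
    then show ?case
      by (simp add: poly_graph_0)
  next
    case (pCons a p)
    obtain b q' where q: "q = pCons b q'"
      by (cases q)
    from pCons.prems have ab: "(a, b) \<in> S" and pq: "(p, q') \<in> poly_graph S"
      by (auto simp: q poly_graph_pCons_iff)
    note IH = pCons.IH[OF pq]
    have *: "(pCons a (p mod m), pCons b (q' mod m')) \<in> poly_graph S"
      using IH ab by (simp add: poly_graph_pCons_iff)
    have c: "(coeff (pCons a (p mod m)) (degree m) / lead_coeff m,
          coeff (pCons b (q' mod m')) (degree m') / lead_coeff m') \<in> S"
      using * lc by (intro hom_graphD[OF S]) (auto simp: poly_graph_def deg)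
    show ?case
      using c IH * assms(1) False m' unfolding q
      by (auto simp: div_pCons_eq mod_pCons poly_graph_pCons_iff Let_def
          intro!: poly_graph_diff poly_graph_smult)
  qed
qed

text \<open>The simple extension step without quotient rings. If \<open>m\<close> has least degree
  among the polynomials over the domain that vanish at \<open>\<alpha>\<close>, any root
  \<open>\<beta>\<close> of its partner \<open>m'\<close> may serve as image of
  \<open>\<alpha>\<close>. The point is that related polynomials vanish at \<open>\<alpha>\<close>
  and at \<open>\<beta>\<close> simultaneously, since either means remainder \<open>0\<close> modulo
  \<open>m\<close> and \<open>m'\<close>.\<close>

lemma hom_graph_adjoin:
  fixes \<alpha> :: 'a
  assumes "(p0, q0) \<in> poly_graph S" "p0 \<noteq> 0" "poly p0 \<alpha> = 0"
    and alg_closed: "\<And>q :: 'b poly. degree q > 0 \<Longrightarrow> \<exists>\<beta>. poly q \<beta> = 0"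
  obtains S' where "hom_graph S'" "S \<subseteq> S'" "\<alpha> \<in> Domain S'"
proof -
  define Q where "Q k \<longleftrightarrow> (\<exists>p q. (p, q) \<in> poly_graph S \<and> p \<noteq> 0 \<and> poly p \<alpha> = 0 \<and> degree p = k)" for k
  have "Q (degree p0)"
    using assms unfolding Q_def by blast
  then have "Q (LEAST k. Q k)"
    by (rule LeastI)
  then obtain m m' where m: "(m, m') \<in> poly_graph S" "m \<noteq> 0" "poly m \<alpha> = 0"
      "degree m = (LEAST k. Q k)"
    unfolding Q_def by blast
  have min: "poly p \<alpha> \<noteq> 0" if "(p, q) \<in> poly_graph S" "p \<noteq> 0" "degree p < degree m" for p q
    using that not_less_Least[of "degree p" Q] m(4) unfolding Q_def by auto
  have deg: "degree m' = degree m" and m': "m' \<noteq> 0"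
    using poly_graph_degree[OF m(1)] m(2) by auto
  have "degree m \<noteq> 0"
    using m(2,3) by (metis degree_eq_zeroE poly_const_conv pCons_eq_0_iff)
  then obtain \<beta> where \<beta>: "poly m' \<beta> = 0"
    using alg_closed[of m'] deg by auto

  \<comment> \<open>\<open>m'\<close> is minimal at \<open>\<beta>\<close>, because \<open>m\<close> is irreducible over the domain of \<open>S\<close>.\<close>
  define Q' where "Q' k \<longleftrightarrow> (\<exists>p q. (p, q) \<in> poly_graph S \<and> q \<noteq> 0 \<and> poly q \<beta> = 0 \<and> degree q = k)" for k
  have "Q' (degree m')"
    using m m' \<beta> unfolding Q'_def by blast
  then have "Q' (LEAST k. Q' k)"
    by (rule LeastI)
  then obtain l l' where l: "(l, l') \<in> poly_graph S" "l' \<noteq> 0" "poly l' \<beta> = 0"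
      "degree l' = (LEAST k. Q' k)"
    unfolding Q'_def by blast
  have min': "poly q \<beta> \<noteq> 0" if "(p, q) \<in> poly_graph S" "q \<noteq> 0" "degree q < degree l'" for p q
    using that not_less_Least[of "degree q" Q'] l(4) unfolding Q'_def by auto
  have l0: "l \<noteq> 0" and degl: "degree l = degree l'"
    using poly_graph_degree[OF l(1)] l(2) by auto
  have degl0: "degree l' \<noteq> 0"
    using l(2,3) by (metis degree_eq_zeroE poly_const_conv pCons_eq_0_iff)
  have "poly (m' mod l') \<beta> = 0"
    using \<beta> l(3) by (metis add_0 div_mult_mod_eq mult_zero_right poly_add poly_mult)
  then have "m' mod l' = 0"
    using min' poly_graph_div_mod[OF l(1) m(1)] degree_mod_less'[OF l(2), of m']
    by blast
  then have "m mod l = 0"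
    using poly_graph_degree(2) poly_graph_div_mod[OF l(1) m(1)] by metis
  then have ml: "m = (m div l) * l"
    by (metis div_mult_mod_eq add.right_neutral)
  have degm: "degree m = degree (m div l) + degree l"
    using ml m(2) degree_mult_eq[of "m div l" l] by (metis mult_zero_left mult_zero_right)
  have dl: "degree l = degree m"
  proof (rule ccontr)
    assume "degree l \<noteq> degree m"
    then have "degree l < degree m"
      using degm by simp
    then have "poly l \<alpha> \<noteq> 0"
      using min l(1) l0 by blast
    moreover have "poly (m div l) \<alpha> * poly l \<alpha> = 0"
      using m(3) ml by (metis poly_mult)
    ultimately have "poly (m div l) \<alpha> = 0"
      by simp
    moreover have "degree (m div l) < degree m"
      using degm degl degl0 by simp
    ultimately show False
      using min poly_graph_div_mod[OF l(1) m(1)] ml m(2) by (metis mult_zero_left)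
  qed

  have iff: "poly p \<alpha> = 0 \<longleftrightarrow> poly q \<beta> = 0" if pq: "(p, q) \<in> poly_graph S" for p q
  proof -
    note dm = poly_graph_div_mod[OF m(1) pq]
    have "poly p \<alpha> = poly (p mod m) \<alpha>"
      using m(3) by (metis add_0 div_mult_mod_eq mult_zero_right poly_add poly_mult)
    also have "\<dots> = 0 \<longleftrightarrow> p mod m = 0"
      using min dm degree_mod_less'[OF m(2), of p] by (metis poly_0)
    also have "\<dots> \<longleftrightarrow> q mod m' = 0"
      by (rule poly_graph_degree(2)) (use dm in blast)
    also have "\<dots> \<longleftrightarrow> poly (q mod m') \<beta> = 0"
      using min' dm degree_mod_less'[OF m', of q] deg dl degl by (metis poly_0)
    also have "poly (q mod m') \<beta> = poly q \<beta>"
      using \<beta> by (metis add_0 div_mult_mod_eq mult_zero_right poly_add poly_mult)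
    finally show ?thesis .
  qed

  define S' where "S' = {(poly p \<alpha> / poly r \<alpha>, poly q \<beta> / poly s \<beta>) | p q r s.
      (p, q) \<in> poly_graph S \<and> (r, s) \<in> poly_graph S \<and> poly r \<alpha> \<noteq> 0}"
  have S'I: "(x, y) \<in> S'"
    if "x = poly p \<alpha> / poly r \<alpha>" "y = poly q \<beta> / poly s \<beta>"
      "(p, q) \<in> poly_graph S" "(r, s) \<in> poly_graph S" "poly r \<alpha> \<noteq> 0" for x y p q r s
    using that unfolding S'_def by blast
  have one: "(1, 1) \<in> poly_graph S"
    unfolding one_pCons by (simp add: poly_graph_pCons_iff poly_graph_0 hom_graphD[OF S])
  have "S \<subseteq> S'"
  proof
    fix z assume "z \<in> S"
    moreover obtain x y where "z = (x, y)" by fastforce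
    ultimately show "z \<in> S'"
      using one by (auto intro!: S'I[of _ "[:x:]" 1 _ "[:y:]" 1] simp: poly_graph_pCons_iff poly_graph_0)
  qed
  moreover have "\<alpha> \<in> Domain S'"
    using one by (auto intro!: S'I[of _ "[:0, 1:]" 1 _ "[:0, 1:]" 1] DomainI[of _ \<beta>]
        simp: poly_graph_pCons_iff poly_graph_0 hom_graphD[OF S])
  moreover have "hom_graph S'"
    unfolding hom_graph_def
  proof (intro conjI allI impI)
    show "(1, 1) \<in> S'"
      using one by (auto intro!: S'I[of _ 1 1 _ 1 1])
  next
    fix x y assume "(x, y) \<in> S'"
    then show "x = 0 \<longleftrightarrow> y = 0"
      unfolding S'_def using iff by auto
  next
    fix x y x' y' assume "(x, y) \<in> S'" "(x', y') \<in> S'"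
    then obtain p q r s p' q' r' s' where
      1: "x = poly p \<alpha> / poly r \<alpha>" "y = poly q \<beta> / poly s \<beta>"
      "(p, q) \<in> poly_graph S" "(r, s) \<in> poly_graph S" "poly r \<alpha> \<noteq> 0" and
      2: "x' = poly p' \<alpha> / poly r' \<alpha>" "y' = poly q' \<beta> / poly s' \<beta>"
      "(p', q') \<in> poly_graph S" "(r', s') \<in> poly_graph S" "poly r' \<alpha> \<noteq> 0"
      unfolding S'_def by blast
    have nz: "poly s \<beta> \<noteq> 0" "poly s' \<beta> \<noteq> 0"
      using 1 2 iff by auto
    show "(x + x', y + y') \<in> S'"
      by (rule S'I[of _ "p * r' + p' * r" "r * r'" _ "q * s' + q' * s" "s * s'"])
         (use 1(3-) 2(3-) nz in \<open>auto simp: 1(1,2) 2(1,2) field_simps intro!: poly_graph_add poly_graph_mult\<close>)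
    show "(x - x', y - y') \<in> S'"
      by (rule S'I[of _ "p * r' - p' * r" "r * r'" _ "q * s' - q' * s" "s * s'"])
         (use 1(3-) 2(3-) nz in \<open>auto simp: 1(1,2) 2(1,2) field_simps intro!: poly_graph_diff poly_graph_mult\<close>)
    show "(x * x', y * y') \<in> S'"
      by (rule S'I[of _ "p * p'" "r * r'" _ "q * q'" "s * s'"])
         (use 1(3-) 2(3-) nz in \<open>auto simp: 1(1,2) 2(1,2) field_simps intro!: poly_graph_mult\<close>)
    show "(x / x', y / y') \<in> S'"
    proof (cases "poly p' \<alpha> = 0")
      \<comment> \<open>By the convention \<open>x / 0 = 0\<close> both quotients vanish together
        here.\<close>
      case True
      then have "x / x' = 0" "y / y' = 0"
        using 2 iff[of p' q'] by auto
      then show ?thesis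
        using \<open>S \<subseteq> S'\<close> hom_graphD(2)[OF S] by auto
    next
      case False
      then have "poly q' \<beta> \<noteq> 0"
        using iff 2 by blast
      then show ?thesis
        by (intro S'I[of _ "p * r'" "r * p'" _ "q * s'" "s * q'"])
           (use 1(3-) 2(3-) nz False in \<open>auto simp: 1(1,2) 2(1,2) field_simps intro!: poly_graph_mult\<close>)
    qed
  qed
  ultimately show thesis
    using that by blast
qed

end

text \<open>Zorn's lemma on graphs over the base. A maximal graph has full domain: every element of
  the closure is algebraic and the target is algebraically closed, so
  \<open>hom_graph_adjoin\<close> would otherwise enlarge it.\<close>

lemma alg_closure_hom_ext:
  fixes h :: "'a::field \<Rightarrow> 'b::alg_closed_field"
  assumes "unital_hom h"
  obtains H :: "'a alg_closure \<Rightarrow> 'b" where "unital_hom H" "\<And>a. H (to_ac a) = h a"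
proof -
  interpret h: unital_hom h by fact
  define S0 where "S0 = range (\<lambda>a. (to_ac a, h a))"
  define \<C> where "\<C> = {S. hom_graph S \<and> S0 \<subseteq> S}"
  have h0: "h x = 0 \<longleftrightarrow> x = 0" for x
    using unital_hom_eq_0_iff[OF assms unital_hom_inj[OF assms]] .
  have S0I: "x = to_ac a \<Longrightarrow> y = h a \<Longrightarrow> (x, y) \<in> S0" for x y a
    by (auto simp: S0_def)
  have "hom_graph S0"
    unfolding hom_graph_def
  proof (intro conjI allI impI)
    show "(1, 1) \<in> S0"
      by (rule S0I[of _ 1]) auto
  next
    fix x y x' y' assume "(x, y) \<in> S0" "(x', y') \<in> S0"
    then obtain a a' where "x = to_ac a" "y = h a" "x' = to_ac a'" "y' = h a'"
      by (auto simp: S0_def)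
    then show "(x + x', y + y') \<in> S0" "(x - x', y - y') \<in> S0" "(x * x', y * y') \<in> S0"
        "(x / x', y / y') \<in> S0"
      using S0I[OF refl refl, of "a + a'"] S0I[OF refl refl, of "a - a'"]
        S0I[OF refl refl, of "a * a'"] S0I[OF refl refl, of "a / a'"]
      by (simp_all add: unital_hom_divide[OF assms])
  qed (auto simp: S0_def h0)
  then have ne: "\<C> \<noteq> {}"
    by (auto simp: \<C>_def)
  have "\<exists>S\<in>\<C>. \<forall>T\<in>\<C>. S \<subseteq> T \<longrightarrow> T = S"
  proof (rule subset_Zorn_nonempty[OF ne])
    fix C assume C: "C \<noteq> {}" "subset.chain \<C> C"
    then have CC: "hom_graph S \<and> S0 \<subseteq> S" if "S \<in> C" for S
      using that unfolding subset_chain_def \<C>_def by blast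
    have tot: "S \<subseteq> T \<or> T \<subseteq> S" if "S \<in> C" "T \<in> C" for S T
      using C that unfolding subset_chain_def by blast
    have "hom_graph (\<Union>C)"
      unfolding hom_graph_def
    proof (intro conjI allI impI)
      show "(1, 1) \<in> \<Union>C"
        using C(1) CC hom_graphD(1) by fast
    next
      fix x y assume "(x, y) \<in> \<Union>C"
      then obtain S where "S \<in> C" "(x, y) \<in> S"
        by blast
      then show "x = 0 \<longleftrightarrow> y = 0"
        using CC hom_graphD(7)[of S x y] by blast
    next
      fix x y x' y' assume "(x, y) \<in> \<Union>C" "(x', y') \<in> \<Union>C"
      then obtain S T where "S \<in> C" "T \<in> C" "(x, y) \<in> S" "(x', y') \<in> T"
        by blast
      then obtain U where U: "U \<in> C" "(x, y) \<in> U" "(x', y') \<in> U"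
        using tot by blast
      have "hom_graph U"
        using CC U by blast
      from hom_graphD(3-6)[OF this U(2,3)] U(1)
      show "(x + x', y + y') \<in> \<Union>C" "(x - x', y - y') \<in> \<Union>C" "(x * x', y * y') \<in> \<Union>C"
        "(x / x', y / y') \<in> \<Union>C"
        by blast+
    qed
    moreover have "S0 \<subseteq> \<Union>C"
      using C(1) CC by blast
    ultimately show "\<Union>C \<in> \<C>"
      by (simp add: \<C>_def)
  qed
  then obtain S where S_in: "S \<in> \<C>" and maximal: "\<forall>T\<in>\<C>. S \<subseteq> T \<longrightarrow> T = S"
    by (rule bexE)
  have S: "hom_graph S" "S0 \<subseteq> S"
    using S_in by (simp_all add: \<C>_def)
  have max: "T = S" if "hom_graph T" "S \<subseteq> T" for T
    using maximal that S(2) by (simp add: \<C>_def)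
  have dom: "x \<in> Domain S" for x
  proof -
    obtain p where p: "p \<noteq> 0" "poly (map_poly to_ac p) x = 0"
      by (rule alg_closure_algebraic)
    have pg: "(map_poly to_ac p, map_poly h p) \<in> poly_graph S"
      using S(2) S0I[OF refl refl] by (simp add: poly_graph_def coeff_map_poly subset_iff)
    have nz: "map_poly to_ac p \<noteq> 0"
      using p(1) by (simp add: poly_eq_iff coeff_map_poly)
    obtain S' where S': "hom_graph S'" "S \<subseteq> S'" "x \<in> Domain S'"
      by (rule hom_graph_adjoin[OF S(1) pg nz p(2) alg_closed_imp_poly_has_root])
    then show ?thesis
      using max[OF S'(1,2)] by simp
  qed
  have functional: "y = y'" if "(x, y) \<in> S" "(x, y') \<in> S" for x y y'
    using hom_graphD(4)[OF S(1) that] hom_graphD(7)[OF S(1), of "x - x" "y - y'"] by simp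
  define H where "H x = (THE y. (x, y) \<in> S)" for x
  have H: "(x, H x) \<in> S" for x
  proof -
    obtain y where y: "(x, y) \<in> S"
      using dom[of x] by blast
    show ?thesis
      unfolding H_def using y by (rule theI) (rule functional[OF _ y])
  qed
  have "unital_hom H"
  proof
    show "H 1 = 1"
      using functional[OF H hom_graphD(1)[OF S(1)]] .
    show "H (x + y) = H x + H y" "H (x * y) = H x * H y" for x y
      using functional[OF H hom_graphD(3)[OF S(1) H[of x] H[of y]]]
        functional[OF H hom_graphD(5)[OF S(1) H[of x] H[of y]]] by simp_all
  qed
  moreover have "H (to_ac a) = h a" for a
    using functional[OF H, of "to_ac a" "h a"] S(2) S0I[OF refl refl, of a] by blast
  ultimately show thesis
    using that by blast
qed

lemma idom_hom_ext:
  fixes h :: "'a::idom \<Rightarrow> 'b::alg_closed_field"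
  assumes "unital_hom h" "inj h"
  obtains H :: "'a fract alg_closure \<Rightarrow> 'b"
  where "unital_hom H" "\<And>a. H (to_ac (frac_of a)) = h a"
proof -
  obtain H where H: "unital_hom H" "\<And>a. H (frac_of a) = h a"
    using fract_hom_ext[OF assms] by blast
  then show thesis
    by (metis alg_closure_hom_ext that)
qed

section \<open>Evaluation of multivariate polynomials\<close>

definition mvar :: "nat \<Rightarrow> 'k::field mpoly" where
  "mvar i = Poly_Mapping.single (Poly_Mapping.single i 1) 1"

definition mconst :: "'k::field \<Rightarrow> 'k mpoly" where
  "mconst c = Poly_Mapping.single 0 c"

lemma indet_conv_mvar: "indet i = frac_of (mvar i)"
  by (simp add: indet_def frac_of_def mvar_def)

lemma cst_conv_mconst: "cst c = frac_of (mconst c)"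
  by (simp add: cst_def frac_of_def mconst_def)

lemma unital_hom_mconst: "unital_hom mconst"
  by unfold_locales (simp_all add: mconst_def single_add mult_single)

lemma unital_hom_cst: "unital_hom cst"
  unfolding cst_conv_mconst[abs_def]
  by (rule unital_hom_comp[OF unital_hom_frac_of unital_hom_mconst])

lemma update_conv_add:
  fixes f :: "'a \<Rightarrow>\<^sub>0 'b::comm_monoid_add"
  assumes "k \<notin> Poly_Mapping.keys f"
  shows "Poly_Mapping.update k v f = f + Poly_Mapping.single k v"
  using assms by (intro poly_mapping_eqI) (auto simp: lookup_update lookup_add lookup_single in_keys_iff when_def)

lemma poly_mapping_single_induct:
  fixes f :: "'a \<Rightarrow>\<^sub>0 'b::comm_monoid_add"
  assumes "P 0" "\<And>f k v. P f \<Longrightarrow> P (f + Poly_Mapping.single k v)"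
  shows "P f"
  by (induction f rule: update_induct) (auto simp: update_conv_add assms)

definition mono_eval :: "(nat \<Rightarrow> 'a::comm_ring_1) \<Rightarrow> (nat \<Rightarrow>\<^sub>0 nat) \<Rightarrow> 'a" where
  "mono_eval x m = (\<Prod>i\<in>Poly_Mapping.keys m. x i ^ Poly_Mapping.lookup m i)"

lemma mono_eval_superset:
  assumes "finite I" "Poly_Mapping.keys m \<subseteq> I"
  shows "mono_eval x m = (\<Prod>i\<in>I. x i ^ Poly_Mapping.lookup m i)"
  unfolding mono_eval_def using assms by (intro prod.mono_neutral_left) (auto simp: in_keys_iff)

lemma mono_eval_0 [simp]: "mono_eval x 0 = 1"
  by (simp add: mono_eval_def)

lemma mono_eval_single [simp]: "mono_eval x (Poly_Mapping.single i n) = x i ^ n"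
  by (subst mono_eval_superset[of "{i}"]) auto

lemma mono_eval_add [simp]: "mono_eval x (m + m') = mono_eval x m * mono_eval x m'"
proof -
  let ?I = "Poly_Mapping.keys m \<union> Poly_Mapping.keys m'"
  have "mono_eval x (m + m') = (\<Prod>i\<in>?I. x i ^ Poly_Mapping.lookup (m + m') i)"
    using keys_add[of m m'] by (intro mono_eval_superset) auto
  also have "\<dots> = (\<Prod>i\<in>?I. x i ^ Poly_Mapping.lookup m i) * (\<Prod>i\<in>?I. x i ^ Poly_Mapping.lookup m' i)"
    by (simp add: lookup_add power_add prod.distrib)
  also have "\<dots> = mono_eval x m * mono_eval x m'"
    by (subst (1 2) mono_eval_superset[of ?I]) auto
  finally show ?thesis .
qed

definition mpoly_eval :: "('k::field \<Rightarrow> 'a::comm_ring_1) \<Rightarrow> (nat \<Rightarrow> 'a) \<Rightarrow> 'k mpoly \<Rightarrow> 'a" where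
  "mpoly_eval c x P = (\<Sum>m\<in>Poly_Mapping.keys P. c (Poly_Mapping.lookup P m) * mono_eval x m)"

context
  fixes c :: "'k::field \<Rightarrow> 'a::comm_ring_1"
  assumes c: "unital_hom c"
begin

interpretation c: unital_hom c by (rule c)

lemma mpoly_eval_single [simp]: "mpoly_eval c x (Poly_Mapping.single m a) = c a * mono_eval x m"
  by (cases "a = 0") (simp_all add: mpoly_eval_def)

lemma mpoly_eval_add [simp]: "mpoly_eval c x (P + Q) = mpoly_eval c x P + mpoly_eval c x Q"
  unfolding mpoly_eval_def by (rule setsum_keys_plus_distrib) (auto simp: algebra_simps)

lemma mpoly_eval_mult_single:
  "mpoly_eval c x (P * Poly_Mapping.single m a) = mpoly_eval c x P * mpoly_eval c x (Poly_Mapping.single m a)"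
proof (induction P rule: poly_mapping_single_induct)
  case 1
  show ?case by (simp add: mpoly_eval_def)
qed (simp_all add: distrib_right mult_single algebra_simps)

lemma mpoly_eval_mult: "mpoly_eval c x (P * Q) = mpoly_eval c x P * mpoly_eval c x Q"
proof (induction Q rule: poly_mapping_single_induct)
  case 1
  show ?case by (simp add: mpoly_eval_def)
qed (simp_all add: distrib_left mpoly_eval_mult_single del: mpoly_eval_single)

lemma unital_hom_mpoly_eval: "unital_hom (mpoly_eval c x)"
proof
  show "mpoly_eval c x 1 = 1"
    unfolding single_one[symmetric] by (simp del: single_one)
qed (simp_all add: mpoly_eval_mult)

lemma mpoly_eval_mconst [simp]: "mpoly_eval c x (mconst a) = c a"
  by (simp add: mconst_def)

lemma mpoly_eval_mvar [simp]: "mpoly_eval c x (mvar i) = x i"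
  by (simp add: mvar_def)

end

lemma mono_eval_mvar: "mono_eval (mvar :: nat \<Rightarrow> 'k::field mpoly) m = Poly_Mapping.single m 1"
proof (induction m rule: poly_mapping_single_induct)
  case 1
  show ?case by simp
next
  case (2 m i n)
  have "(mvar i :: 'k mpoly) ^ n = Poly_Mapping.single (Poly_Mapping.single i n) 1"
    by (induction n) (simp_all add: mvar_def mult_single single_add[symmetric])
  with 2 show ?case
    by (simp add: mult_single)
qed

lemma mpoly_induct [case_names const var add mult]:
  assumes "\<And>c. P (mconst c)" "\<And>i. P (mvar i)"
    and "\<And>p q. P p \<Longrightarrow> P q \<Longrightarrow> P (p + q)" "\<And>p q. P p \<Longrightarrow> P q \<Longrightarrow> P (p * q)"
  shows "P (p :: 'k::field mpoly)"
proof (induction p rule: poly_mapping_single_induct)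
  case 1
  show ?case
    using assms(1)[of 0] by (simp add: mconst_def)
next
  case (2 p m a)
  have pow: "P (x ^ n)" if "P x" for x n
    using that assms(1)[of 1] assms(4) by (induction n) (simp_all add: mconst_def)
  have "P (\<Prod>i\<in>I. mvar i ^ f i)" for I and f :: "nat \<Rightarrow> nat"
    using assms(1)[of 1] by (induction I rule: infinite_finite_induct)
      (auto simp: mconst_def intro: assms pow)
  then have "P (mono_eval mvar m)"
    by (simp add: mono_eval_def)
  then have "P (mconst a * mono_eval mvar m)"
    using assms by blast
  then have "P (Poly_Mapping.single m a)"
    by (simp add: mono_eval_mvar mconst_def mult_single)
  then show ?case
    using 2 assms by blast
qed

lemma mpoly_hom_eqI:
  assumes "unital_hom g" "unital_hom h" "\<And>c. g (mconst c) = h (mconst c)"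
    "\<And>i. g (mvar i) = h (mvar i)"
  shows "g p = h p"
  by (induction p rule: mpoly_induct)
     (simp_all add: assms unital_hom.add[OF assms(1)] unital_hom.add[OF assms(2)]
       unital_hom.mult[OF assms(1)] unital_hom.mult[OF assms(2)])

lemma inj_unital_homI:
  assumes "unital_hom h" "\<And>x. h x = 0 \<Longrightarrow> x = 0"
  shows "inj h"
  by (rule injI) (metis assms unital_hom.diff eq_iff_diff_eq_0)

lemma lookup_sum_single:
  assumes "finite A"
  shows "Poly_Mapping.lookup (\<Sum>m\<in>A. Poly_Mapping.single m (f m)) k = (if k \<in> A then f k else 0)"
  using assms by (auto simp: lookup_sum lookup_single when_def)

lemma inj_coeff_embedding:
  "inj (mpoly_eval (\<lambda>a. mconst (to_ac a)) mvar :: 'k::field mpoly \<Rightarrow> 'k alg_closure mpoly)"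
proof (rule inj_unital_homI)
  let ?h = "\<lambda>a::'k. mconst (to_ac a)"
  have h: "unital_hom ?h"
    by (rule unital_hom_comp[OF unital_hom_mconst unital_hom_to_ac])
  show "unital_hom (mpoly_eval ?h mvar)"
    by (rule unital_hom_mpoly_eval[OF h])
  fix p :: "'k mpoly" assume "mpoly_eval ?h mvar p = 0"
  then have "(\<Sum>m\<in>Poly_Mapping.keys p. Poly_Mapping.single m (to_ac (Poly_Mapping.lookup p m))) = 0"
    by (simp add: mpoly_eval_def mono_eval_mvar mconst_def mult_single)
  then have "Poly_Mapping.lookup p k = 0" for k
    using lookup_sum_single[of "Poly_Mapping.keys p" "\<lambda>m. to_ac (Poly_Mapping.lookup p m)" k]
    by (auto simp: in_keys_iff split: if_splits)
  then show "p = 0"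
    by (intro poly_mapping_eqI) simp
qed

text \<open>Substituting \<open>\<tau>\<cdot>z\<^sub>i\<close> for the variables separates the homogeneous components.\<close>

lemma inj_graded_eval:
  "inj (mpoly_eval (\<lambda>a. fps_const (cst a)) (\<lambda>i. fps_X * fps_const (indet i))
     :: 'k::field mpoly \<Rightarrow> 'k ratfun fps)"
proof (rule inj_unital_homI)
  let ?c = "\<lambda>a::'k. fps_const (cst a)"
  let ?x = "\<lambda>i. fps_X * fps_const (indet i :: 'k ratfun)"
  have const: "unital_hom (fps_const :: 'k ratfun \<Rightarrow> _)"
    by unfold_locales simp_all
  then have c: "unital_hom ?c"
    by (rule unital_hom_comp[OF _ unital_hom_cst])
  show "unital_hom (mpoly_eval ?c ?x)"
    by (rule unital_hom_mpoly_eval[OF c])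
  fix p :: "'k mpoly" assume 0: "mpoly_eval ?c ?x p = 0"
  \<comment> \<open>Total degree. The coefficient of \<open>fps_X ^ N\<close> in the image is the
    homogeneous component of degree \<open>N\<close>, so the components can be read off one at a
    time.\<close>
  define wt where "wt m = (\<Sum>i\<in>Poly_Mapping.keys m. Poly_Mapping.lookup m i)" for m :: "nat \<Rightarrow>\<^sub>0 nat"
  have mono: "mono_eval ?x m = fps_X ^ wt m * fps_const (frac_of (Poly_Mapping.single m 1))" for m
  proof -
    have "mono_eval ?x m = fps_X ^ wt m * fps_const (mono_eval indet m)"
      by (simp add: mono_eval_def power_mult_distrib prod.distrib power_sum wt_def
          unital_hom.prod[OF const] fps_const_power)
    also have "mono_eval indet m = (frac_of (mono_eval mvar m) :: 'k ratfun)"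
      by (simp add: mono_eval_def indet_conv_mvar unital_hom.prod[OF unital_hom_frac_of]
          unital_hom.power[OF unital_hom_frac_of])
    finally show ?thesis
      by (simp add: mono_eval_mvar)
  qed
  have coeff_term: "fps_nth (?c a * mono_eval ?x m) N = (if wt m = N then frac_of (Poly_Mapping.single m a) else 0)"
    for a m N
    by (simp add: mono cst_conv_mconst mconst_def mult.left_commute[of "fps_const _"]
        fps_X_power_mult_nth unital_hom.mult[OF unital_hom_frac_of, symmetric] mult_single)
  have nth: "fps_nth (mpoly_eval ?c ?x p) N =
      frac_of (\<Sum>m\<in>{m \<in> Poly_Mapping.keys p. wt m = N}. Poly_Mapping.single m (Poly_Mapping.lookup p m))" for N
    unfolding mpoly_eval_def fps_sum_nth coeff_term
    by (simp add: unital_hom.sum[OF unital_hom_frac_of] sum.inter_filter[symmetric])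
  have "Poly_Mapping.lookup p k = 0" for k
  proof -
    have "frac_of (\<Sum>m\<in>{m \<in> Poly_Mapping.keys p. wt m = wt k}. Poly_Mapping.single m (Poly_Mapping.lookup p m))
        = (0 :: 'k ratfun)"
      using nth[of "wt k"] 0 by simp
    then have "(\<Sum>m\<in>{m \<in> Poly_Mapping.keys p. wt m = wt k}. Poly_Mapping.single m (Poly_Mapping.lookup p m)) = 0"
      by (simp add: unital_hom_eq_0_iff[OF unital_hom_frac_of inj_frac_of])
    then show ?thesis
      using lookup_sum_single[of "{m \<in> Poly_Mapping.keys p. wt m = wt k}" "Poly_Mapping.lookup p" k]
      by (auto simp: in_keys_iff split: if_splits)
  qed
  then show "p = 0"
    by (intro poly_mapping_eqI) simp
qed

section \<open>Power series with permutable indeterminates\<close>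

type_synonym 'k series = "'k alg_closure ratfun fps"

definition series_const :: "'k alg_closure \<Rightarrow> 'k::field series" where
  "series_const a = fps_const (cst a)"

text \<open>The residue \<open>a i\<close> is a constant while the first-order term is an
  indeterminate: permuting the indeterminates leaves residues alone, and variables with equal
  residue stay distinct.\<close>

definition series_var :: "(nat \<Rightarrow> 'k alg_closure) \<Rightarrow> nat \<Rightarrow> 'k::field series" where
  "series_var a i = series_const (a i) + fps_X * fps_const (indet i)"

definition series_eval :: "(nat \<Rightarrow> 'k alg_closure) \<Rightarrow> 'k::field mpoly \<Rightarrow> 'k series" where
  "series_eval a = mpoly_eval (\<lambda>c. series_const (to_ac c)) (series_var a)"

lemma unital_hom_series_const: "unital_hom (series_const :: _ \<Rightarrow> 'k::field series)"
proof -
  have "unital_hom (fps_const :: 'k alg_closure ratfun \<Rightarrow> _)"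
    by unfold_locales simp_all
  then show ?thesis
    unfolding series_const_def[abs_def] by (rule unital_hom_comp[OF _ unital_hom_cst])
qed

lemma unital_hom_series_const_to_ac: "unital_hom (\<lambda>c. series_const (to_ac c))"
  by (rule unital_hom_comp[OF unital_hom_series_const unital_hom_to_ac])

lemma unital_hom_series_eval: "unital_hom (series_eval a)"
  unfolding series_eval_def by (rule unital_hom_mpoly_eval[OF unital_hom_series_const_to_ac])

lemma series_eval_mvar [simp]: "series_eval a (mvar i) = series_var a i"
  and series_eval_mconst [simp]: "series_eval a (mconst c) = series_const (to_ac c)"
  by (simp_all add: series_eval_def mpoly_eval_mvar mpoly_eval_mconst unital_hom_series_const_to_ac)

text \<open>The evaluation is \<open>E\<close> after \<open>sh\<close>. Here \<open>sh\<close> is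
  injective because translating back with \<open>unsh\<close> leaves the mere extension of
  constants, and \<open>E\<close> separates homogeneous components.\<close>

lemma inj_series_eval: "inj (series_eval a :: 'k::field mpoly \<Rightarrow> 'k series)"
proof -
  define E :: "'k alg_closure mpoly \<Rightarrow> 'k series" where
    "E = mpoly_eval (\<lambda>a. fps_const (cst a)) (\<lambda>i. fps_X * fps_const (indet i))"
  define sh :: "'k mpoly \<Rightarrow> 'k alg_closure mpoly" where
    "sh = mpoly_eval (\<lambda>c. mconst (to_ac c)) (\<lambda>i. mvar i + mconst (a i))"
  define unsh :: "'k alg_closure mpoly \<Rightarrow> 'k alg_closure mpoly" where
    "unsh = mpoly_eval mconst (\<lambda>i. mvar i - mconst (a i))"
  note c1 = unital_hom_series_const[unfolded series_const_def[abs_def]]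
  note c2 = unital_hom_comp[OF unital_hom_mconst unital_hom_to_ac]
  note homs = unital_hom_mpoly_eval[OF c1] unital_hom_mpoly_eval[OF c2]
    unital_hom_mpoly_eval[OF unital_hom_mconst]
  have E: "unital_hom E" and sh: "unital_hom sh" and unsh: "unital_hom unsh"
    unfolding E_def sh_def unsh_def by (rule homs)+
  have "E (sh p) = series_eval a p" for p
  proof (rule mpoly_hom_eqI[OF unital_hom_comp[OF E sh] unital_hom_series_eval])
    show "E (sh (mconst c)) = series_eval a (mconst c)" for c
      by (simp add: sh_def E_def mpoly_eval_mconst c1 c2 series_const_def)
    show "E (sh (mvar i)) = series_eval a (mvar i)" for i
      by (simp add: sh_def mpoly_eval_mvar c2 unital_hom.add[OF E])
         (simp add: E_def mpoly_eval_mvar mpoly_eval_mconst c1 series_var_def series_const_def)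
  qed
  moreover have "unsh (sh p) = mpoly_eval (\<lambda>a. mconst (to_ac a)) mvar p" for p
  proof (rule mpoly_hom_eqI[OF unital_hom_comp[OF unsh sh] homs(2)])
    show "unsh (sh (mconst c)) = mpoly_eval (\<lambda>a. mconst (to_ac a)) mvar (mconst c)" for c :: 'k
      by (simp add: sh_def unsh_def mpoly_eval_mconst c2 unital_hom_mconst)
    show "unsh (sh (mvar i)) = mpoly_eval (\<lambda>a. mconst (to_ac a :: 'k alg_closure)) mvar (mvar i)" for i
      by (simp add: sh_def mpoly_eval_mvar c2 unital_hom.add[OF unsh])
         (simp add: unsh_def mpoly_eval_mvar mpoly_eval_mconst unital_hom_mconst)
  qed
  then have "inj sh"
    using inj_coeff_embedding by (metis (mono_tags, lifting) injD injI)
  moreover have "inj E"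
    unfolding E_def by (rule inj_graded_eval)
  ultimately show ?thesis
    by (metis (mono_tags, lifting) injD injI)
qed

lemma unital_hom_fps_map:
  assumes "unital_hom q"
  shows "unital_hom (\<lambda>w. Abs_fps (\<lambda>n. q (fps_nth w n)))"
proof -
  interpret unital_hom q by fact
  show ?thesis
    by unfold_locales (auto simp: fps_eq_iff fps_mult_nth)
qed

text \<open>The permutation of the indeterminates acts on every coefficient of a series. The last
  clause later pins down Hensel lifts: a constant residue survives, and a lift is determined by its
  residue.\<close>

lemma series_perm_hom:
  assumes "bij \<pi>"
  obtains T :: "'k::field series \<Rightarrow> 'k series"
  where "unital_hom T" "inj T" "\<And>f. T (series_const f) = series_const f"
    "\<And>a i. a (\<pi> i) = a i \<Longrightarrow> T (series_var a i) = series_var a (\<pi> i)"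
    "\<And>w r. fps_nth w 0 = cst r \<Longrightarrow> fps_nth (T w) 0 = cst r"
proof -
  define pm :: "(nat \<Rightarrow> nat) \<Rightarrow> 'k alg_closure mpoly \<Rightarrow> 'k alg_closure mpoly" where
    "pm \<rho> = mpoly_eval mconst (\<lambda>i. mvar (\<rho> i))" for \<rho>
  have pm: "unital_hom (pm \<rho>)" for \<rho>
    unfolding pm_def by (rule unital_hom_mpoly_eval[OF unital_hom_mconst])
  have pmc: "pm \<rho> (mconst c) = mconst c" and pmv: "pm \<rho> (mvar i) = mvar (\<rho> i)" for \<rho> c i
    by (simp_all add: pm_def mpoly_eval_mconst mpoly_eval_mvar unital_hom_mconst)
  have "pm (inv_into UNIV \<pi>) (pm \<pi> p) = id p" for p
    by (rule mpoly_hom_eqI[OF unital_hom_comp[OF pm pm]])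
       (use assms in \<open>auto simp: pmc pmv unital_hom_def bij_is_inj\<close>)
  then have inj_pm: "inj (pm \<pi>)"
    by (metis id_apply injI)
  have "unital_hom (\<lambda>p. frac_of (pm \<pi> p))"
    by (rule unital_hom_comp[OF unital_hom_frac_of pm])
  moreover have "inj (\<lambda>p. frac_of (pm \<pi> p))"
    by (rule injI) (metis injD inj_pm inj_frac_of)
  ultimately obtain q :: "'k alg_closure ratfun \<Rightarrow> 'k alg_closure ratfun" where
    q: "unital_hom q" "\<And>p. q (frac_of p) = frac_of (pm \<pi> p)"
    using fract_hom_ext by blast
  have qc: "q (cst f) = cst f" and qv: "q (indet i) = indet (\<pi> i)" for f i
    by (simp_all add: q cst_conv_mconst indet_conv_mvar pmc pmv)
  have q0: "q 0 = 0" and q1: "q 1 = 1"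
    using unital_hom.zero[OF q(1)] unital_hom.one[OF q(1)] by auto
  define T where "T w = Abs_fps (\<lambda>n. q (fps_nth w n))" for w
  have T: "unital_hom T"
    unfolding T_def[abs_def] by (rule unital_hom_fps_map[OF q(1)])
  have Tc: "T (fps_const r) = fps_const (q r)" for r
    by (auto simp: T_def fps_eq_iff q0)
  have TX: "T fps_X = fps_X"
    by (auto simp: T_def fps_eq_iff fps_X_def q0 q1)
  show thesis
  proof (rule that[OF T])
    show "inj T"
      using unital_hom_inj[OF q(1)] by (auto simp: T_def inj_def fps_eq_iff)
    show Tsc: "T (series_const f) = series_const f" for f
      by (simp add: series_const_def Tc qc)
    show "T (series_var a i) = series_var a (\<pi> i)" if "a (\<pi> i) = a i" for a i
      using that by (simp add: series_var_def unital_hom.add[OF T] unital_hom.mult[OF T] Tsc TX Tc qv)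
    show "fps_nth (T w) 0 = cst r" if "fps_nth w 0 = cst r" for w r
      using that by (simp add: T_def qc)
  qed
qed

section \<open>Hensel's lemma for power series\<close>

lemma poly_taylor2:
  fixes p :: "'a::idom poly"
  shows "\<exists>s. poly p (x + e) = poly p x + poly (pderiv p) x * e + e ^ 2 * s"
proof (induction p)
  case 0
  show ?case by simp
next
  case (pCons a p)
  then obtain s where s: "poly p (x + e) = poly p x + poly (pderiv p) x * e + e ^ 2 * s"
    by blast
  have "poly (pCons a p) (x + e) = poly (pCons a p) x + poly (pderiv (pCons a p)) x * e +
      e ^ 2 * (x * s + poly (pderiv p) x + e * s)"
    unfolding poly_pCons s pderiv_pCons poly_add by (simp add: algebra_simps power2_eq_square)
  then show ?case by blast
qed

lemma unital_hom_fps_nth_0: "unital_hom (\<lambda>w::'a::comm_ring_1 fps. fps_nth w 0)"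
  by unfold_locales simp_all

lemma map_poly_pderiv:
  fixes h :: "'a::idom \<Rightarrow> 'b::idom"
  assumes "unital_hom h"
  shows "map_poly h (pderiv p) = pderiv (map_poly h p)"
proof -
  interpret unital_hom h by fact
  have "h (of_nat n) = of_nat n" for n
    by (induction n) auto
  then show ?thesis
    by (intro poly_eqI) (simp add: coeff_map_poly coeff_pderiv del: of_nat_Suc)
qed

lemma fps_hensel:
  fixes p :: "'a::field fps poly"
  defines "p0 \<equiv> map_poly (\<lambda>w. fps_nth w 0) p"
  assumes root: "poly p0 r0 = 0" and simple: "poly (pderiv p0) r0 \<noteq> 0"
  shows "\<exists>r. poly p r = 0 \<and> fps_nth r 0 = r0"
proof -
  interpret c0: unital_hom "\<lambda>w::'a fps. fps_nth w 0"
    by (rule unital_hom_fps_nth_0)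
  define P where "P k r \<longleftrightarrow> fps_nth r 0 = r0 \<and> (\<forall>i\<le>k. fps_nth (poly p r) i = 0)" for k r
  define Q where "Q k r r' \<longleftrightarrow> (\<exists>c. r' = r + fps_X ^ Suc k * fps_const c)" for k :: nat and r r' :: "'a fps"
  have "\<exists>f. \<forall>k. P k (f k) \<and> Q k (f k) (f (Suc k))"
  proof (rule dependent_nat_choice)
    show "\<exists>r. P 0 r"
      using root c0.poly_map_poly[of p "fps_const r0"] unfolding P_def p0_def
      by (intro exI[of _ "fps_const r0"]) simp
  next
    fix r k assume r: "P k r"
    have "fps_nth (poly (pderiv p) r) 0 = poly (pderiv p0) r0"
      using c0.poly_map_poly[of "pderiv p" r] r
      by (simp add: P_def p0_def map_poly_pderiv[OF unital_hom_fps_nth_0])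
    then have d0: "fps_nth (poly (pderiv p) r) 0 \<noteq> 0"
      using simple by simp
    \<comment> \<open>Newton step: \<open>e\<close> has order at least \<open>k + 1\<close> and
      \<open>e ^ 2\<close> order at least \<open>2 * k + 2\<close>, so only the linear term reaches
      the coefficient of index \<open>k + 1\<close>, which \<open>c\<close> cancels.\<close>
    define c where "c = - fps_nth (poly p r) (Suc k) / fps_nth (poly (pderiv p) r) 0"
    define e where "e = fps_X ^ Suc k * fps_const c"
    obtain s where s: "poly p (r + e) = poly p r + poly (pderiv p) r * e + e ^ 2 * s"
      using poly_taylor2 by blast
    have e2: "e ^ 2 * s = fps_X ^ (Suc k + Suc k) * (fps_const c ^ 2 * s)"
      by (simp add: e_def power2_eq_square power_add algebra_simps)
    have e1: "poly (pderiv p) r * e = fps_X ^ Suc k * (fps_const c * poly (pderiv p) r)"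
      by (simp add: e_def algebra_simps)
    have "fps_nth (poly p (r + e)) i = 0" if "i \<le> Suc k" for i
    proof (cases "i = Suc k")
      case True
      then show ?thesis
        unfolding s e1 e2 fps_add_nth fps_X_power_mult_nth using d0 by (simp add: c_def)
    next
      case False
      then show ?thesis
        using that r unfolding s e1 e2 fps_add_nth fps_X_power_mult_nth by (simp add: P_def)
    qed
    moreover have "fps_nth (r + e) 0 = r0"
      using r by (simp add: P_def e_def)
    ultimately show "\<exists>r'. P (Suc k) r' \<and> Q k r r'"
      unfolding P_def Q_def e_def by blast
  qed
  then obtain f where fP: "\<And>k. P k (f k)" and fQ: "\<And>k. Q k (f k) (f (Suc k))"
    by blast
  have step: "fps_nth (f (Suc k)) i = fps_nth (f k) i" if "i \<le> k" for i k
  proof -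
    obtain c where "f (Suc k) = f k + fps_X ^ Suc k * fps_const c"
      using fQ[of k] unfolding Q_def by blast
    then show ?thesis
      using that by (simp add: fps_X_power_mult_nth del: power_Suc)
  qed
  have stable: "fps_nth (f (i + j)) i = fps_nth (f i) i" for i j
    by (induction j) (simp_all add: step)
  \<comment> \<open>The approximations stabilise coefficientwise, so the diagonal is their
    limit.\<close>
  define r where "r = Abs_fps (\<lambda>i. fps_nth (f i) i)"
  have "fps_nth (poly p r) k = 0" for k
  proof -
    have "fps_nth (r - f k) i = 0" if "i \<le> k" for i
      using stable[of i "k - i"] that by (simp add: r_def)
    then have "r - f k = fps_X ^ Suc k * fps_shift (Suc k) (r - f k)"
      by (intro fps_ext) (auto simp: fps_X_power_mult_nth simp del: power_Suc)
    then obtain g where g: "r = f k + fps_X ^ Suc k * g"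
      by (metis add.commute diff_add_cancel)
    obtain s where "poly p r = poly p (f k) + poly (pderiv p) (f k) * (fps_X ^ Suc k * g) + (fps_X ^ Suc k * g) ^ 2 * s"
      unfolding g using poly_taylor2 by blast
    then have "poly p r = poly p (f k) + fps_X ^ Suc k * (poly (pderiv p) (f k) * g + (fps_X ^ Suc k * g) * g * s)"
      by (simp add: power2_eq_square algebra_simps)
    then show ?thesis
      using fP[of k] unfolding P_def by (simp add: fps_X_power_mult_nth del: power_Suc)
  qed
  then have "poly p r = 0"
    by (intro fps_ext) simp
  moreover have "fps_nth r 0 = r0"
    using fP[of 0] by (simp add: r_def P_def)
  ultimately show ?thesis by blast
qed

section \<open>Groups acting on a rooted tree\<close>

text \<open>The vertices supplied by \<open>swap\<close> and \<open>doubly_trans\<close> on one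
  level may differ. Double transitivity also makes the levels transitive, which moves one to the
  other.\<close>

locale tree_action =
  fixes root :: 'o and child :: "'o \<Rightarrow> 'o set" and d n :: nat and \<Gamma> :: "('o \<Rightarrow> 'o) set"
    and lev :: "nat \<Rightarrow> 'o set"
  assumes lev_0: "lev 0 = {root}" and lev_Suc: "lev (Suc j) = (\<Union>y\<in>lev j. child y)"
    and d_gt_1: "d > 1"
    and card_child: "j < n \<Longrightarrow> y \<in> lev j \<Longrightarrow> card (child y) = d"
    and child_unique: "x \<in> child y \<Longrightarrow> x \<in> child y' \<Longrightarrow> y = y'"
    and group_id: "id \<in> \<Gamma>"
    and group_comp: "\<sigma> \<in> \<Gamma> \<Longrightarrow> \<tau> \<in> \<Gamma> \<Longrightarrow> \<sigma> \<circ> \<tau> \<in> \<Gamma>"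
    and group_inv: "\<sigma> \<in> \<Gamma> \<Longrightarrow> inv_into UNIV \<sigma> \<in> \<Gamma>"
    and group_bij: "\<sigma> \<in> \<Gamma> \<Longrightarrow> bij \<sigma>"
    and group_child: "\<sigma> \<in> \<Gamma> \<Longrightarrow> x \<in> child y \<Longrightarrow> \<sigma> x \<in> child (\<sigma> y)"
    and group_root: "\<sigma> \<in> \<Gamma> \<Longrightarrow> \<sigma> root = root"
    and swap: "j < n \<Longrightarrow> \<exists>v\<in>lev j. \<exists>a\<in>child v. \<exists>b\<in>child v. a \<noteq> b \<and>
          (\<exists>\<sigma>\<in>\<Gamma>. \<sigma> a = b \<and> \<sigma> b = a \<and> (\<forall>x\<in>lev (Suc j) - {a, b}. \<sigma> x = x))"
    and doubly_trans: "j < n \<Longrightarrow> \<exists>v\<in>lev j. \<forall>a\<in>child v. \<forall>b\<in>child v. \<forall>a'\<in>child v. \<forall>b'\<in>child v.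
          a \<noteq> b \<longrightarrow> a' \<noteq> b' \<longrightarrow> (\<exists>\<sigma>\<in>\<Gamma>. \<sigma> a = a' \<and> \<sigma> b = b')"
begin

lemma finite_child: "j < n \<Longrightarrow> y \<in> lev j \<Longrightarrow> finite (child y)"
  using card_child d_gt_1 by (metis card.infinite not_one_less_zero)

lemma finite_lev: "j \<le> n \<Longrightarrow> finite (lev j)"
proof (induction j)
  case (Suc j)
  then show ?case
    using finite_child[of j] by (simp add: lev_Suc)
qed (simp add: lev_0)

lemma group_lev:
  assumes "\<sigma> \<in> \<Gamma>" "x \<in> lev j"
  shows "\<sigma> x \<in> lev j"
  using assms(2)
  by (induction j arbitrary: x) (auto simp: lev_0 lev_Suc group_root assms(1) dest: group_child[OF assms(1)])

lemma inv_left: "\<sigma> \<in> \<Gamma> \<Longrightarrow> inv_into UNIV \<sigma> (\<sigma> x) = x"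
  and inv_right: "\<sigma> \<in> \<Gamma> \<Longrightarrow> \<sigma> (inv_into UNIV \<sigma> x) = x"
  using group_bij by (simp_all add: bij_is_inj bij_is_surj surj_f_inv_f)

lemma sibling_exists:
  assumes "j < n" "y \<in> lev j" "a \<in> child y"
  obtains b where "b \<in> child y" "b \<noteq> a"
proof -
  have "card (child y - {a}) = d - 1"
    using assms card_child finite_child by (simp add: card_Diff_singleton)
  then have "child y - {a} \<noteq> {}"
    using d_gt_1 by (metis card.empty zero_less_diff less_numeral_extra(3))
  then show thesis
    using that by blast
qed

text \<open>Move both parents to the vertex \<open>v\<close> of \<open>doubly_trans\<close>, then
  match the children there. Double transitivity speaks of pairs, so a sibling is adjoined on either
  side.\<close>

lemma transitive_lev:
  assumes "j \<le> n" "x \<in> lev j" "y \<in> lev j"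
  shows "\<exists>\<sigma>\<in>\<Gamma>. \<sigma> x = y"
  using assms
proof (induction j arbitrary: x y)
  case 0
  then show ?case
    using group_id by (intro bexI[of _ id]) (auto simp: lev_0)
next
  case (Suc j)
  then have j: "j < n" by simp
  obtain v where v: "v \<in> lev j" and D: "\<forall>a\<in>child v. \<forall>b\<in>child v. \<forall>a'\<in>child v. \<forall>b'\<in>child v.
      a \<noteq> b \<longrightarrow> a' \<noteq> b' \<longrightarrow> (\<exists>\<sigma>\<in>\<Gamma>. \<sigma> a = a' \<and> \<sigma> b = b')"
    using doubly_trans[OF j] by (rule bexE)
  obtain x' y' where p: "x' \<in> lev j" "y' \<in> lev j" "x \<in> child x'" "y \<in> child y'"
    using Suc.prems by (auto simp: lev_Suc)
  obtain \<sigma> \<tau> where \<sigma>: "\<sigma> \<in> \<Gamma>" "\<sigma> x' = v" and \<tau>: "\<tau> \<in> \<Gamma>" "\<tau> y' = v"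
    using Suc.IH[OF less_imp_le[OF j] p(1) v] Suc.IH[OF less_imp_le[OF j] p(2) v]
    by (elim bexE) (rule that; assumption)
  have c: "\<sigma> x \<in> child v" "\<tau> y \<in> child v"
    using group_child[OF \<sigma>(1) p(3)] group_child[OF \<tau>(1) p(4)] \<sigma> \<tau> by auto
  obtain b where b: "b \<in> child v" "b \<noteq> \<sigma> x"
    using sibling_exists[OF j v c(1)] .
  obtain b' where b': "b' \<in> child v" "b' \<noteq> \<tau> y"
    using sibling_exists[OF j v c(2)] .
  obtain \<rho> where \<rho>: "\<rho> \<in> \<Gamma>" "\<rho> (\<sigma> x) = \<tau> y"
    using D[rule_format, OF c(1) b(1) c(2) b'(1) b(2)[symmetric] b'(2)[symmetric]]
    by (elim bexE conjE) (rule that; assumption)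
  have "inv_into UNIV \<tau> \<circ> \<rho> \<circ> \<sigma> \<in> \<Gamma>"
    using \<sigma> \<tau> \<rho> by (intro group_comp group_inv)
  moreover have "(inv_into UNIV \<tau> \<circ> \<rho> \<circ> \<sigma>) x = y"
    using \<rho>(2) inv_left[OF \<tau>(1)] by simp
  ultimately show ?case by blast
qed

text \<open>A conjugate of the given swap. The pairs \<open>a\<close>, \<open>b\<close> and
  \<open>a0\<close>, \<open>b0\<close> may lie under different vertices, so both are carried to the
  vertex \<open>v\<close>, where double transitivity matches them in order.\<close>

lemma all_swaps:
  assumes j: "j < n" and u: "u \<in> lev j" and a: "a \<in> child u" "b \<in> child u" "a \<noteq> b"
  shows "\<exists>\<sigma>\<in>\<Gamma>. \<forall>x\<in>lev (Suc j). \<sigma> x = Transposition.transpose a b x"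
proof -
  obtain v where v: "v \<in> lev j" and D: "\<forall>a\<in>child v. \<forall>b\<in>child v. \<forall>a'\<in>child v. \<forall>b'\<in>child v.
      a \<noteq> b \<longrightarrow> a' \<noteq> b' \<longrightarrow> (\<exists>\<sigma>\<in>\<Gamma>. \<sigma> a = a' \<and> \<sigma> b = b')"
    using doubly_trans[OF j] by (rule bexE)
  obtain w a0 b0 \<tau> where w: "w \<in> lev j" "a0 \<in> child w" "b0 \<in> child w" "a0 \<noteq> b0"
    and \<tau>: "\<tau> \<in> \<Gamma>" "\<tau> a0 = b0" "\<tau> b0 = a0" "\<forall>x\<in>lev (Suc j) - {a0, b0}. \<tau> x = x"
    using swap[OF j] by (elim bexE conjE) (rule that; assumption)
  obtain \<sigma> \<rho> where \<sigma>: "\<sigma> \<in> \<Gamma>" "\<sigma> u = v" and \<rho>: "\<rho> \<in> \<Gamma>" "\<rho> w = v"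
    using transitive_lev[OF less_imp_le[OF j] u v] transitive_lev[OF less_imp_le[OF j] w(1) v]
    by (elim bexE) (rule that; assumption)
  have c: "\<sigma> a \<in> child v" "\<sigma> b \<in> child v" "\<rho> a0 \<in> child v" "\<rho> b0 \<in> child v"
    using group_child[OF \<sigma>(1) a(1)] group_child[OF \<sigma>(1) a(2)]
      group_child[OF \<rho>(1) w(2)] group_child[OF \<rho>(1) w(3)] by (simp_all add: \<sigma>(2) \<rho>(2))
  have ne: "\<sigma> a \<noteq> \<sigma> b" "\<rho> a0 \<noteq> \<rho> b0"
    using a(3) w(4) group_bij[OF \<sigma>(1)] group_bij[OF \<rho>(1)] by (simp_all add: bij_def inj_eq)
  obtain \<kappa> where \<kappa>: "\<kappa> \<in> \<Gamma>" "\<kappa> (\<sigma> a) = \<rho> a0" "\<kappa> (\<sigma> b) = \<rho> b0"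
    using D[rule_format, OF c ne] by (elim bexE conjE) (rule that; assumption)
  define g where "g = inv_into UNIV \<rho> \<circ> \<kappa> \<circ> \<sigma>"
  have g: "g \<in> \<Gamma>" "g a = a0" "g b = b0"
    using \<kappa> \<sigma>(1) \<rho>(1) inv_left[OF \<rho>(1)] by (simp_all add: g_def group_comp group_inv)
  define h where "h = inv_into UNIV g \<circ> \<tau> \<circ> g"
  have "h \<in> \<Gamma>"
    unfolding h_def using g \<tau> by (intro group_comp group_inv)
  moreover have "h x = Transposition.transpose a b x" if x: "x \<in> lev (Suc j)" for x
  proof -
    have "h a = b" "h b = a"
      using g(2,3) \<tau>(2,3) inv_left[OF g(1), of a] inv_left[OF g(1), of b] by (simp_all add: h_def)
    moreover have "h x = x" if "x \<noteq> a" "x \<noteq> b"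
    proof -
      have "g x \<noteq> a0" "g x \<noteq> b0"
        using that g(2,3) group_bij[OF g(1)] by (metis bij_def injD)+
      then have "\<tau> (g x) = g x"
        using \<tau>(4) group_lev[OF g(1) x] by blast
      then show ?thesis
        by (simp add: h_def inv_left[OF g(1)])
    qed
    ultimately show ?thesis
      by (auto simp: Transposition.transpose_def)
  qed
  ultimately show ?thesis by blast
qed

text \<open>Induction on the number of moved vertices: after composing with the transposition of
  \<open>x\<close> and \<open>h x\<close>, the vertex \<open>x\<close> is fixed as well and no new
  one moves.\<close>

lemma all_sibling_perms:
  assumes j: "j < n" and h: "bij_betw h (lev (Suc j)) (lev (Suc j))"
    and "\<And>y x. y \<in> lev j \<Longrightarrow> x \<in> child y \<Longrightarrow> h x \<in> child y"
  shows "\<exists>\<sigma>\<in>\<Gamma>. \<forall>x\<in>lev (Suc j). \<sigma> x = h x"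
  using h assms(3)
proof (induction "card {x \<in> lev (Suc j). h x \<noteq> x}" arbitrary: h rule: less_induct)
  case less
  show ?case
  proof (cases "\<exists>x\<in>lev (Suc j). h x \<noteq> x")
    case False
    then show ?thesis
      using group_id by (intro bexI[of _ id]) auto
  next
    case True
    then obtain x where x: "x \<in> lev (Suc j)" "h x \<noteq> x"
      by blast
    then obtain y where y: "y \<in> lev j" "x \<in> child y" "h x \<in> child y"
      using less.prems(2) by (auto simp: lev_Suc)
    define t where "t = Transposition.transpose x (h x)"
    obtain \<sigma> where \<sigma>: "\<sigma> \<in> \<Gamma>" "\<And>z. z \<in> lev (Suc j) \<Longrightarrow> \<sigma> z = t z"
      using all_swaps[OF j y(1,2,3)] x(2) unfolding t_def by metis
    have hx: "h x \<in> lev (Suc j)"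
      using y by (auto simp: lev_Suc)
    have bt: "bij_betw t (lev (Suc j)) (lev (Suc j))"
      unfolding t_def using x(1) hx
      by (intro bij_betwI[of _ _ _ "Transposition.transpose x (h x)"])
         (auto simp: Transposition.transpose_def)
    have inj: "h a = h b \<longleftrightarrow> a = b" if "a \<in> lev (Suc j)" "b \<in> lev (Suc j)" for a b
      using less.prems(1) that by (auto simp: bij_betw_def inj_on_eq_iff)
    have fixd: "t (h z) = z" if "z \<in> lev (Suc j)" "h z = z" for z
      using that inj[OF that(1) x(1)] inj[OF that(1) hx] x hx
      by (auto simp: t_def Transposition.transpose_def)
    have "t (h x) = x"
      by (simp add: t_def)
    then have "{z \<in> lev (Suc j). (t \<circ> h) z \<noteq> z} \<subset> {z \<in> lev (Suc j). h z \<noteq> z}"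
      using fixd x by auto
    moreover have "finite {z \<in> lev (Suc j). h z \<noteq> z}"
      using finite_lev[of "Suc j"] j by simp
    ultimately have "card {z \<in> lev (Suc j). (t \<circ> h) z \<noteq> z} < card {z \<in> lev (Suc j). h z \<noteq> z}"
      by (rule psubset_card_mono[rotated])
    moreover have "bij_betw (t \<circ> h) (lev (Suc j)) (lev (Suc j))"
      using less.prems(1) bt by (rule bij_betw_trans)
    moreover have "(t \<circ> h) z \<in> child w" if "w \<in> lev j" "z \<in> child w" for w z
    proof -
      have "h z \<in> child w"
        using less.prems(2) that by blast
      moreover have "t c \<in> child w" if "c \<in> child w" for c
        using that y(2,3) child_unique by (auto simp: t_def Transposition.transpose_def)
      ultimately show ?thesis by simp
    qed
    ultimately obtain \<rho> where \<rho>: "\<rho> \<in> \<Gamma>" "\<And>z. z \<in> lev (Suc j) \<Longrightarrow> \<rho> z = t (h z)"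
      using less.hyps[of "t \<circ> h"] by auto
    have "(\<sigma> \<circ> \<rho>) z = h z" if "z \<in> lev (Suc j)" for z
    proof -
      have "\<rho> z \<in> lev (Suc j)"
        using \<rho>(1) that group_lev by blast
      then show ?thesis
        using \<sigma>(2) \<rho>(2) that by (simp add: t_def)
    qed
    then show ?thesis
      using group_comp[OF \<sigma>(1) \<rho>(1)] by blast
  qed
qed

text \<open>One map per level, so that the levels need not be known to be disjoint.\<close>

definition tree_auto :: "nat \<Rightarrow> (nat \<Rightarrow> 'o \<Rightarrow> 'o) \<Rightarrow> bool" where
  "tree_auto m f \<longleftrightarrow> (\<forall>j\<le>m. bij_betw (f j) (lev j) (lev j)) \<and>
     (\<forall>j<m. \<forall>y\<in>lev j. \<forall>x\<in>child y. f (Suc j) x \<in> child (f j y))"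

text \<open>If \<open>\<sigma>\<close> realises the map on level \<open>m\<close>, then undoing
  \<open>\<sigma>\<close> on level \<open>m + 1\<close> leaves a permutation that preserves the
  sibling sets, and such permutations are realised by \<open>all_sibling_perms\<close>.\<close>

lemma tree_auto_top:
  assumes "m \<le> n" "tree_auto m f"
  shows "\<exists>\<sigma>\<in>\<Gamma>. \<forall>x\<in>lev m. \<sigma> x = f m x"
  using assms
proof (induction m)
  case 0
  then have "f 0 root = root"
    by (auto simp: tree_auto_def lev_0 bij_betw_def)
  then show ?case
    using group_id by (intro bexI[of _ id]) (auto simp: lev_0)
next
  case (Suc m)
  then obtain \<sigma> where \<sigma>: "\<sigma> \<in> \<Gamma>" "\<And>x. x \<in> lev m \<Longrightarrow> \<sigma> x = f m x"
    by (auto simp: tree_auto_def)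
  define \<sigma>' where "\<sigma>' = inv_into UNIV \<sigma>"
  have \<sigma>': "\<sigma>' \<in> \<Gamma>"
    unfolding \<sigma>'_def using \<sigma>(1) by (rule group_inv)
  have "bij_betw \<sigma>' (lev (Suc m)) (lev (Suc m))"
    using group_lev[OF \<sigma>(1)] group_lev[OF \<sigma>'] inv_left[OF \<sigma>(1)] inv_right[OF \<sigma>(1)]
    by (intro bij_betwI[of _ _ _ \<sigma>]) (auto simp: \<sigma>'_def)
  moreover have "bij_betw (f (Suc m)) (lev (Suc m)) (lev (Suc m))"
    using Suc.prems by (auto simp: tree_auto_def)
  ultimately have "bij_betw (\<sigma>' \<circ> f (Suc m)) (lev (Suc m)) (lev (Suc m))"
    by (rule bij_betw_trans[rotated])
  moreover have "(\<sigma>' \<circ> f (Suc m)) x \<in> child y" if "y \<in> lev m" "x \<in> child y" for x y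
  proof -
    have "f (Suc m) x \<in> child (\<sigma> y)"
      using Suc.prems that \<sigma>(2) by (simp add: tree_auto_def)
    from group_child[OF \<sigma>' this] show ?thesis
      by (simp add: \<sigma>'_def inv_left[OF \<sigma>(1)])
  qed
  ultimately obtain \<rho> where \<rho>: "\<rho> \<in> \<Gamma>" "\<forall>x\<in>lev (Suc m). \<rho> x = (\<sigma>' \<circ> f (Suc m)) x"
    using all_sibling_perms[of m "\<sigma>' \<circ> f (Suc m)"] Suc.prems by auto
  then have "\<forall>x\<in>lev (Suc m). (\<sigma> \<circ> \<rho>) x = f (Suc m) x"
    by (simp add: \<sigma>'_def inv_right[OF \<sigma>(1)])
  then show ?case
    using group_comp[OF \<sigma>(1) \<rho>(1)] by blast
qed

text \<open>The values on level \<open>n\<close> force those on the earlier levels: every vertex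
  there has a child, and the parent of the image of that child is unique.\<close>

lemma tree_auto_realised:
  assumes "tree_auto n f"
  shows "\<exists>\<sigma>\<in>\<Gamma>. \<forall>j\<le>n. \<forall>x\<in>lev j. \<sigma> x = f j x"
proof -
  obtain \<sigma> where \<sigma>: "\<sigma> \<in> \<Gamma>" "\<And>x. x \<in> lev n \<Longrightarrow> \<sigma> x = f n x"
    using tree_auto_top[OF order_refl assms] by blast
  have "\<forall>x\<in>lev (n - k). \<sigma> x = f (n - k) x" if "k \<le> n" for k
    using that
  proof (induction k)
    case (Suc k)
    define j where "j = n - Suc k"
    have j: "n - k = Suc j" "j < n"
      using Suc.prems by (auto simp: j_def)
    show ?case
      unfolding j_def[symmetric]
    proof
      fix y assume y: "y \<in> lev j"
      then have "child y \<noteq> {}"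
        using card_child[OF j(2) y] d_gt_1 by auto
      then obtain x where x: "x \<in> child y"
        by blast
      have "\<sigma> x = f (Suc j) x"
        using Suc x y by (auto simp: j lev_Suc)
      moreover have "f (Suc j) x \<in> child (f j y)"
        using assms j(2) x y by (auto simp: tree_auto_def)
      ultimately show "\<sigma> y = f j y"
        using group_child[OF \<sigma>(1) x] child_unique by metis
    qed
  qed (use \<sigma> in auto)
  then have "\<forall>x\<in>lev j. \<sigma> x = f j x" if "j \<le> n" for j
    using that by (metis diff_diff_cancel diff_le_self)
  with \<sigma>(1) show ?thesis by blast
qed

end

section \<open>From tree automorphisms to the Galois group\<close>

definition num_eval :: "nat \<Rightarrow> (nat \<Rightarrow> 'a) \<Rightarrow> 'a::comm_ring_1 \<Rightarrow> 'a" where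
  "num_eval d s x = x ^ d + (\<Sum>i<d. s i * x ^ i)"

definition den_eval :: "nat \<Rightarrow> (nat \<Rightarrow> 'a) \<Rightarrow> 'a::comm_ring_1 \<Rightarrow> 'a" where
  "den_eval d u x = (\<Sum>i\<le>d. u i * x ^ i)"

text \<open>Cross-multiplied, so that poles call for no case distinction. The price is that a common
  zero of numerator and denominator lies over every \<open>y\<close>; \<open>child_unique\<close>
  excludes this for the tree.\<close>

definition preimages :: "nat \<Rightarrow> (nat \<Rightarrow> 'a) \<Rightarrow> (nat \<Rightarrow> 'a) \<Rightarrow> 'a::comm_ring_1 \<Rightarrow> 'a set" where
  "preimages d s u y = {x. num_eval d s x = y * den_eval d u x}"

primrec tree_lev :: "('o \<Rightarrow> 'o set) \<Rightarrow> 'o \<Rightarrow> nat \<Rightarrow> 'o set" where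
  "tree_lev ch r 0 = {r}"
| "tree_lev ch r (Suc j) = (\<Union>y\<in>tree_lev ch r j. ch y)"

text \<open>These automorphisms fix all of \<open>'a\<close>, hence possibly more than the field
  generated by the coefficients. They will already realise every tree automorphism, so the smaller
  group suffices.\<close>

definition ac_auts :: "('a::field alg_closure \<Rightarrow> 'a alg_closure) set" where
  "ac_auts = {\<sigma>. unital_hom \<sigma> \<and> bij \<sigma> \<and> (\<forall>k. \<sigma> (to_ac k) = to_ac k)}"

definition subfield_closed :: "'a::field set \<Rightarrow> bool" where
  "subfield_closed F \<longleftrightarrow> 0 \<in> F \<and> 1 \<in> F \<and>
     (\<forall>x\<in>F. \<forall>y\<in>F. x + y \<in> F \<and> x * y \<in> F \<and> - x \<in> F \<and> inverse x \<in> F)"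

section \<open>Generated subfields\<close>

lemma gen_subfield_conv: "gen_subfield A = \<Inter>{F. A \<subseteq> F \<and> subfield_closed F}"
  unfolding gen_subfield_def subfield_closed_def by simp

lemma gen_subfield_superset: "A \<subseteq> gen_subfield A"
  unfolding gen_subfield_conv by blast

lemma gen_subfield_least: "A \<subseteq> F \<Longrightarrow> subfield_closed F \<Longrightarrow> gen_subfield A \<subseteq> F"
  unfolding gen_subfield_conv by blast

lemma subfield_closedD:
  assumes "subfield_closed F"
  shows "0 \<in> F" "1 \<in> F" "x \<in> F \<Longrightarrow> y \<in> F \<Longrightarrow> x + y \<in> F" "x \<in> F \<Longrightarrow> y \<in> F \<Longrightarrow> x * y \<in> F"
    "x \<in> F \<Longrightarrow> - x \<in> F" "x \<in> F \<Longrightarrow> inverse x \<in> F"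
  using assms unfolding subfield_closed_def by simp_all

lemma subfield_closed_gen_subfield: "subfield_closed (gen_subfield A)"
proof -
  have mem: "x \<in> gen_subfield A \<longleftrightarrow> (\<forall>F. A \<subseteq> F \<longrightarrow> subfield_closed F \<longrightarrow> x \<in> F)" for x
    unfolding gen_subfield_conv by auto
  show ?thesis
    unfolding subfield_closed_def[of "gen_subfield A"] Ball_def mem by (simp add: subfield_closedD)
qed

lemma subfield_closed_power: "subfield_closed F \<Longrightarrow> x \<in> F \<Longrightarrow> x ^ n \<in> F"
  by (induction n) (simp_all add: subfield_closedD)

lemma subfield_closed_sum:
  "subfield_closed F \<Longrightarrow> (\<And>i. i \<in> I \<Longrightarrow> f i \<in> F) \<Longrightarrow> sum f I \<in> F"
  by (induction I rule: infinite_finite_induct) (simp_all add: subfield_closedD)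

lemma subfield_closed_range:
  fixes h :: "'a::field \<Rightarrow> 'b::field"
  assumes "unital_hom h"
  shows "subfield_closed (range h)"
proof -
  interpret unital_hom h by fact
  have "inverse (h x) = h (inverse x)" for x
    using unital_hom_divide[OF assms, of 1 x] by (simp add: divide_inverse)
  then show ?thesis
    unfolding subfield_closed_def
    by (auto simp flip: add mult uminus intro: range_eqI[of _ _ 0] range_eqI[of _ _ 1])
qed

locale tree_galois =
  fixes d n :: nat and s u :: "nat \<Rightarrow> 'a::field alg_closure" and C :: "'a set"
  assumes act: "tree_action 0 (preimages d s u) d n ac_auts (tree_lev (preimages d s u) 0)"
    and coeffs: "\<And>i. i < d \<Longrightarrow> s i \<in> gen_subfield (to_ac ` C)" "\<And>i. i \<le> d \<Longrightarrow> u i \<in> gen_subfield (to_ac ` C)"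
begin

abbreviation "child \<equiv> preimages d s u"
abbreviation "lev \<equiv> tree_lev (preimages d s u) 0"

sublocale tree_action 0 child d n ac_auts lev
  by (rule act)

definition K where "K = gen_subfield (to_ac ` C)"
definition E where "E = gen_subfield (K \<union> lev n)"

lemma K_closed: "subfield_closed K"
  and E_closed: "subfield_closed E"
  unfolding K_def E_def by (rule subfield_closed_gen_subfield)+

lemma K_subset_E: "K \<subseteq> E"
  unfolding E_def using gen_subfield_superset by blast

lemma K_fixed:
  assumes "\<sigma> \<in> ac_auts" "x \<in> K"
  shows "\<sigma> x = x"
proof -
  have "K \<subseteq> range to_ac"
    unfolding K_def
    by (rule gen_subfield_least) (auto intro: subfield_closed_range[OF unital_hom_to_ac])
  then show ?thesis
    using assms by (auto simp: ac_auts_def)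
qed

text \<open>At a zero of the denominator the numerator would vanish too, and \<open>x\<close> would
  be a child of both \<open>y\<close> and \<open>y + 1\<close>.\<close>

lemma den_nonzero:
  assumes "x \<in> child y"
  shows "den_eval d u x \<noteq> 0"
proof
  assume "den_eval d u x = 0"
  with assms have "x \<in> child (y + 1)"
    by (simp add: preimages_def)
  then have "y = y + 1"
    by (rule child_unique[OF assms])
  then show False
    by simp
qed

lemma s_in_E: "i < d \<Longrightarrow> s i \<in> E" and u_in_E: "i \<le> d \<Longrightarrow> u i \<in> E"
  using coeffs K_subset_E by (simp_all add: K_def subset_iff)

lemma num_eval_in_E: "x \<in> E \<Longrightarrow> num_eval d s x \<in> E"
  and den_eval_in_E: "x \<in> E \<Longrightarrow> den_eval d u x \<in> E"
  unfolding num_eval_def den_eval_def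
  by (intro subfield_closedD(3)[OF E_closed] subfield_closed_sum[OF E_closed]
      subfield_closedD(4)[OF E_closed] subfield_closed_power[OF E_closed] s_in_E u_in_E; simp)+

lemma parent_in_E:
  assumes "x \<in> child y" "x \<in> E"
  shows "y \<in> E"
proof -
  have "y = num_eval d s x * inverse (den_eval d u x)"
    using assms(1) den_nonzero[OF assms(1)] by (simp add: preimages_def)
  then show ?thesis
    using subfield_closedD(4,6)[OF E_closed] num_eval_in_E den_eval_in_E assms(2) by simp
qed

lemma child_nonempty: "j < n \<Longrightarrow> y \<in> lev j \<Longrightarrow> child y \<noteq> {}"
  using card_child[of j y] d_gt_1 by auto

text \<open>\<open>E\<close> is generated by level \<open>n\<close> alone. The earlier levels lie in
  it because a parent is a rational expression in its child and every vertex before level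
  \<open>n\<close> has a child.\<close>

lemma lev_subset_E: "j \<le> n \<Longrightarrow> lev j \<subseteq> E"
proof (induction "n - j" arbitrary: j)
  case 0
  then show ?case
    unfolding E_def using gen_subfield_superset[of "K \<union> lev n"] by auto
next
  case (Suc k)
  then have j: "j < n" "k = n - Suc j"
    by auto
  then have sub: "lev (Suc j) \<subseteq> E"
    using Suc.hyps(1)[of "Suc j"] by simp
  show ?case
  proof
    fix y assume y: "y \<in> lev j"
    then obtain x where "x \<in> child y"
      using child_nonempty[OF j(1)] by blast
    moreover from this have "x \<in> E"
      using sub y by auto
    ultimately show "y \<in> E"
      by (rule parent_in_E)
  qed
qed

section \<open>Labelling the vertices by words\<close>

definition br :: "'a alg_closure \<Rightarrow> nat \<Rightarrow> 'a alg_closure" where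
  "br y = (SOME h. bij_betw h {..<d} (child y))"

lemma br: "j < n \<Longrightarrow> y \<in> lev j \<Longrightarrow> bij_betw (br y) {..<d} (child y)"
proof -
  assume "j < n" "y \<in> lev j"
  then have "\<exists>h. bij_betw h {..<d} (child y)"
    using ex_bij_betw_nat_finite[OF finite_child] card_child by (simp add: atLeast0LessThan)
  then show ?thesis
    unfolding br_def by (rule someI_ex)
qed

definition vertex :: "nat list \<Rightarrow> 'a alg_closure" where
  "vertex xs = foldl br 0 xs"

lemma vertex_Nil [simp]: "vertex [] = 0"
  and vertex_snoc [simp]: "vertex (xs @ [i]) = br (vertex xs) i"
  by (simp_all add: vertex_def)

definition words :: "nat \<Rightarrow> nat list set" where
  "words j = {xs. length xs = j \<and> set xs \<subseteq> {..<d}}"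

lemma words_0 [simp]: "words 0 = {[]}"
  by (auto simp: words_def)

lemma words_SucE:
  assumes "xs \<in> words (Suc j)"
  obtains ys i where "xs = ys @ [i]" "ys \<in> words j" "i < d"
  using assms by (cases xs rule: rev_cases) (auto simp: words_def)

lemma snoc_in_words_iff [simp]: "xs @ [i] \<in> words (Suc j) \<longleftrightarrow> xs \<in> words j \<and> i < d"
  by (auto simp: words_def)

lemma tree_verts_conv: "xs \<in> tree_verts d n \<longleftrightarrow> length xs \<le> n \<and> xs \<in> words (length xs)"
  by (auto simp: tree_verts_def words_def)

lemma words_in_tree_verts: "j \<le> n \<Longrightarrow> xs \<in> words j \<Longrightarrow> xs \<in> tree_verts d n"
  by (auto simp: tree_verts_def words_def)

lemma vertex_bij: "j \<le> n \<Longrightarrow> bij_betw vertex (words j) (lev j)"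
proof (induction j)
  case 0
  show ?case by (simp add: bij_betw_def)
next
  case (Suc j)
  then have j: "j < n" and IH: "bij_betw vertex (words j) (lev j)"
    by auto
  have v: "vertex xs \<in> lev j" if "xs \<in> words j" for xs
    using IH that by (auto simp: bij_betw_def)
  have c: "br (vertex xs) i \<in> child (vertex xs)" if "xs \<in> words j" "i < d" for xs i
    using br[OF j v] that by (auto simp: bij_betw_def)
  show ?case
    unfolding bij_betw_def
  proof
    show "inj_on vertex (words (Suc j))"
    proof (rule inj_onI)
      fix xs ys assume xs: "xs \<in> words (Suc j)" and ys: "ys \<in> words (Suc j)" and eq: "vertex xs = vertex ys"
      obtain xs' i where x: "xs = xs' @ [i]" "xs' \<in> words j" "i < d"
        using xs by (rule words_SucE)
      obtain ys' k where y: "ys = ys' @ [k]" "ys' \<in> words j" "k < d"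
        using ys by (rule words_SucE)
      have "vertex xs' = vertex ys'"
        using c[OF x(2,3)] c[OF y(2,3)] eq child_unique by (auto simp: x(1) y(1))
      then have "xs' = ys'"
        using IH x(2) y(2) by (auto simp: bij_betw_def inj_on_def)
      moreover from this have "i = k"
        using br[OF j v[OF x(2)]] eq x y by (auto simp: bij_betw_def inj_on_def)
      ultimately show "xs = ys"
        using x y by simp
    qed
    show "vertex ` words (Suc j) = lev (Suc j)"
    proof (intro equalityI subsetI)
      fix z assume "z \<in> vertex ` words (Suc j)"
      then obtain xs where xs: "xs \<in> words (Suc j)" "z = vertex xs"
        by blast
      obtain ys i where ys: "xs = ys @ [i]" "ys \<in> words j" "i < d"
        using xs(1) by (rule words_SucE)
      show "z \<in> lev (Suc j)"
        using c[OF ys(2,3)] v[OF ys(2)] xs(2) ys(1) by (simp, blast)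
    next
      fix z assume "z \<in> lev (Suc j)"
      then obtain y where y: "y \<in> lev j" "z \<in> child y"
        by auto
      then obtain xs where xs: "xs \<in> words j" "y = vertex xs"
        using IH by (auto simp: bij_betw_def)
      obtain i where "i < d" "z = br y i"
        using br[OF j y(1)] y(2) by (auto simp: bij_betw_def)
      then show "z \<in> vertex ` words (Suc j)"
        using xs by (intro image_eqI[of _ _ "xs @ [i]"]) auto
    qed
  qed
qed

definition label :: "nat \<Rightarrow> 'a alg_closure \<Rightarrow> nat list" where
  "label j = inv_into (words j) vertex"

lemma label: "j \<le> n \<Longrightarrow> x \<in> lev j \<Longrightarrow> label j x \<in> words j \<and> vertex (label j x) = x"
  unfolding label_def using vertex_bij[of j]
  by (metis bij_betw_imp_surj_on f_inv_into_f inv_into_into)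

lemma label_vertex: "j \<le> n \<Longrightarrow> xs \<in> words j \<Longrightarrow> label j (vertex xs) = xs"
  unfolding label_def using vertex_bij[of j] by (simp add: bij_betw_def)

lemma vertex_in_lev: "j \<le> n \<Longrightarrow> xs \<in> words j \<Longrightarrow> vertex xs \<in> lev j"
  using vertex_bij[of j] by (auto simp: bij_betw_def)

lemma vertex_eqD: "j \<le> n \<Longrightarrow> xs \<in> words j \<Longrightarrow> ys \<in> words j \<Longrightarrow> vertex xs = vertex ys \<Longrightarrow> xs = ys"
  using label_vertex by metis

lemma vertex_child:
  "j < n \<Longrightarrow> xs \<in> words j \<Longrightarrow> i < d \<Longrightarrow> vertex (xs @ [i]) \<in> child (vertex xs)"
  using br[OF _ vertex_in_lev] by (auto simp: bij_betw_def)

section \<open>Galois elements as automorphisms of words\<close>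

abbreviation "Gal \<equiv> carrier (Gal_over K E)"

lemma Gal_iff: "\<sigma> \<in> Gal \<longleftrightarrow> \<sigma> \<in> extensional E \<and> bij_betw \<sigma> E E \<and>
    (\<forall>x\<in>E. \<forall>y\<in>E. \<sigma> (x + y) = \<sigma> x + \<sigma> y \<and> \<sigma> (x * y) = \<sigma> x * \<sigma> y) \<and> (\<forall>x\<in>K. \<sigma> x = x)"
  by (simp add: Gal_over_def)

context
  fixes \<sigma>
  assumes \<sigma>: "\<sigma> \<in> Gal"
begin

lemma Gal_add: "x \<in> E \<Longrightarrow> y \<in> E \<Longrightarrow> \<sigma> (x + y) = \<sigma> x + \<sigma> y"
  and Gal_mult: "x \<in> E \<Longrightarrow> y \<in> E \<Longrightarrow> \<sigma> (x * y) = \<sigma> x * \<sigma> y"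
  and Gal_K: "x \<in> K \<Longrightarrow> \<sigma> x = x"
  and Gal_inj: "x \<in> E \<Longrightarrow> y \<in> E \<Longrightarrow> \<sigma> x = \<sigma> y \<Longrightarrow> x = y"
  using \<sigma> unfolding Gal_iff by (auto simp: bij_betw_def inj_on_def)

lemma Gal_0: "\<sigma> 0 = 0" and Gal_1: "\<sigma> 1 = 1"
  using Gal_K subfield_closedD[OF K_closed] by simp_all

lemma Gal_minus: "x \<in> E \<Longrightarrow> \<sigma> (- x) = - \<sigma> x"
  using Gal_add[of x "- x"] subfield_closedD(5)[OF E_closed] Gal_0
  by (simp add: eq_neg_iff_add_eq_0 add.commute)

lemma Gal_inverse: "x \<in> E \<Longrightarrow> \<sigma> (inverse x) = inverse (\<sigma> x)"
  using Gal_mult[of x "inverse x"] subfield_closedD(6)[OF E_closed] Gal_0 Gal_1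
  by (cases "x = 0") (auto intro: inverse_unique[symmetric])

lemma Gal_power: "x \<in> E \<Longrightarrow> \<sigma> (x ^ m) = \<sigma> x ^ m"
  by (induction m) (simp_all add: Gal_1 Gal_mult subfield_closed_power[OF E_closed])

lemma Gal_sum: "(\<And>i. i \<in> I \<Longrightarrow> f i \<in> E) \<Longrightarrow> \<sigma> (sum f I) = (\<Sum>i\<in>I. \<sigma> (f i))"
  by (induction I rule: infinite_finite_induct)
     (simp_all add: Gal_0 Gal_add subfield_closed_sum[OF E_closed])

lemma Gal_monom:
  assumes "c \<in> K" "x \<in> E"
  shows "c * x ^ i \<in> E" "\<sigma> (c * x ^ i) = c * \<sigma> x ^ i"
  using assms K_subset_E Gal_K[of c] Gal_power[of x i] subfield_closed_power[OF E_closed, of x i]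
  by (auto simp: Gal_mult intro: subfield_closedD(4)[OF E_closed])

lemma Gal_child:
  assumes "x \<in> child y" "x \<in> E" "y \<in> E"
  shows "\<sigma> x \<in> child (\<sigma> y)"
proof -
  have s: "s i \<in> K" if "i < d" for i
    using coeffs that by (simp add: K_def)
  have u: "u i \<in> K" if "i \<le> d" for i
    using coeffs that by (simp add: K_def)
  have num: "\<sigma> (num_eval d s x) = num_eval d s (\<sigma> x)"
  proof -
    have "\<sigma> (\<Sum>i<d. s i * x ^ i) = (\<Sum>i<d. \<sigma> (s i * x ^ i))"
      by (rule Gal_sum) (simp add: Gal_monom s assms(2))
    also have "\<dots> = (\<Sum>i<d. s i * \<sigma> x ^ i)"
      by (rule sum.cong) (simp_all add: Gal_monom s assms(2))
    finally have "\<sigma> (\<Sum>i<d. s i * x ^ i) = (\<Sum>i<d. s i * \<sigma> x ^ i)" .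
    moreover have "(\<Sum>i<d. s i * x ^ i) \<in> E"
      by (rule subfield_closed_sum[OF E_closed]) (simp add: Gal_monom s assms(2))
    ultimately show ?thesis
      unfolding num_eval_def using assms(2) subfield_closed_power[OF E_closed]
      by (simp add: Gal_add Gal_power)
  qed
  have den: "\<sigma> (den_eval d u x) = den_eval d u (\<sigma> x)"
  proof -
    have "\<sigma> (\<Sum>i\<le>d. u i * x ^ i) = (\<Sum>i\<le>d. \<sigma> (u i * x ^ i))"
      by (rule Gal_sum) (simp add: Gal_monom u assms(2))
    also have "\<dots> = (\<Sum>i\<le>d. u i * \<sigma> x ^ i)"
      by (rule sum.cong) (simp_all add: Gal_monom u assms(2))
    finally show ?thesis
      unfolding den_eval_def .
  qed
  have "\<sigma> (num_eval d s x) = \<sigma> (y * den_eval d u x)"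
    using assms(1) by (simp add: preimages_def)
  also have "\<dots> = \<sigma> y * \<sigma> (den_eval d u x)"
    using assms den_eval_in_E by (simp add: Gal_mult)
  finally show ?thesis
    by (simp add: num den preimages_def)
qed

lemma Gal_lev: "j \<le> n \<Longrightarrow> x \<in> lev j \<Longrightarrow> \<sigma> x \<in> lev j"
proof (induction j arbitrary: x)
  case 0
  then show ?case by (simp add: Gal_0)
next
  case (Suc j)
  then obtain y where y: "y \<in> lev j" "x \<in> child y"
    by auto
  have "x \<in> E" "y \<in> E"
    using lev_subset_E[of "Suc j"] lev_subset_E[of j] Suc.prems y(1) by (simp_all add: subset_iff)
  then have "\<sigma> x \<in> child (\<sigma> y)"
    using Gal_child y(2) by simp
  moreover have "\<sigma> y \<in> lev j"
    using Suc.IH Suc.prems y(1) by simp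
  ultimately show ?case by auto
qed

end

definition word_map :: "('a alg_closure \<Rightarrow> 'a alg_closure) \<Rightarrow> nat list \<Rightarrow> nat list" where
  "word_map \<sigma> = restrict (\<lambda>xs. label (length xs) (\<sigma> (vertex xs))) (tree_verts d n)"

lemma word_map:
  assumes "\<sigma> \<in> Gal" "j \<le> n" "xs \<in> words j"
  shows "word_map \<sigma> xs \<in> words j" "vertex (word_map \<sigma> xs) = \<sigma> (vertex xs)"
proof -
  have "\<sigma> (vertex xs) \<in> lev j"
    using Gal_lev[OF assms(1,2)] vertex_in_lev[OF assms(2,3)] .
  moreover have "word_map \<sigma> xs = label j (\<sigma> (vertex xs))"
    using words_in_tree_verts[OF assms(2,3)] assms(3) by (simp add: word_map_def words_def)
  ultimately show "word_map \<sigma> xs \<in> words j" "vertex (word_map \<sigma> xs) = \<sigma> (vertex xs)"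
    using label[OF assms(2)] by auto
qed

lemma finite_tree_verts: "finite (tree_verts d n)"
proof -
  have "tree_verts d n = (\<Union>j\<le>n. {xs. set xs \<subseteq> {..<d} \<and> length xs = j})"
    by (auto simp: tree_verts_def)
  then show ?thesis
    by (simp add: finite_lists_length_eq)
qed

lemma vertex_in_E: "xs \<in> tree_verts d n \<Longrightarrow> vertex xs \<in> E"
  using vertex_in_lev lev_subset_E by (meson subsetD tree_verts_conv)

lemma word_map_in_wreath:
  assumes \<sigma>: "\<sigma> \<in> Gal"
  shows "word_map \<sigma> \<in> carrier (wreath_power d n)"
proof -
  have into: "word_map \<sigma> xs \<in> tree_verts d n" "length (word_map \<sigma> xs) = length xs"
    if "xs \<in> tree_verts d n" for xs
    using word_map(1)[OF \<sigma>, of "length xs" xs] that by (auto simp: tree_verts_conv words_def)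
  have "inj_on (word_map \<sigma>) (tree_verts d n)"
  proof (rule inj_onI)
    fix xs ys assume xs: "xs \<in> tree_verts d n" and ys: "ys \<in> tree_verts d n"
      and eq: "word_map \<sigma> xs = word_map \<sigma> ys"
    then have len: "length xs = length ys"
      using into(2) by metis
    have w: "length xs \<le> n" "xs \<in> words (length xs)" "ys \<in> words (length xs)"
      using xs ys len by (auto simp: tree_verts_conv)
    have "\<sigma> (vertex xs) = \<sigma> (vertex ys)"
      using word_map(2)[OF \<sigma> w(1,2)] word_map(2)[OF \<sigma> w(1,3)] eq by simp
    then have "vertex xs = vertex ys"
      using Gal_inj[OF \<sigma>] vertex_in_E xs ys by simp
    then show "xs = ys"
      using vertex_eqD[OF w] by simp
  qed
  moreover have "word_map \<sigma> ` tree_verts d n \<subseteq> tree_verts d n"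
    using into by auto
  ultimately have "bij_betw (word_map \<sigma>) (tree_verts d n) (tree_verts d n)"
    using endo_inj_surj[OF finite_tree_verts] by (simp add: bij_betw_def)
  moreover have "word_map \<sigma> [] = []"
    using word_map(1)[OF \<sigma>, of 0 "[]"] by simp
  moreover have "word_map \<sigma> (butlast xs) = butlast (word_map \<sigma> xs)"
    if xs: "xs \<in> tree_verts d n" "xs \<noteq> []" for xs
  proof -
    obtain j where j: "length xs = Suc j"
      using xs(2) by (cases "length xs") auto
    with xs(1) have w: "Suc j \<le> n" "xs \<in> words (Suc j)"
      by (auto simp: tree_verts_conv)
    obtain ys i where ys: "xs = ys @ [i]" "ys \<in> words j" "i < d"
      using w(2) by (rule words_SucE)
    obtain zs k where zs: "word_map \<sigma> xs = zs @ [k]" "zs \<in> words j" "k < d"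
      using word_map(1)[OF \<sigma> w] by (rule words_SucE)
    have "\<sigma> (vertex xs) \<in> child (\<sigma> (vertex ys))"
    proof (rule Gal_child[OF \<sigma>])
      show "vertex xs \<in> child (vertex ys)"
        unfolding ys(1) using w by (intro vertex_child[OF _ ys(2,3)]) simp
      show "vertex xs \<in> E" "vertex ys \<in> E"
        using vertex_in_E xs(1) words_in_tree_verts[OF _ ys(2)] w by simp_all
    qed
    moreover have "\<sigma> (vertex xs) \<in> child (vertex zs)"
      using vertex_child[OF _ zs(2,3)] zs(1) w word_map(2)[OF \<sigma> w] by simp
    ultimately have "vertex zs = \<sigma> (vertex ys)"
      using child_unique by metis
    also have "\<dots> = vertex (word_map \<sigma> ys)"
      using word_map(2)[OF \<sigma> _ ys(2)] w by simp
    finally have "zs = word_map \<sigma> ys"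
      using vertex_eqD[OF _ zs(2) word_map(1)[OF \<sigma> _ ys(2)]] w by simp
    then show ?thesis
      using ys zs by simp
  qed
  ultimately show ?thesis
    by (simp add: wreath_power_def word_map_def)
qed

lemma word_map_mult:
  assumes "\<sigma> \<in> Gal" "\<tau> \<in> Gal"
  shows "word_map (\<sigma> \<otimes>\<^bsub>Gal_over K E\<^esub> \<tau>) = word_map \<sigma> \<otimes>\<^bsub>wreath_power d n\<^esub> word_map \<tau>"
proof
  fix xs
  show "word_map (\<sigma> \<otimes>\<^bsub>Gal_over K E\<^esub> \<tau>) xs = (word_map \<sigma> \<otimes>\<^bsub>wreath_power d n\<^esub> word_map \<tau>) xs"
  proof (cases "xs \<in> tree_verts d n")
    case True
    then have w: "length xs \<le> n" "xs \<in> words (length xs)"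
      by (auto simp: tree_verts_conv)
    have wt: "word_map \<tau> xs \<in> words (length xs)"
      using word_map(1)[OF assms(2) w] .
    have "word_map \<sigma> (word_map \<tau> xs) = label (length xs) (vertex (word_map \<sigma> (word_map \<tau> xs)))"
      using label_vertex[OF w(1) word_map(1)[OF assms(1) w(1) wt]] by simp
    also have "\<dots> = label (length xs) (\<sigma> (\<tau> (vertex xs)))"
      using word_map(2)[OF assms(1) w(1) wt] word_map(2)[OF assms(2) w] by simp
    finally show ?thesis
      using True vertex_in_E[OF True] by (simp add: word_map_def Gal_over_def wreath_power_def)
  next
    case False
    then show ?thesis
      by (simp add: word_map_def wreath_power_def)
  qed
qed

text \<open>The set on which two Galois elements agree is a subfield, and equal action on the words
  of length \<open>n\<close> puts all generators of \<open>E\<close> into it.\<close>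

lemma word_map_inj: "inj_on word_map Gal"
proof (rule inj_onI)
  fix \<sigma> \<tau> assume \<sigma>: "\<sigma> \<in> Gal" and \<tau>: "\<tau> \<in> Gal" and eq: "word_map \<sigma> = word_map \<tau>"
  define F where "F = {x \<in> E. \<sigma> x = \<tau> x}"
  have "subfield_closed F"
    unfolding subfield_closed_def F_def using subfield_closedD[OF E_closed]
    by (simp add: Gal_0[OF \<sigma>] Gal_0[OF \<tau>] Gal_1[OF \<sigma>] Gal_1[OF \<tau>] Gal_add[OF \<sigma>] Gal_add[OF \<tau>]
        Gal_mult[OF \<sigma>] Gal_mult[OF \<tau>] Gal_minus[OF \<sigma>] Gal_minus[OF \<tau>]
        Gal_inverse[OF \<sigma>] Gal_inverse[OF \<tau>])
  moreover have "K \<union> lev n \<subseteq> F"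
  proof -
    have "x \<in> F" if x: "x \<in> lev n" for x
    proof -
      have l: "label n x \<in> words n" "vertex (label n x) = x"
        using label[of n x] x by auto
      have "\<sigma> x = \<tau> x"
        using word_map(2)[OF \<sigma> order_refl l(1)] word_map(2)[OF \<tau> order_refl l(1)] eq l(2) by simp
      then show ?thesis
        using lev_subset_E[of n] x by (auto simp: F_def)
    qed
    then show ?thesis
      using K_subset_E Gal_K[OF \<sigma>] Gal_K[OF \<tau>] by (auto simp: F_def)
  qed
  ultimately have "E \<subseteq> F"
    unfolding E_def by (intro gen_subfield_least)
  then show "\<sigma> = \<tau>"
    using \<sigma> \<tau> unfolding Gal_iff by (intro extensionalityI[of \<sigma> E \<tau>]) (auto simp: F_def)
qed

lemma restrict_in_Gal:
  assumes \<sigma>: "\<sigma> \<in> ac_auts"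
  shows "restrict \<sigma> E \<in> Gal"
proof -
  have into: "\<sigma> x \<in> E" if "x \<in> E" "\<sigma> \<in> ac_auts" for x \<sigma>
  proof -
    interpret unital_hom \<sigma>
      using that(2) by (simp add: ac_auts_def)
    have inv: "\<sigma> (inverse x) = inverse (\<sigma> x)" for x
      using unital_hom_divide[of \<sigma> 1 x] that(2) by (simp add: ac_auts_def divide_inverse)
    have "subfield_closed {x. \<sigma> x \<in> E}"
      unfolding subfield_closed_def using subfield_closedD[OF E_closed] by (simp add: inv)
    moreover have "K \<union> lev n \<subseteq> {x. \<sigma> x \<in> E}"
      using K_fixed[OF that(2)] K_subset_E group_lev[OF that(2), of _ n] lev_subset_E[of n] by auto
    ultimately have "E \<subseteq> {x. \<sigma> x \<in> E}"
      unfolding E_def[symmetric] by (subst (1) E_def) (rule gen_subfield_least)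
    then show ?thesis
      using that(1) by auto
  qed
  have "bij_betw \<sigma> E E"
    by (intro bij_betwI[of _ _ _ "inv_into UNIV \<sigma>"])
       (auto simp: into \<sigma> group_inv inv_left inv_right)
  moreover have "unital_hom \<sigma>"
    using \<sigma> by (simp add: ac_auts_def)
  ultimately show ?thesis
    unfolding Gal_iff using K_fixed[OF \<sigma>] K_subset_E subfield_closedD(3,4)[OF E_closed]
    by (auto simp: bij_betw_restrict_eq unital_hom.add unital_hom.mult subset_iff)
qed

text \<open>The automorphism of words is transported level by level along the labels, realised by an
  element of \<open>ac_auts\<close> and restricted to \<open>E\<close>. Together with injectivity
  this shows that automorphisms fixing only \<open>K\<close> give nothing more on
  \<open>E\<close>.\<close>

lemma word_map_surj:
  assumes "f \<in> carrier (wreath_power d n)"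
  shows "f \<in> word_map ` Gal"
proof -
  from assms have ext: "f \<in> extensional (tree_verts d n)"
    and bij: "bij_betw f (tree_verts d n) (tree_verts d n)" and Nil: "f [] = []"
    and bl: "\<And>xs. xs \<in> tree_verts d n \<Longrightarrow> xs \<noteq> [] \<Longrightarrow> f (butlast xs) = butlast (f xs)"
    by (auto simp: wreath_power_def)
  have into: "f xs \<in> tree_verts d n" if "xs \<in> tree_verts d n" for xs
    using bij that by (auto simp: bij_betw_def)
  have inj: "xs = ys" if "f xs = f ys" "xs \<in> tree_verts d n" "ys \<in> tree_verts d n" for xs ys
    using bij that by (auto simp: bij_betw_def inj_on_def)
  have nil: "[] \<in> tree_verts d n"
    by (simp add: tree_verts_def)
  have len: "f xs \<in> words j" if "j \<le> n" "xs \<in> words j" for j xs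
    using that
  proof (induction j arbitrary: xs)
    case 0
    then show ?case by (simp add: Nil)
  next
    case (Suc j)
    obtain ys i where ys: "xs = ys @ [i]" "ys \<in> words j" "i < d"
      using Suc.prems(2) by (rule words_SucE)
    have xs: "xs \<in> tree_verts d n" "xs \<noteq> []"
      using words_in_tree_verts Suc.prems ys by auto
    have ne: "f xs \<noteq> []"
      using inj[OF _ xs(1) nil] Nil xs(2) by auto
    have "butlast (f xs) \<in> words j"
      using bl[OF xs] Suc.IH[OF _ ys(2)] Suc.prems ys(1) by simp
    moreover have "f xs = butlast (f xs) @ [last (f xs)]"
      using ne by simp
    moreover have "set (f xs) \<subseteq> {..<d}"
      using into[OF xs(1)] by (simp add: tree_verts_def)
    ultimately show ?case
      using ne by (auto simp: words_def)
  qed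
  define g where "g j x = vertex (f (label j x))" for j x
  have gl: "g j x \<in> lev j" if "j \<le> n" "x \<in> lev j" for j x
    unfolding g_def using vertex_in_lev[OF that(1) len[OF that(1)]] label[OF that] by simp
  have "tree_auto n g"
    unfolding tree_auto_def
  proof (intro conjI allI impI ballI)
    fix j assume j: "j \<le> n"
    have "inj_on (g j) (lev j)"
    proof (rule inj_onI)
      fix x y assume x: "x \<in> lev j" and y: "y \<in> lev j" and eq: "g j x = g j y"
      note lx = label[OF j x] and ly = label[OF j y]
      have "f (label j x) = f (label j y)"
        using vertex_eqD[OF j len[OF j] len[OF j]] lx ly eq by (simp add: g_def)
      then have "label j x = label j y"
        using inj words_in_tree_verts[OF j] lx ly by simp
      then show "x = y"
        using lx ly by metis
    qed
    moreover have "g j ` lev j \<subseteq> lev j"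
      using gl[OF j] by auto
    ultimately show "bij_betw (g j) (lev j) (lev j)"
      using endo_inj_surj[OF finite_lev[OF j]] by (simp add: bij_betw_def)
  next
    fix j y x assume j: "j < n" and y: "y \<in> lev j" and x: "x \<in> child y"
    have xl: "x \<in> lev (Suc j)"
      using x y by auto
    note lx = label[OF _ xl] and ly = label[OF less_imp_le[OF j] y]
    have lx': "label (Suc j) x \<in> words (Suc j)" "vertex (label (Suc j) x) = x"
      using lx j by auto
    obtain ys i where ys: "label (Suc j) x = ys @ [i]" "ys \<in> words j" "i < d"
      using lx'(1) by (rule words_SucE)
    have "x \<in> child (vertex ys)"
      using vertex_child[OF j ys(2,3)] lx'(2) ys(1) by simp
    then have yv: "vertex ys = y"
      using x by (rule child_unique)
    then have yl: "ys = label j y"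
      using label_vertex[OF less_imp_le[OF j] ys(2)] by simp
    have "f (label (Suc j) x) \<in> words (Suc j)"
      using len[OF _ lx'(1)] j by simp
    then obtain zs k where zs: "f (label (Suc j) x) = zs @ [k]" "zs \<in> words j" "k < d"
      by (rule words_SucE)
    have "f (butlast (label (Suc j) x)) = butlast (f (label (Suc j) x))"
      using words_in_tree_verts[of "Suc j"] lx'(1) j ys by (intro bl) auto
    then have "f ys = zs"
      using ys zs by simp
    then show "g (Suc j) x \<in> child (g j y)"
      using vertex_child[OF j zs(2,3)] zs(1) yl by (simp add: g_def)
  qed
  then obtain \<sigma> where \<sigma>: "\<sigma> \<in> ac_auts" "\<And>j x. j \<le> n \<Longrightarrow> x \<in> lev j \<Longrightarrow> \<sigma> x = g j x"
    using tree_auto_realised by meson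
  have "word_map (restrict \<sigma> E) = f"
  proof (rule extensionalityI[of _ "tree_verts d n"])
    show "word_map (restrict \<sigma> E) \<in> extensional (tree_verts d n)"
      by (simp add: word_map_def)
    fix xs assume xs: "xs \<in> tree_verts d n"
    then have w: "length xs \<le> n" "xs \<in> words (length xs)"
      by (auto simp: tree_verts_conv)
    have "\<sigma> (vertex xs) = vertex (f xs)"
      using \<sigma>(2)[OF w(1) vertex_in_lev[OF w]] label_vertex[OF w] by (simp add: g_def)
    then show "word_map (restrict \<sigma> E) xs = f xs"
      using xs vertex_in_E[OF xs] label_vertex[OF w(1) len[OF w]] by (simp add: word_map_def)
  qed (rule ext)
  then show ?thesis
    using restrict_in_Gal[OF \<sigma>(1)] by blast
qed

theorem Gal_iso_wreath_power: "Gal_over K E \<cong> wreath_power d n"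
proof (rule is_isoI[of word_map])
  show "word_map \<in> iso (Gal_over K E) (wreath_power d n)"
    unfolding iso_def hom_def bij_betw_def
    using word_map_in_wreath word_map_mult word_map_inj word_map_surj by auto
qed

end

section \<open>The specialised family\<close>

lemma ring_rel_den_eval:
  assumes "ring_rel S" "\<And>i. i \<le> d \<Longrightarrow> (b i, c i) \<in> S" "(x, y) \<in> S"
  shows "(den_eval d b x, den_eval d c y) \<in> S"
  unfolding den_eval_def
  by (intro ring_rel_sum[OF assms(1)] ring_relD(5)[OF assms(1)] ring_rel_power[OF assms(1)] assms(2,3)) simp

lemma coeff_pcompose_linear_top:
  fixes p :: "'a::idom poly"
  assumes "degree p \<le> d"
  shows "coeff (pcompose p [:t, 1:]) d = coeff p d"
    and "i > d \<Longrightarrow> coeff (pcompose p [:t, 1:]) i = 0"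
proof -
  have deg: "degree (pcompose p [:t, 1:]) = degree p"
    by (simp add: degree_pcompose)
  show "coeff (pcompose p [:t, 1:]) d = coeff p d"
  proof (cases "degree p = d")
    case True
    then show ?thesis
      using lead_coeff_comp[of "[:t, 1:]" p] deg by simp
  next
    case False
    then show ?thesis
      using assms deg by (simp add: coeff_eq_0)
  qed
  show "coeff (pcompose p [:t, 1:]) i = 0" if "i > d"
    using that assms deg by (simp add: coeff_eq_0)
qed

lemma poly_conv_sum:
  fixes p :: "'a::comm_ring_1 poly"
  assumes "degree p \<le> d"
  shows "poly p x = (\<Sum>i\<le>d. coeff p i * x ^ i)"
  unfolding poly_altdef using assms by (intro sum.mono_neutral_left) (auto simp: coeff_eq_0)

definition den_poly :: "nat \<Rightarrow> (nat \<Rightarrow> 'a::comm_ring_1) \<Rightarrow> 'a poly" where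
  "den_poly d u = (\<Sum>j\<le>d. monom (u j) j)"

definition num_poly :: "nat \<Rightarrow> (nat \<Rightarrow> 'a::comm_ring_1) \<Rightarrow> 'a poly" where
  "num_poly d s = monom 1 d + (\<Sum>i<d. monom (s i) i)"

lemma coeff_den_poly: "coeff (den_poly d u) i = (if i \<le> d then u i else 0)"
  by (simp add: den_poly_def coeff_sum sum.delta)

lemma coeff_num_poly: "coeff (num_poly d s) i = (if i < d then s i else if i = d then 1 else 0)"
  by (simp add: num_poly_def coeff_sum sum.delta)

lemma poly_den_poly: "poly (den_poly d u) x = den_eval d u x"
  by (simp add: den_poly_def den_eval_def poly_sum poly_monom)

lemma poly_num_poly: "poly (num_poly d s) x = num_eval d s x"
  by (simp add: num_poly_def num_eval_def poly_sum poly_monom)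

lemma degree_den_poly: "degree (den_poly d u) \<le> d"
  by (intro degree_le) (simp add: coeff_den_poly)

definition lin_prod :: "nat \<Rightarrow> (nat \<Rightarrow> 'a::comm_ring_1) \<Rightarrow> 'a poly" where
  "lin_prod d y = (\<Prod>i<d. [:- y i, 1:])"

lemma poly_lin_prod: "poly (lin_prod d y) x = (\<Prod>i<d. x - y i)"
  by (simp add: lin_prod_def poly_prod)

lemma degree_lin_prod: "degree (lin_prod d (y :: nat \<Rightarrow> 'a::idom)) = d"
  by (simp add: lin_prod_def degree_prod_sum_eq)

lemma coeff_lin_prod_top: "coeff (lin_prod d (y :: nat \<Rightarrow> 'a::idom)) d = 1"
proof -
  have "lead_coeff (lin_prod d y) = 1"
    unfolding lin_prod_def by (simp add: lead_coeff_prod)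
  then show ?thesis
    by (simp add: degree_lin_prod)
qed

lemma cst_eq_iff [simp]: "cst x = cst z \<longleftrightarrow> x = z"
  by (simp add: inj_eq[OF unital_hom_inj[OF unital_hom_cst]])

lemma cst_eq_0_iff [simp]: "cst x = 0 \<longleftrightarrow> x = 0"
  using unital_hom_eq_0_iff[OF unital_hom_cst unital_hom_inj[OF unital_hom_cst]] .

lemma map_poly_den_poly:
  assumes "unital_hom h"
  shows "map_poly h (den_poly d u) = den_poly d (\<lambda>j. h (u j))"
  by (rule poly_eqI) (simp add: coeff_map_poly coeff_den_poly unital_hom.zero[OF assms])

lemma map_poly_lin_prod:
  assumes "unital_hom h"
  shows "map_poly h (lin_prod d y) = lin_prod d (\<lambda>i. h (y i))"
proof -
  interpret unital_hom h by fact
  show ?thesis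
    unfolding lin_prod_def by (simp add: map_poly_prod)
qed

text \<open>The flag \<open>ph\<close> selects between \<open>\<Phi>\<close> and the polynomial case, in which the denominator is 1.\<close>

definition gen_den :: "bool \<Rightarrow> nat \<Rightarrow> nat \<Rightarrow> 'k::field ratfun alg_closure" where
  "gen_den ph d j = (if ph then to_ac (indet (d + j)) else if j = 0 then 1 else 0)"

definition gen_num :: "nat \<Rightarrow> 'k::field ratfun alg_closure" where
  "gen_num i = to_ac (indet i)"

text \<open>The parameters have indices \<open>i < d\<close> for the roots \<open>y i\<close>,
  \<open>d\<close> for \<open>v\<close>, and \<open>d + 1 + j\<close> for the coefficient
  \<open>b j\<close>. The condition at \<open>2 * d + 1\<close> makes the residue of
  \<open>b d\<close> vanish, so that residual fibres keep degree \<open>d\<close> and the factor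
  \<open>c\<close> is a unit.\<close>

locale special_family =
  fixes ph :: bool and d N :: nat and a :: "nat \<Rightarrow> 'k::field alg_closure"
  assumes d_gt_1: "d > 1" and a_top: "ph \<Longrightarrow> a (2 * d + 1) = 0"
begin

definition "y i = series_var a i"
definition "v = series_var a d"
definition "b j = (if ph then series_var a (d + 1 + j) else if j = 0 then 1 else 0)"
definition "b0 j = (if ph then a (d + 1 + j) else if j = 0 then 1 else 0)"

fun orb0 :: "nat \<Rightarrow> 'k alg_closure" where
  "orb0 0 = a d"
| "orb0 (Suc k) = a d + (\<Prod>i<d. orb0 k - a i) / den_eval d b0 (orb0 k)"

fun orb :: "nat \<Rightarrow> 'k series" where
  "orb 0 = v"
| "orb (Suc k) = v + (\<Prod>i<d. orb k - y i) * inverse (den_eval d b (orb k))"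

definition "t = orb N"
text \<open>The leading coefficient of the numerator of \<open>g (x + t) - t\<close>, with
  \<open>g\<close> the special map; this conjugate moves the root of the tree from \<open>t\<close>
  to \<open>0\<close>. Dividing numerator and denominator by \<open>c\<close> makes the numerator
  monic, as in the generic map.\<close>

definition "c = 1 + (v - t) * b d"
definition "numP = smult (inverse c) (smult (v - t) (pcompose (den_poly d b) [:t, 1:])
    + pcompose (lin_prod d y) [:t, 1:])"
definition "denP = smult (inverse c) (pcompose (den_poly d b) [:t, 1:])"

text \<open>Images of all indeterminates. Those that are not coefficients of the generic map go to
  the series variable of the next index, because the special map has one parameter more, namely
  \<open>v\<close>.\<close>

definition "\<xi> i = (if i < d then coeff numP i else if ph \<and> i \<le> 2 * d then coeff denP (i - d)
    else series_var a (i + 1))"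

definition "\<iota> = mpoly_eval (\<lambda>c. series_const (to_ac c)) \<xi>"

abbreviation "res w \<equiv> fps_nth w 0"

lemma res_var: "res (series_var a i) = cst (a i)"
  by (simp add: series_var_def series_const_def)

lemma res_b: "res (b j) = cst (b0 j)"
  by (simp add: b_def b0_def res_var unital_hom.one[OF unital_hom_cst] unital_hom.zero[OF unital_hom_cst])

lemma res_den_eval:
  assumes "res x = cst r"
  shows "res (den_eval d b x) = cst (den_eval d b0 r)"
proof -
  interpret r: unital_hom "\<lambda>w::'k series. res w"
    by (rule unital_hom_fps_nth_0)
  interpret c: unital_hom "cst :: 'k alg_closure \<Rightarrow> _"
    by (rule unital_hom_cst)
  show ?thesis
    unfolding den_eval_def r.sum r.mult r.power res_b assms by simp
qed

lemma res_prod: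
  assumes "res x = cst r"
  shows "res (\<Prod>i<d. x - y i) = cst (\<Prod>i<d. r - a i)"
proof -
  interpret r: unital_hom "\<lambda>w::'k series. res w"
    by (rule unital_hom_fps_nth_0)
  interpret c: unital_hom "cst :: 'k alg_closure \<Rightarrow> _"
    by (rule unital_hom_cst)
  show ?thesis
    unfolding r.prod r.diff y_def res_var assms by simp
qed

lemma b0_top: "b0 d = 0"
  using a_top d_gt_1 by (simp add: b0_def mult_2)

text \<open>\<open>inverse\<close> of a power series inverts it only if its constant term is
  nonzero; this condition makes the quotients in \<open>orb\<close> genuine.\<close>

definition "orbit_defined \<longleftrightarrow> (\<forall>k<N. den_eval d b0 (orb0 k) \<noteq> 0)"

lemma res_orb:
  assumes "orbit_defined" "k \<le> N"
  shows "res (orb k) = cst (orb0 k)"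
  using assms(2)
proof (induction k)
  case 0
  show ?case by (simp add: v_def res_var)
next
  case (Suc k)
  then have IH: "res (orb k) = cst (orb0 k)"
    by simp
  show ?case
    using res_prod[OF IH] res_den_eval[OF IH]
    by (simp add: v_def res_var unital_hom_divide[OF unital_hom_cst] unital_hom.add[OF unital_hom_cst])
       (simp add: divide_inverse)
qed

lemma orb_den_inverse:
  assumes "orbit_defined" "k < N"
  shows "den_eval d b (orb k) * inverse (den_eval d b (orb k)) = 1"
proof -
  have "res (den_eval d b (orb k)) \<noteq> 0"
    using res_den_eval[OF res_orb[OF assms(1), of k]] assms by (simp add: orbit_defined_def)
  then show ?thesis
    using inverse_mult_eq_1[of "den_eval d b (orb k)"] by (simp add: mult.commute)
qed

lemma c_inverse: "c * inverse c = 1"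
proof -
  have "res c = 1"
    by (simp add: c_def res_b b0_top unital_hom.zero[OF unital_hom_cst])
  then show ?thesis
    using inverse_mult_eq_1[of c] by (simp add: mult.commute)
qed

lemma coeff_numP_top: "coeff numP d = 1" and coeff_numP_gt: "i > d \<Longrightarrow> coeff numP i = 0"
  using coeff_pcompose_linear_top[OF degree_den_poly[of d b], where t = t]
    coeff_pcompose_linear_top[where p = "lin_prod d y" and d = d and t = t] c_inverse
  by (simp_all add: numP_def degree_lin_prod coeff_lin_prod_top coeff_den_poly c_def
      algebra_simps)

lemma coeff_denP_gt: "i > d \<Longrightarrow> coeff denP i = 0"
  using coeff_pcompose_linear_top(2)[OF degree_den_poly[of d b], where t = t] by (simp add: denP_def)

lemma denP_poly_case:
  assumes "\<not> ph" "j \<le> d"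
  shows "coeff denP j = (if j = 0 then 1 else 0)"
proof -
  have bj: "b i = (if i = 0 then 1 else 0)" for i
    unfolding b_def using assms(1) by (simp only: if_False)
  have "den_poly d b = [:1:]"
    by (rule poly_eqI) (simp add: coeff_den_poly bj coeff_pCons split: nat.splits)
  moreover have "c = 1"
    using d_gt_1 by (simp add: c_def bj)
  ultimately show ?thesis
    by (simp add: denP_def pcompose_pCons coeff_pCons split: nat.splits)
qed

lemma unital_hom_\<iota>: "unital_hom \<iota>"
  unfolding \<iota>_def by (rule unital_hom_mpoly_eval[OF unital_hom_series_const_to_ac])

lemma \<iota>_mvar [simp]: "\<iota> (mvar i) = \<xi> i" and \<iota>_mconst [simp]: "\<iota> (mconst k) = series_const (to_ac k)"
  unfolding \<iota>_def
  by (simp_all add: mpoly_eval_mvar mpoly_eval_mconst unital_hom_series_const_to_ac)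

text \<open>A point of the generic tree at level \<open>N\<close> and its children specialise the family
  back to the generic map with \<open>t = 0\<close>, so no algebraic relation can hold between the coefficients.\<close>

lemma inj_\<iota>:
  fixes \<omega> :: "nat \<Rightarrow> 'k ratfun alg_closure"
  assumes orbit: "orbit_defined"
    and chain: "\<And>k. k < N \<Longrightarrow> num_eval d gen_num (\<omega> k) = \<omega> (Suc k) * den_eval d (gen_den ph d) (\<omega> k)"
    and den: "\<And>k. k < N \<Longrightarrow> den_eval d (gen_den ph d) (\<omega> k) \<noteq> 0"
    and root0: "\<omega> N = 0" and top: "\<omega> 0 * gen_den ph d d \<noteq> 1"
  shows "inj \<iota>"
proof -
  let ?s = "gen_num :: nat \<Rightarrow> 'k ratfun alg_closure"
  let ?u = "gen_den ph d :: nat \<Rightarrow> 'k ratfun alg_closure"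
  define \<nu> where "\<nu> = \<omega> 0"
  \<comment> \<open>The leading coefficient of \<open>P\<close>; the hypothesis \<open>top\<close>
    says that no child of \<open>\<nu>\<close> escapes to infinity.\<close>
  define q where "q = 1 - \<nu> * ?u d"
  have q: "q \<noteq> 0"
    using top by (simp add: q_def \<nu>_def)
  have q1: "q = 1" if "\<not> ph"
    using that d_gt_1 by (simp add: q_def gen_den_def)
  define P where "P = num_poly d ?s - smult \<nu> (den_poly d ?u)"
  have Pd: "coeff P d = q" and Pgt: "i > d \<Longrightarrow> coeff P i = 0" for i
    by (simp_all add: P_def q_def coeff_num_poly coeff_den_poly)
  have degP: "degree P = d"
    using Pd Pgt q by (metis degree_le le_antisym le_degree not_le)
  have "P \<noteq> 0"
    using Pd q by auto
  then obtain R where R: "size R = d" "P = smult q (\<Prod>x\<in>#R. [:- x, 1:])"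
    using alg_closed_imp_factorization[of P] Pd degP by auto
  obtain rs where rs: "mset rs = R"
    by (metis ex_mset)
  have len: "length rs = d"
    using rs R(1) by (metis size_mset)
  define \<rho> where "\<rho> i = rs ! i" for i
  have "(\<Prod>x\<in>#R. [:- x, 1:]) = prod_list (map (\<lambda>x. [:- x, 1:]) rs)"
    by (simp add: rs[symmetric] prod_mset_prod_list flip: mset_map)
  also have "\<dots> = lin_prod d \<rho>"
    by (simp add: prod.list_conv_set_nth len lin_prod_def \<rho>_def lessThan_atLeast0)
  finally have Pfac: "P = smult q (lin_prod d \<rho>)"
    using R(2) by simp
  \<comment> \<open>\<open>P\<close> is the generic numerator minus \<open>\<nu>\<close> times the
    denominator. Dividing \<open>P\<close> and the denominator by \<open>q\<close> writes the
    generic map as \<open>\<nu>\<close> plus the monic product over the roots \<open>\<rho>\<close>,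
    divided by the polynomial with coefficients \<open>\<beta>\<close>.\<close>
  define \<beta> where "\<beta> j = ?u j / q" for j
  define vals where "vals i = (if i < d then \<rho> i else if i = d then \<nu>
      else if ph \<and> i \<le> 2 * d + 1 then \<beta> (i - d - 1) else to_ac (indet (i - 1)))" for i
  note hc = unital_hom_comp[OF unital_hom_to_ac unital_hom_cst]
  define e2 :: "'k mpoly \<Rightarrow> 'k ratfun alg_closure" where "e2 = mpoly_eval (\<lambda>x. to_ac (cst x)) vals"
  have e2: "unital_hom e2"
    unfolding e2_def by (rule unital_hom_mpoly_eval[OF hc])
  interpret e1: unital_hom "series_eval a"
    by (rule unital_hom_series_eval)
  interpret e2: unital_hom e2
    by (rule e2)
  \<comment> \<open>The substitution of \<open>vals\<close>, extended to fractions whose denominator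
    survives it; \<open>inverse c\<close> and the inverses along the orbit are of this kind.\<close>
  define S where "S = {(w, z). \<exists>p r. e2 r \<noteq> 0 \<and> w * series_eval a r = series_eval a p \<and> z * e2 r = e2 p}"
  have SI: "(w, z) \<in> S" if "e2 r \<noteq> 0" "w * series_eval a r = series_eval a p" "z * e2 r = e2 p" for w z p r
    using that unfolding S_def by blast
  have S: "ring_rel S"
    unfolding ring_rel_def
  proof (intro conjI allI impI)
    show "(0, 0) \<in> S" by (rule SI[of 1 _ 0]) simp_all
    show "(1, 1) \<in> S" by (rule SI[of 1 _ 1]) simp_all
  next
    fix w z w' z' assume "(w, z) \<in> S" "(w', z') \<in> S"
    then obtain p r p' r' where
      1: "e2 r \<noteq> 0" "w * series_eval a r = series_eval a p" "z * e2 r = e2 p" and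
      2: "e2 r' \<noteq> 0" "w' * series_eval a r' = series_eval a p'" "z' * e2 r' = e2 p'"
      unfolding S_def by blast
    show "(w + w', z + z') \<in> S"
      by (rule SI[of "r * r'" _ "p * r' + p' * r"]) (use 1 in simp, use 2 in simp, simp_all add: 1(2,3)[symmetric] 2(2,3)[symmetric] algebra_simps)
    show "(w - w', z - z') \<in> S"
      by (rule SI[of "r * r'" _ "p * r' - p' * r"]) (use 1 2 in simp, simp_all add: 1(2,3)[symmetric] 2(2,3)[symmetric] algebra_simps)
    show "(w * w', z * z') \<in> S"
      by (rule SI[of "r * r'" _ "p * p'"]) (use 1 2 in simp, simp_all add: 1(2,3)[symmetric] 2(2,3)[symmetric] algebra_simps)
  qed
  \<comment> \<open>Here injectivity of \<open>series_eval\<close> enters: a fraction equal to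
    \<open>0\<close> has numerator \<open>0\<close> already as a polynomial.\<close>
  have S_zero: "z = 0" if z: "(0, z) \<in> S" for z
  proof -
    obtain p r where pr: "e2 r \<noteq> 0" "0 * series_eval a r = series_eval a p" "z * e2 r = e2 p"
      using z unfolding S_def by blast
    then have "p = 0"
      using unital_hom_eq_0_iff[OF unital_hom_series_eval inj_series_eval, of a p] by simp
    then show ?thesis
      using pr by simp
  qed
  have S_inverse: "(w', inverse z) \<in> S" if wz: "(w, z) \<in> S" "z \<noteq> 0" "w * w' = 1" for w w' z
  proof -
    obtain p r where pr: "e2 r \<noteq> 0" "w * series_eval a r = series_eval a p" "z * e2 r = e2 p"
      using wz(1) unfolding S_def by blast
    have "w' * series_eval a p = (w * w') * series_eval a r"
      unfolding pr(2)[symmetric] by (simp add: algebra_simps)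
    then have "w' * series_eval a p = series_eval a r"
      using wz(3) by simp
    moreover have "e2 p \<noteq> 0" "inverse z * e2 p = e2 r"
      using pr(1) wz(2) by (auto simp: pr(3)[symmetric])
    ultimately show ?thesis
      by (intro SI[of p _ r])
  qed
  have Svar: "(series_var a i, vals i) \<in> S" for i
    by (rule SI[of 1 _ "mvar i"]) (simp_all add: e2_def mpoly_eval_mvar[OF hc] unital_hom.one[OF unital_hom_mpoly_eval[OF hc]])
  have Sconst: "(series_const (to_ac x), to_ac (cst x)) \<in> S" for x
    by (rule SI[of 1 _ "mconst x"]) (simp_all add: e2_def mpoly_eval_mconst[OF hc] unital_hom.one[OF unital_hom_mpoly_eval[OF hc]])
  have Sy: "(y i, \<rho> i) \<in> S" if "i < d" for i
    using Svar[of i] that by (simp add: y_def vals_def)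
  have Sv: "(v, \<nu>) \<in> S"
    using Svar[of d] by (simp add: v_def vals_def)
  have Sb: "(b j, \<beta> j) \<in> S" if "j \<le> d" for j
  proof (cases ph)
    case True
    then show ?thesis
      using Svar[of "d + 1 + j"] that unfolding b_def vals_def by simp
  next
    case False
    then show ?thesis
      using ring_relD(1,2)[OF S] unfolding b_def \<beta>_def gen_den_def q1[OF False] by simp
  qed
  have den_\<beta>: "den_eval d \<beta> x = den_eval d ?u x / q" for x
    by (simp add: den_eval_def \<beta>_def sum_divide_distrib)
  have prod_\<rho>: "(\<Prod>i<d. x - \<rho> i) = (num_eval d ?s x - \<nu> * den_eval d ?u x) / q" for x
  proof -
    have "poly P x = q * (\<Prod>i<d. x - \<rho> i)"
      by (simp add: Pfac poly_lin_prod)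
    moreover have "poly P x = num_eval d ?s x - \<nu> * den_eval d ?u x"
      by (simp add: P_def poly_num_poly poly_den_poly)
    ultimately show ?thesis
      using q by (simp add: field_simps)
  qed
  have Sorb: "(orb k, \<omega> k) \<in> S" if "k \<le> N" for k
    using that
  proof (induction k)
    case 0
    then show ?case
      using Sv by (simp add: \<nu>_def)
  next
    case (Suc k)
    then have k: "k < N" and IH: "(orb k, \<omega> k) \<in> S"
      by auto
    have dn: "den_eval d ?u (\<omega> k) \<noteq> 0"
      using den[OF k] .
    have "(den_eval d b (orb k), den_eval d \<beta> (\<omega> k)) \<in> S"
      using ring_rel_den_eval[OF S Sb IH] .
    then have "(inverse (den_eval d b (orb k)), inverse (den_eval d \<beta> (\<omega> k))) \<in> S"
      using orb_den_inverse[OF orbit k] dn q by (intro S_inverse) (simp_all add: den_\<beta>)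
    moreover have "((\<Prod>i<d. orb k - y i), (\<Prod>i<d. \<omega> k - \<rho> i)) \<in> S"
      using Sy IH by (intro ring_rel_prod[OF S] ring_relD(4)[OF S]) simp_all
    ultimately have "(orb (Suc k), \<nu> + (\<Prod>i<d. \<omega> k - \<rho> i) * inverse (den_eval d \<beta> (\<omega> k))) \<in> S"
      using Sv by (simp add: ring_relD[OF S])
    moreover have "\<nu> + (\<Prod>i<d. \<omega> k - \<rho> i) * inverse (den_eval d \<beta> (\<omega> k)) = \<omega> (Suc k)"
      using chain[OF k] dn q by (simp add: den_\<beta> prod_\<rho> field_simps)
    ultimately show ?case by simp
  qed
  have St: "(t, 0) \<in> S"
    using Sorb[of N] root0 by (simp add: t_def)
  \<comment> \<open>The normalising factor \<open>c\<close> specialises to \<open>1 / q\<close>, so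
    dividing by \<open>c\<close> undoes the division by \<open>q\<close>.\<close>
  have c': "1 + (\<nu> - 0) * \<beta> d = 1 / q"
    using q by (simp add: \<beta>_def field_simps) (simp add: q_def algebra_simps)
  have "(c, 1 + (\<nu> - 0) * \<beta> d) \<in> S"
    unfolding c_def using Sv St Sb[of d] by (intro ring_relD(2,3,4,5)[OF S]) simp_all
  then have "(inverse c, inverse (1 / q)) \<in> S"
    using c_inverse q unfolding c' by (intro S_inverse) simp_all
  then have Sc: "(inverse c, q) \<in> S"
    by simp
  note PG = ring_rel_poly_graph[OF S]
  have smult_PG: "(smult w p, smult z r) \<in> poly_graph S" if "(w, z) \<in> S" "(p, r) \<in> poly_graph S" for w z p r
    using ring_relD(5)[OF PG ring_rel_poly_graph_const[OF S that(1)] that(2)] by simp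
  have lin: "([:t, 1:], [:0, 1:]) \<in> poly_graph S"
    using ring_rel_poly_graph_pCons[OF St ring_rel_poly_graph_const[OF S ring_relD(2)[OF S]]] .
  have PGb: "(den_poly d b, den_poly d \<beta>) \<in> poly_graph S"
    using Sb ring_relD(1)[OF S] by (simp add: poly_graph_def coeff_den_poly)
  have PGy: "(lin_prod d y, lin_prod d \<rho>) \<in> poly_graph S"
    unfolding lin_prod_def
  proof (rule ring_rel_prod[OF PG])
    fix i assume "i \<in> {..<d}"
    then have "(0 - y i, 0 - \<rho> i) \<in> S"
      by (intro ring_relD(1,4)[OF S] Sy) simp
    then show "([:- y i, 1:], [:- \<rho> i, 1:]) \<in> poly_graph S"
      using ring_rel_poly_graph_pCons ring_rel_poly_graph_const[OF S ring_relD(2)[OF S]] by simp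
  qed
  have comp_b: "(pcompose (den_poly d b) [:t, 1:], den_poly d \<beta>) \<in> poly_graph S"
    and comp_y: "(pcompose (lin_prod d y) [:t, 1:], lin_prod d \<rho>) \<in> poly_graph S"
    using ring_rel_poly_graph_pcompose[OF S PGb lin] ring_rel_poly_graph_pcompose[OF S PGy lin]
    by (simp_all add: pcompose_idR)
  have u_eq: "smult q (den_poly d \<beta>) = den_poly d ?u"
    by (rule poly_eqI) (use q in \<open>simp add: coeff_den_poly \<beta>_def\<close>)
  have "(numP, smult q (smult (\<nu> - 0) (den_poly d \<beta>) + lin_prod d \<rho>)) \<in> poly_graph S"
    unfolding numP_def using Sv St
    by (intro smult_PG[OF Sc] ring_relD(3)[OF PG] smult_PG ring_relD(4)[OF S] comp_b comp_y)
  moreover have "smult q (smult (\<nu> - 0) (den_poly d \<beta>) + lin_prod d \<rho>) = num_poly d ?s"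
  proof -
    have "smult q (smult (\<nu> - 0) (den_poly d \<beta>) + lin_prod d \<rho>) =
        smult \<nu> (smult q (den_poly d \<beta>)) + smult q (lin_prod d \<rho>)"
      by (simp add: smult_add_right mult.commute)
    also have "\<dots> = num_poly d ?s"
      unfolding u_eq Pfac[symmetric] by (simp add: P_def)
    finally show ?thesis .
  qed
  ultimately have "(numP, num_poly d ?s) \<in> poly_graph S"
    by (simp only:)
  then have Snum: "(coeff numP i, coeff (num_poly d ?s) i) \<in> S" for i
    by (simp add: poly_graph_def)
  have "(denP, smult q (den_poly d \<beta>)) \<in> poly_graph S"
    unfolding denP_def by (rule smult_PG[OF Sc comp_b])
  then have Sden: "(coeff denP i, coeff (den_poly d ?u) i) \<in> S" for i
    unfolding u_eq by (simp add: poly_graph_def)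
  have S\<xi>: "(\<xi> i, to_ac (indet i)) \<in> S" for i
  proof -
    consider "i < d" | "i \<ge> d" "ph" "i \<le> 2 * d" | "i \<ge> d" "\<not> (ph \<and> i \<le> 2 * d)"
      by linarith
    then show ?thesis
    proof cases
      case 1
      then show ?thesis
        using Snum[of i] by (simp add: \<xi>_def coeff_num_poly gen_num_def)
    next
      case 2
      then have "i - d \<le> d" "d + (i - d) = i" "\<not> i < d"
        by simp_all
      then have "\<xi> i = coeff denP (i - d)" "coeff (den_poly d ?u) (i - d) = to_ac (indet i)"
        using 2 unfolding \<xi>_def coeff_den_poly gen_den_def by simp_all
      then show ?thesis
        using Sden[of "i - d"] by simp
    next
      case 3
      then show ?thesis
        using Svar[of "Suc i"] unfolding \<xi>_def vals_def by auto
    qed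
  qed
  have S\<iota>: "(\<iota> p, to_ac (frac_of p)) \<in> S" for p
  proof (induction p rule: mpoly_induct)
    case (const x)
    then show ?case
      using Sconst by (simp add: cst_conv_mconst)
  next
    case (var i)
    then show ?case
      using S\<xi> by (simp add: indet_conv_mvar)
  next
    case (add p r)
    then show ?case
      using ring_relD(3)[OF S] by (simp add: unital_hom.add[OF unital_hom_\<iota>] unital_hom.add[OF unital_hom_frac_of])
  next
    case (mult p r)
    then show ?case
      using ring_relD(5)[OF S] by (simp add: unital_hom.mult[OF unital_hom_\<iota>] unital_hom.mult[OF unital_hom_frac_of])
  qed
  show ?thesis
  proof (rule inj_unital_homI[OF unital_hom_\<iota>])
    fix p assume p: "\<iota> p = 0"
    have "to_ac (frac_of p) = (0 :: 'k ratfun alg_closure)"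
      by (rule S_zero) (use S\<iota>[of p] p in \<open>simp only:\<close>)
    then show "p = 0"
      by (simp add: unital_hom_eq_0_iff[OF unital_hom_frac_of inj_frac_of])
  qed
qed

end

section \<open>Transfer between the generic and the specialised tree\<close>

lemma poly_root_lift:
  fixes f :: "'a::alg_closed_field \<Rightarrow> 'b::field"
  assumes f: "unital_hom f" and "p \<noteq> 0" "poly (map_poly f p) x = 0"
  obtains r where "poly p r = 0" "f r = x"
proof -
  interpret unital_hom f by fact
  obtain A where A: "p = smult (lead_coeff p) (\<Prod>r\<in>#A. [:- r, 1:])"
    using alg_closed_imp_factorization[OF assms(2)] by blast
  have lc: "f (lead_coeff p) \<noteq> 0"
    using unital_hom_eq_0_iff[OF f unital_hom_inj[OF f]] assms(2) by simp
  have map: "map_poly f (\<Prod>r\<in>#B. [:- r, 1:]) = (\<Prod>r\<in>#B. [:- f r, 1:])" for B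
    by (induction B) (simp_all add: map_poly_mult del: mult_pCons_left)
  have pr: "poly (\<Prod>r\<in>#B. [:- f r, 1:]) x = (\<Prod>r\<in>#B. x - f r)" for B
    by (induction B) (simp_all add: algebra_simps)
  have "map_poly f p = smult (f (lead_coeff p)) (\<Prod>r\<in>#A. [:- f r, 1:])"
    by (subst A) (simp add: map_poly_smult map)
  then have "(\<Prod>r\<in>#A. x - f r) = 0"
    using assms(3) lc by (simp add: pr)
  then obtain r where r: "r \<in># A" "f r = x"
    by (auto simp: prod_mset_zero_iff)
  moreover have "poly p r = 0"
  proof -
    have "poly (\<Prod>r\<in>#B. [:- r, 1:]) r = 0" if "r \<in># B" for B
      using that by (induction B) auto
    then show ?thesis
      using r(1) by (subst A) simp
  qed
  ultimately show thesis
    using that by blast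
qed

text \<open>Both maps have the same image: a value of one is a root of a polynomial over the common
  base, and the other reaches all roots of that polynomial because its source is algebraically
  closed. Composing one map with the inverse of the other gives \<open>\<sigma>\<close>.\<close>

lemma two_extensions:
  fixes f g :: "'a::field alg_closure \<Rightarrow> 'b::field"
  assumes f: "unital_hom f" and g: "unital_hom g" and eq: "\<And>k. f (to_ac k) = g (to_ac k)"
  obtains \<sigma> where "\<sigma> \<in> ac_auts" "\<And>x. g x = f (\<sigma> x)"
proof -
  have lift: "\<exists>x'. f1 x' = f2 x"
    if f1: "unital_hom f1" and f2: "unital_hom f2" and eq: "\<And>k. f1 (to_ac k) = f2 (to_ac k)"
    for f1 f2 :: "'a alg_closure \<Rightarrow> 'b" and x
  proof -
    obtain p where p: "p \<noteq> 0" "poly (map_poly to_ac p) x = 0"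
      by (rule alg_closure_algebraic)
    have "map_poly f1 (map_poly to_ac p) = map_poly f2 (map_poly to_ac p)"
      by (intro poly_eqI) (simp add: coeff_map_poly unital_hom.zero[OF f1] unital_hom.zero[OF f2] eq)
    then have "poly (map_poly f1 (map_poly to_ac p)) (f2 x) = 0"
      using unital_hom.poly_map_poly[OF f2, of "map_poly to_ac p" x] p(2) unital_hom.zero[OF f2] by simp
    moreover have "map_poly to_ac p \<noteq> 0"
      using p(1) by (simp add: poly_eq_iff coeff_map_poly)
    ultimately show ?thesis
      using poly_root_lift[OF f1] by metis
  qed
  define \<sigma> where "\<sigma> x = (SOME x'. f x' = g x)" for x
  have \<sigma>: "f (\<sigma> x) = g x" for x
    unfolding \<sigma>_def by (rule someI_ex) (rule lift[OF f g eq])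
  have inj: "x = y" if "f x = f y" for x y
    using unital_hom_inj[OF f] that by (rule injD)
  have "unital_hom \<sigma>"
  proof
    show "\<sigma> 1 = 1"
      by (rule inj) (simp add: \<sigma> unital_hom.one[OF f] unital_hom.one[OF g])
    show "\<sigma> (x + y) = \<sigma> x + \<sigma> y" "\<sigma> (x * y) = \<sigma> x * \<sigma> y" for x y
      by (rule inj; simp add: \<sigma> unital_hom.add[OF f] unital_hom.add[OF g] unital_hom.mult[OF f] unital_hom.mult[OF g])+
  qed
  moreover have "surj \<sigma>"
  proof (rule surjI)
    fix x
    have "\<exists>x'. g x' = f x"
      using lift[OF g f] eq by simp
    then have "g (SOME x'. g x' = f x) = f x"
      by (rule someI_ex)
    then show "\<sigma> (SOME x'. g x' = f x) = x"
      using \<sigma> inj by simp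
  qed
  moreover have "\<sigma> (to_ac k) = to_ac k" for k
    by (rule inj) (simp add: \<sigma> eq)
  ultimately have "\<sigma> \<in> ac_auts"
    using unital_hom_inj[of \<sigma>] by (simp add: ac_auts_def bij_def)
  then show thesis
    using that \<sigma> by metis
qed

type_synonym 'k big = "'k series fract alg_closure"

definition em :: "'k::field series \<Rightarrow> 'k big" where
  "em w = to_ac (frac_of w)"

lemma unital_hom_em: "unital_hom em"
  unfolding em_def[abs_def] by (rule unital_hom_comp[OF unital_hom_to_ac unital_hom_frac_of])

lemma inj_em: "inj em"
  by (rule injI) (simp add: em_def inj_eq[OF inj_frac_of])

lemma em_eq_iff [simp]: "em w = em z \<longleftrightarrow> w = z"
  by (simp add: inj_eq[OF inj_em])

interpretation em: unital_hom em
  by (rule unital_hom_em)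

lemma unital_hom_num_eval: "unital_hom h \<Longrightarrow> h (num_eval d s x) = num_eval d (\<lambda>i. h (s i)) (h x)"
  by (simp add: num_eval_def unital_hom.add unital_hom.sum unital_hom.mult unital_hom.power)

lemma unital_hom_den_eval: "unital_hom h \<Longrightarrow> h (den_eval d s x) = den_eval d (\<lambda>i. h (s i)) (h x)"
  by (simp add: den_eval_def unital_hom.sum unital_hom.mult unital_hom.power)

definition gen_child :: "bool \<Rightarrow> nat \<Rightarrow> 'k ratfun alg_closure \<Rightarrow> 'k::field ratfun alg_closure set" where
  "gen_child ph d = preimages d gen_num (gen_den ph d)"

definition gen_coprime :: "'k::field itself \<Rightarrow> bool \<Rightarrow> nat \<Rightarrow> bool" where
  "gen_coprime _ ph d \<longleftrightarrow> (\<forall>x :: 'k ratfun alg_closure.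
     \<not> (num_eval d gen_num x = 0 \<and> den_eval d (gen_den ph d) x = 0))"

locale special_embedding = special_family +
  fixes f :: "'a::field ratfun alg_closure \<Rightarrow> 'a big"
  assumes f: "unital_hom f" and f_frac: "\<And>p. f (to_ac (frac_of p)) = em (\<iota> p)"
    and orbit: orbit_defined
begin

text \<open>The fibre over \<open>Y\<close> of the special map before translation. Hence its tree
  starts at \<open>em t\<close> and is compared with the generic one through
  \<open>f x + em t\<close>.\<close>

definition "sp_child Y = {Z. (\<Prod>i<d. Z - em (y i)) = (Y - em v) * den_eval d (\<lambda>j. em (b j)) Z}"

abbreviation "slev \<equiv> tree_lev sp_child (em t)"
abbreviation "lev \<equiv> tree_lev (gen_child ph d) (0 :: 'a ratfun alg_closure)"

lemma f_num: "i < d \<Longrightarrow> f (gen_num i) = em (coeff numP i)"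
  by (simp add: gen_num_def indet_conv_mvar f_frac \<xi>_def)

lemma f_den: "j \<le> d \<Longrightarrow> f (gen_den ph d j) = em (coeff denP j)"
proof (cases ph)
  case True
  assume j: "j \<le> d"
  have "f (gen_den ph d j) = em (\<xi> (d + j))"
    by (simp only: gen_den_def if_P[OF True] indet_conv_mvar f_frac \<iota>_mvar)
  also have "\<xi> (d + j) = coeff denP j"
    unfolding \<xi>_def using True j by simp
  finally show ?thesis .
next
  case False
  assume j: "j \<le> d"
  show ?thesis
    unfolding gen_den_def denP_poly_case[OF False j] using False unital_hom.one[OF f] unital_hom.zero[OF f] by auto
qed

lemma map_num: "map_poly f (num_poly d gen_num) = smult (em (inverse c))
    (smult (em v - em t) (pcompose (den_poly d (\<lambda>j. em (b j))) [:em t, 1:])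
      + pcompose (lin_prod d (\<lambda>i. em (y i))) [:em t, 1:])"
proof -
  have "map_poly f (num_poly d gen_num) = map_poly em numP"
    by (rule poly_eqI)
       (auto simp: coeff_map_poly coeff_num_poly unital_hom.zero[OF f] unital_hom.one[OF f] f_num
         coeff_numP_top coeff_numP_gt)
  then show ?thesis
    by (simp add: numP_def em.map_poly_smult em.map_poly_add em.map_poly_pcompose
        map_poly_den_poly[OF unital_hom_em] map_poly_lin_prod[OF unital_hom_em])
qed

lemma map_den: "map_poly f (den_poly d (gen_den ph d)) =
    smult (em (inverse c)) (pcompose (den_poly d (\<lambda>j. em (b j))) [:em t, 1:])"
proof -
  have "map_poly f (den_poly d (gen_den ph d)) = map_poly em denP"
    by (rule poly_eqI)
       (auto simp: coeff_map_poly coeff_den_poly unital_hom.zero[OF f] f_den coeff_denP_gt)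
  then show ?thesis
    by (simp add: denP_def em.map_poly_smult em.map_poly_pcompose map_poly_den_poly[OF unital_hom_em])
qed

lemma f_num_eval: "f (num_eval d gen_num x) = em (inverse c) *
    ((em v - em t) * den_eval d (\<lambda>j. em (b j)) (f x + em t) + (\<Prod>i<d. f x + em t - em (y i)))"
  using unital_hom.poly_map_poly[OF f, of "num_poly d gen_num" x]
  by (simp add: map_num poly_pcompose poly_num_poly poly_den_poly poly_lin_prod add.commute)

lemma f_den_eval: "f (den_eval d (gen_den ph d) x) =
    em (inverse c) * den_eval d (\<lambda>j. em (b j)) (f x + em t)"
  using unital_hom.poly_map_poly[OF f, of "den_poly d (gen_den ph d)" x]
  by (simp add: map_den poly_pcompose poly_den_poly add.commute)

lemma em_c_inverse: "em c * em (inverse c) = 1"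
  using c_inverse em.mult[of c "inverse c"] by simp

lemma em_inverse_c_nonzero: "em (inverse c) \<noteq> 0"
  using em_c_inverse by auto

lemma child_iff: "x \<in> gen_child ph d z \<longleftrightarrow> f x + em t \<in> sp_child (f z + em t)"
proof -
  have "x \<in> gen_child ph d z \<longleftrightarrow> f (num_eval d gen_num x) = f (z * den_eval d (gen_den ph d) x)"
    by (simp add: gen_child_def preimages_def inj_eq[OF unital_hom_inj[OF f]])
  also have "\<dots> \<longleftrightarrow> em (inverse c) *
    ((em v - em t) * den_eval d (\<lambda>j. em (b j)) (f x + em t) + (\<Prod>i<d. f x + em t - em (y i)))
    = em (inverse c) * (f z * den_eval d (\<lambda>j. em (b j)) (f x + em t))"
    unfolding f_num_eval unital_hom.mult[OF f] f_den_eval by (simp add: algebra_simps)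
  also have "\<dots> \<longleftrightarrow> (em v - em t) * den_eval d (\<lambda>j. em (b j)) (f x + em t) + (\<Prod>i<d. f x + em t - em (y i))
    = f z * den_eval d (\<lambda>j. em (b j)) (f x + em t)"
    using em_inverse_c_nonzero by simp
  also have "\<dots> \<longleftrightarrow> f x + em t \<in> sp_child (f z + em t)"
    by (simp add: sp_child_def algebra_simps)
  finally show ?thesis .
qed

text \<open>The children are roots of a polynomial whose coefficients lie in the image of an
  algebraically closed field, hence they lie in that image. Coprimality keeps this polynomial from
  vanishing identically.\<close>

lemma child_lift:
  assumes cop: "gen_coprime TYPE('a) ph d" and Z: "Z \<in> sp_child (f z + em t)"
  obtains x where "x \<in> gen_child ph d z" "Z = f x + em t"
proof -
  define P where "P = num_poly d gen_num - smult z (den_poly d (gen_den ph d))"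
  have Px: "poly P x = num_eval d gen_num x - z * den_eval d (gen_den ph d) x" for x
    by (simp add: P_def poly_num_poly poly_den_poly)
  have "P \<noteq> 0"
  proof
    assume P: "P = 0"
    have lc: "coeff (num_poly d gen_num) d = (1 :: 'a ratfun alg_closure)"
      by (simp add: coeff_num_poly)
    then have "d \<le> degree (num_poly d gen_num :: 'a ratfun alg_closure poly)"
      by (intro le_degree) simp
    then have "degree (num_poly d gen_num :: 'a ratfun alg_closure poly) > 0"
      using d_gt_1 by linarith
    then obtain x :: "'a ratfun alg_closure" where x: "num_eval d gen_num x = 0"
      using alg_closed_imp_poly_has_root by (metis poly_num_poly)
    have "z \<noteq> 0"
    proof
      assume "z = 0"
      then have "num_poly d gen_num = (0 :: 'a ratfun alg_closure poly)"
        using P by (simp add: P_def)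
      then show False
        using lc by simp
    qed
    then have "den_eval d (gen_den ph d) x = 0"
      using Px[of x] P x by simp
    with x cop show False
      unfolding gen_coprime_def by blast
  qed
  moreover have "poly (map_poly f P) (Z - em t) = 0"
  proof -
    have "map_poly f P = map_poly f (num_poly d gen_num) - smult (f z) (map_poly f (den_poly d (gen_den ph d)))"
      by (rule poly_eqI) (simp add: P_def coeff_map_poly unital_hom.zero[OF f] unital_hom.diff[OF f] unital_hom.mult[OF f])
    then have "poly (map_poly f P) (Z - em t) = em (inverse c) *
       ((em v - em t) * den_eval d (\<lambda>j. em (b j)) Z + (\<Prod>i<d. Z - em (y i)))
       - f z * (em (inverse c) * den_eval d (\<lambda>j. em (b j)) Z)"
      by (simp add: map_num map_den poly_pcompose poly_den_poly poly_lin_prod)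
    also have "(\<Prod>i<d. Z - em (y i)) = (f z + em t - em v) * den_eval d (\<lambda>j. em (b j)) Z"
      using Z by (simp add: sp_child_def)
    finally show ?thesis
      by (simp add: algebra_simps)
  qed
  ultimately obtain r where "poly P r = 0" "f r = Z - em t"
    using poly_root_lift[OF f] by blast
  then show thesis
    using that[of r] by (simp add: Px gen_child_def preimages_def)
qed

lemma lev_transfer: "x \<in> lev j \<Longrightarrow> f x + em t \<in> slev j"
proof (induction j arbitrary: x)
  case 0
  then show ?case by (simp add: unital_hom.zero[OF f])
next
  case (Suc j)
  then obtain z where "z \<in> lev j" "x \<in> gen_child ph d z"
    by auto
  then show ?case
    using Suc.IH[of z] child_iff[of x z] by auto
qed

lemma slev_lift:
  assumes cop: "gen_coprime TYPE('a) ph d"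
  shows "Z \<in> slev j \<Longrightarrow> \<exists>x\<in>lev j. Z = f x + em t"
proof (induction j arbitrary: Z)
  case 0
  then show ?case by (simp add: unital_hom.zero[OF f])
next
  case (Suc j)
  then obtain Y where Y: "Y \<in> slev j" "Z \<in> sp_child Y"
    by auto
  then obtain z where z: "z \<in> lev j" "Y = f z + em t"
    using Suc.IH by blast
  obtain x where "x \<in> gen_child ph d z" "Z = f x + em t"
    using child_lift[OF cop] Y(2) z(2) by metis
  then show ?case
    using z(1) by auto
qed

text \<open>The orbit of \<open>v\<close> read backwards: \<open>t\<close> is the root, each point
  is a child of its successor, and \<open>v\<close> ends up on level \<open>N\<close>.\<close>

lemma orb_slev: "k \<le> N \<Longrightarrow> em (orb (N - k)) \<in> slev k"
proof (induction k)
  case 0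
  show ?case by (simp add: t_def)
next
  case (Suc k)
  define j where "j = N - Suc k"
  have j: "N - k = Suc j" "j < N"
    using Suc.prems by (auto simp: j_def)
  have "(\<Prod>i<d. orb j - y i) = (orb (Suc j) - v) * den_eval d b (orb j)"
    using orb_den_inverse[OF orbit j(2)] by (simp add: mult.assoc mult.commute[of "inverse _"])
  then have "em (\<Prod>i<d. orb j - y i) = em ((orb (Suc j) - v) * den_eval d b (orb j))"
    by (rule arg_cong)
  then have "em (orb j) \<in> sp_child (em (orb (Suc j)))"
    unfolding sp_child_def em.prod em.diff em.mult unital_hom_den_eval[OF unital_hom_em]
    by (rule CollectI)
  then show ?case
    using Suc j by (auto simp: j_def[symmetric])
qed

lemma v_slev: "em v \<in> slev N"
  using orb_slev[of N] by simp

lemma sp_child_v: "sp_child (em v) = {em (y i) | i. i < d}"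
  by (auto simp: sp_child_def)

text \<open>The residues may coincide; the coefficient of \<open>fps_X\<close> tells the roots
  apart.\<close>

lemma y_inj: "y i = y j \<Longrightarrow> i = j"
proof -
  assume "y i = y j"
  then have "fps_nth (y i) 1 = fps_nth (y j) 1"
    by simp
  then have "(indet i :: 'a alg_closure ratfun) = indet j"
    by (simp add: y_def series_var_def series_const_def)
  then have "(mvar i :: 'a alg_closure mpoly) = mvar j"
    by (simp add: indet_conv_mvar inj_eq[OF inj_frac_of])
  then have "Poly_Mapping.lookup (mvar i :: 'a alg_closure mpoly) (Poly_Mapping.single j 1) = 1"
    by (simp add: mvar_def)
  then have "Poly_Mapping.single i 1 = (Poly_Mapping.single j 1 :: nat \<Rightarrow>\<^sub>0 nat)"
    by (simp add: mvar_def lookup_single when_def split: if_splits)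
  then have "Poly_Mapping.lookup (Poly_Mapping.single i 1 :: nat \<Rightarrow>\<^sub>0 nat) j = 1"
    by simp
  then show "i = j"
    by (simp add: lookup_single when_def split: if_splits)
qed

text \<open>The roots \<open>y i\<close> enter the special coefficients only through the products of
  the \<open>w - y i\<close>, so \<open>T\<close> fixes these coefficients. Extend \<open>T\<close>
  to \<open>\<Theta>\<close> on the algebraic closure \<open>big\<close>; then \<open>f\<close> and
  the composite of \<open>\<Theta>\<close> with \<open>f\<close> agree on the base and differ by
  some \<open>\<sigma>\<close>.\<close>

lemma perm_aut:
  assumes "bij \<pi>" and fixes_ge: "\<And>i. i \<ge> d \<Longrightarrow> \<pi> i = i" and a_inv: "\<And>i. i < d \<Longrightarrow> a (\<pi> i) = a i"
  obtains T \<sigma> where "unital_hom T" "\<sigma> \<in> ac_auts" "\<And>i. i < d \<Longrightarrow> T (y i) = y (\<pi> i)"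
    "\<And>x w. f x + em t = em w \<Longrightarrow> f (\<sigma> x) + em t = em (T w)"
    "\<And>w r. res w = cst r \<Longrightarrow> res (T w) = cst r"
    "T v = v" "\<And>j. T (b j) = b j" "T t = t"
    "(\<lambda>w. \<Prod>i<d. w - T (y i)) = (\<lambda>w. \<Prod>i<d. w - y i)"
proof -
  obtain T :: "'a series \<Rightarrow> 'a series" where T: "unital_hom T" "inj T"
    "\<And>g. T (series_const g) = series_const g"
    "\<And>a i. a (\<pi> i) = a i \<Longrightarrow> T (series_var a i) = series_var a (\<pi> i)"
    "\<And>w r. res w = cst r \<Longrightarrow> res (T w) = cst r"
    using series_perm_hom[OF assms(1), where 'k = 'a] by blast
  interpret T: unital_hom T by (rule T(1))
  have Ty: "T (y i) = y (\<pi> i)" if "i < d" for i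
    using T(4)[of a i] a_inv[OF that] by (simp add: y_def)
  have Tvar: "T (series_var a i) = series_var a i" if "i \<ge> d" for i
    using T(4)[of a i] fixes_ge[OF that] by simp
  have Tv: "T v = v"
    unfolding v_def by (rule Tvar) simp
  have Tb: "T (b j) = b j" for j
    unfolding b_def using Tvar[of "d + 1 + j"] by simp
  have \<pi>_bij: "bij_betw \<pi> {..<d} {..<d}"
  proof -
    have "\<pi> i < d" if "i < d" for i
    proof (rule ccontr)
      assume "\<not> \<pi> i < d"
      then have "\<pi> (\<pi> i) = \<pi> i"
        using fixes_ge[of "\<pi> i"] by simp
      then have "\<pi> i = i"
        using assms(1) by (simp add: bij_def inj_eq)
      then show False
        using that \<open>\<not> \<pi> i < d\<close> by simp
    qed
    then have "\<pi> ` {..<d} \<subseteq> {..<d}"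
      by auto
    moreover have "inj_on \<pi> {..<d}"
      using assms(1) by (auto simp: bij_def intro: inj_on_subset)
    ultimately show ?thesis
      using endo_inj_surj[of "{..<d}" \<pi>] by (simp add: bij_betw_def)
  qed
  have prodT: "(\<Prod>i<d. w - T (y i)) = (\<Prod>i<d. w - y i)" for w
  proof -
    have "(\<Prod>i<d. w - T (y i)) = (\<Prod>i<d. w - y (\<pi> i))"
      by (rule prod.cong) (simp_all add: Ty)
    also have "\<dots> = (\<Prod>i<d. w - y i)"
      by (rule prod.reindex_bij_betw[OF \<pi>_bij])
    finally show ?thesis .
  qed
  \<comment> \<open>The series do not form a field, so compatibility with \<open>inverse\<close> is
    argued for units only.\<close>
  have Tinv: "T (inverse w) = inverse (T w)" if "w * inverse w = 1" for w
  proof -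
    have 1: "T w * T (inverse w) = 1"
      unfolding T.mult[symmetric] that by simp
    then have "fps_nth (T w) 0 \<noteq> 0"
      by (metis fps_mult_nth_0 fps_one_nth mult_zero_left zero_neq_one)
    then have 2: "inverse (T w) * T w = 1"
      by (rule inverse_mult_eq_1)
    have "T (inverse w) = inverse (T w) * T w * T (inverse w)"
      by (simp only: 2 mult_1)
    also have "\<dots> = inverse (T w) * (T w * T (inverse w))"
      by (rule mult.assoc)
    finally show ?thesis
      by (simp only: 1 mult_1_right)
  qed
  have Torb: "T (orb k) = orb k" if "k \<le> N" for k
    using that
  proof (induction k)
    case (Suc k)
    then have IH: "T (orb k) = orb k" and k: "k < N"
      by auto
    have den: "T (den_eval d b (orb k)) = den_eval d b (orb k)"
      by (simp add: unital_hom_den_eval[OF T(1)] Tb IH)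
    show ?case
      using Tinv[OF orb_den_inverse[OF orbit k]] by (simp add: Tv IH prodT den)
  qed (simp add: Tv)
  have Tt: "T t = t"
    unfolding t_def by (rule Torb) simp
  have Tc: "T c = c"
    by (simp add: c_def Tv Tt Tb)
  have Tci: "T (inverse c) = inverse c"
    using Tinv[OF c_inverse] Tc by simp
  have mden: "map_poly T (den_poly d b) = den_poly d b"
    by (simp add: map_poly_den_poly[OF T(1)] Tb)
  have mlin: "map_poly T (lin_prod d y) = lin_prod d y"
  proof -
    have "map_poly T (lin_prod d y) = (\<Prod>i<d. [:- y (\<pi> i), 1:])"
      unfolding lin_prod_def T.map_poly_prod by (rule prod.cong) (simp_all add: Ty)
    also have "\<dots> = lin_prod d y"
      unfolding lin_prod_def by (rule prod.reindex_bij_betw[OF \<pi>_bij])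
    finally show ?thesis .
  qed
  have Tnum: "map_poly T numP = numP" and Tden: "map_poly T denP = denP"
    unfolding numP_def denP_def
    by (simp_all add: T.map_poly_smult T.map_poly_add T.map_poly_pcompose mden mlin Tci Tv Tt)
  have Tcoeff: "T (coeff numP i) = coeff numP i" "T (coeff denP i) = coeff denP i" for i
    using arg_cong[OF Tnum, of "\<lambda>p. coeff p i"] arg_cong[OF Tden, of "\<lambda>p. coeff p i"]
    by (simp_all add: coeff_map_poly)
  have T\<xi>: "T (\<xi> i) = \<xi> i" for i
  proof (cases "i < d")
    case True
    then show ?thesis
      by (simp only: \<xi>_def if_True Tcoeff)
  next
    case False
    then have "T (series_var a (i + 1)) = series_var a (i + 1)"
      by (intro Tvar) simp
    then show ?thesis
      using False by (simp only: \<xi>_def if_False if_distrib[of T] Tcoeff)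
  qed
  have T\<iota>: "T (\<iota> p) = \<iota> p" for p
    by (rule mpoly_hom_eqI[OF unital_hom_comp[OF T(1) unital_hom_\<iota>] unital_hom_\<iota>]) (simp_all add: T\<xi> T(3))
  have h1: "unital_hom (\<lambda>w. em (T w))"
    by (rule unital_hom_comp[OF unital_hom_em T(1)])
  have h2: "inj (\<lambda>w. em (T w))"
    by (rule injI) (simp add: inj_eq[OF T(2)])
  obtain \<Theta> :: "'a big \<Rightarrow> 'a big" where \<Theta>: "unital_hom \<Theta>"
    "\<And>w. \<Theta> (to_ac (frac_of w)) = em (T w)"
    using idom_hom_ext[OF h1 h2] by blast
  have \<Theta>em: "\<Theta> (em w) = em (T w)" for w
    by (simp add: em_def[of w] \<Theta>(2))
  have "\<Theta> (f (to_ac k)) = f (to_ac k)" for k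
  proof -
    obtain p q where k: "k = Fract p q" "q \<noteq> 0"
      by (cases k)
    have "k = frac_of p / frac_of q"
      by (simp add: k frac_of_def)
    then show ?thesis
      by (simp add: unital_hom_divide[OF f] unital_hom_divide[OF \<Theta>(1)] f_frac \<Theta>em T\<iota>)
  qed
  then obtain \<sigma> where \<sigma>: "\<sigma> \<in> ac_auts" "\<And>x. \<Theta> (f x) = f (\<sigma> x)"
    using two_extensions[OF f unital_hom_comp[OF \<Theta>(1) f]] by metis
  have key: "f (\<sigma> x) + em t = em (T w)" if "f x + em t = em w" for x w
  proof -
    have "\<Theta> (f x + em t) = \<Theta> (em w)"
      using that by simp
    then show ?thesis
      by (simp add: unital_hom.add[OF \<Theta>(1)] \<sigma>(2) \<Theta>em Tt)
  qed
  show thesis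
    by (rule that[OF T(1) \<sigma>(1) Ty key T(5) Tv Tb Tt]) (simp_all add: prodT)
qed

text \<open>All residues being equal, every permutation of the \<open>y i\<close> is admissible in
  \<open>perm_aut\<close>. Only the fibre over \<open>v\<close> matters here, so the reduced map may
  be ramified elsewhere.\<close>

lemma double_transitivity:
  assumes cop: "gen_coprime TYPE('a) ph d" and eq: "\<And>i. i < d \<Longrightarrow> a i = a 0"
  shows "\<exists>x\<in>lev N. \<forall>p\<in>gen_child ph d x. \<forall>q\<in>gen_child ph d x. \<forall>p'\<in>gen_child ph d x. \<forall>q'\<in>gen_child ph d x.
          p \<noteq> q \<longrightarrow> p' \<noteq> q' \<longrightarrow> (\<exists>\<sigma>\<in>ac_auts. \<sigma> p = p' \<and> \<sigma> q = q')"
proof -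
  obtain x where x: "x \<in> lev N" "em v = f x + em t"
    using slev_lift[OF cop v_slev] by blast
  have idx: "\<exists>i<d. f p + em t = em (y i)" if "p \<in> gen_child ph d x" for p
    using child_iff[of p x] that sp_child_v by (auto simp: x(2)[symmetric])
  have finj: "p = q" if "f p + em t = f q + em t" for p q
    using that inj_eq[OF unital_hom_inj[OF f]] by simp
  show ?thesis
  proof (intro bexI[OF _ x(1)] ballI impI)
    fix p q p' q' assume pq: "p \<in> gen_child ph d x" "q \<in> gen_child ph d x"
      "p' \<in> gen_child ph d x" "q' \<in> gen_child ph d x" "p \<noteq> q" "p' \<noteq> q'"
    obtain i where i: "i < d" "f p + em t = em (y i)" using idx[OF pq(1)] by blast
    obtain j where j: "j < d" "f q + em t = em (y j)" using idx[OF pq(2)] by blast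
    obtain i' where i': "i' < d" "f p' + em t = em (y i')" using idx[OF pq(3)] by blast
    obtain j' where j': "j' < d" "f q' + em t = em (y j')" using idx[OF pq(4)] by blast
    have ij: "i \<noteq> j" "i' \<noteq> j'"
      using i j i' j' pq(5,6) finj by metis+
    \<comment> \<open>\<open>\<pi>1\<close> brings \<open>i\<close> to \<open>i'\<close>; the second
      transposition then corrects the image of \<open>j\<close> without touching
      \<open>i'\<close>.\<close>
    define \<pi>1 where "\<pi>1 = Transposition.transpose i i'"
    define \<pi> where "\<pi> = Transposition.transpose (\<pi>1 j) j' \<circ> \<pi>1"
    have \<pi>i: "\<pi> i = i'" and \<pi>j: "\<pi> j = j'"
      using ij by (auto simp: \<pi>_def \<pi>1_def Transposition.transpose_def)
    have \<pi>1: "bij \<pi>"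
      unfolding \<pi>_def \<pi>1_def by (intro bij_comp) simp_all
    have \<pi>2: "\<pi> l = l" if "l \<ge> d" for l
      using that i j i' j' by (auto simp: \<pi>_def \<pi>1_def Transposition.transpose_def)
    have \<pi>3: "a (\<pi> l) = a l" if "l < d" for l
    proof -
      have "\<pi> l < d"
        using that i j i' j' by (auto simp: \<pi>_def \<pi>1_def Transposition.transpose_def)
      then show ?thesis
        using eq that by metis
    qed
    show "\<exists>\<sigma>\<in>ac_auts. \<sigma> p = p' \<and> \<sigma> q = q'"
    proof (rule perm_aut[OF \<pi>1 \<pi>2 \<pi>3])
      fix T \<sigma>
      assume T: "\<sigma> \<in> ac_auts" "\<And>i. i < d \<Longrightarrow> T (y i) = y (\<pi> i)"
        "\<And>x w. f x + em t = em w \<Longrightarrow> f (\<sigma> x) + em t = em (T w)"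
      have "\<sigma> p = p'"
        by (rule finj) (simp add: T(3)[OF i(2)] T(2)[OF i(1)] i'(2) \<pi>i)
      moreover have "\<sigma> q = q'"
        by (rule finj) (simp add: T(3)[OF j(2)] T(2)[OF j(1)] j'(2) \<pi>j)
      ultimately show ?thesis
        using T(1) by (intro bexI[of _ \<sigma>]) simp_all
    qed
  qed
qed

end

section \<open>Good specialisations\<close>

lemma card_roots_separable:
  fixes p :: "'a::alg_closed_field poly"
  assumes "p \<noteq> 0" "\<And>x. poly p x = 0 \<Longrightarrow> poly (pderiv p) x \<noteq> 0"
  shows "card {x. poly p x = 0} = degree p"
proof -
  obtain A where A: "size A = degree p" "p = smult (lead_coeff p) (\<Prod>x\<in>#A. [:- x, 1:])"
    using alg_closed_imp_factorization[OF assms(1)] by blast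
  have lc: "lead_coeff p \<noteq> 0"
    using assms(1) by simp
  have "poly (\<Prod>x\<in>#B. [:- x, 1:]) z = 0 \<longleftrightarrow> z \<in># B" for B and z :: 'a
    by (induction B) (auto simp del: mult_pCons_left)
  then have roots: "poly p z = 0 \<longleftrightarrow> z \<in># A" for z
    using lc by (subst A(2)) simp
  have "count A x \<le> 1" for x
  proof (rule ccontr)
    assume "\<not> count A x \<le> 1"
    then have x: "x \<in># A" "x \<in># A - {#x#}"
      by (simp_all add: in_diff_count flip: count_greater_zero_iff)
    define C where "C = A - {#x#} - {#x#}"
    have "A = add_mset x (add_mset x C)"
      unfolding C_def by (simp only: insert_DiffM[OF x(2)] insert_DiffM[OF x(1)])
    then have "p = [:- x, 1:] * ([:- x, 1:] * smult (lead_coeff p) (\<Prod>z\<in>#C. [:- z, 1:]))"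
      by (subst A(2)) (simp add: mult.left_commute del: mult_pCons_left)
    then obtain q where q: "p = [:- x, 1:] * ([:- x, 1:] * q)"
      by blast
    have "poly p x = 0" "poly (pderiv p) x = 0"
      by (simp_all add: q pderiv_mult del: mult_pCons_left)
    then show False
      using assms(2) by blast
  qed
  then have "A = mset_set (set_mset A)"
    by (intro multiset_eqI) (metis count_mset_set(1,3) finite_set_mset le_less_Suc_eq
        not_in_iff One_nat_def count_greater_zero_iff le_antisym Suc_leI)
  then have "size A = card (set_mset A)"
    by (metis size_mset_set)
  moreover have "{x. poly p x = 0} = set_mset A"
    using roots by auto
  ultimately show ?thesis
    using A(1) by simp
qed

text \<open>With \<open>H\<close> the product of the \<open>x - y i\<close> and \<open>B\<close> the
  denominator, its zeros are the fibre of \<open>v + H / B\<close> over \<open>v - s\<close>,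
  provided \<open>H\<close> and \<open>B\<close> have no common zero.\<close>

definition fibre_poly :: "nat \<Rightarrow> (nat \<Rightarrow> 'a::comm_ring_1) \<Rightarrow> (nat \<Rightarrow> 'a) \<Rightarrow> 'a \<Rightarrow> 'a poly" where
  "fibre_poly d y b s = lin_prod d y + smult s (den_poly d b)"

lemma poly_fibre_poly: "poly (fibre_poly d y b s) x = (\<Prod>i<d. x - y i) + s * den_eval d b x"
  by (simp add: fibre_poly_def poly_lin_prod poly_den_poly)

lemma map_poly_fibre_poly:
  assumes "unital_hom h"
  shows "map_poly h (fibre_poly d y b s) = fibre_poly d (\<lambda>i. h (y i)) (\<lambda>j. h (b j)) (h s)"
proof -
  interpret unital_hom h by fact
  show ?thesis
    by (simp add: fibre_poly_def map_poly_add map_poly_smult map_poly_den_poly[OF assms] map_poly_lin_prod[OF assms])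
qed

lemma coeff_fibre_poly_top:
  fixes y :: "nat \<Rightarrow> 'a::idom"
  shows "coeff (fibre_poly d y b s) d = 1 + s * b d"
  by (simp add: fibre_poly_def coeff_lin_prod_top coeff_den_poly)

lemma degree_fibre_poly_le:
  fixes y :: "nat \<Rightarrow> 'a::idom"
  shows "degree (fibre_poly d y b s) \<le> d"
  unfolding fibre_poly_def
  by (intro degree_add_le) (simp_all add: degree_lin_prod degree_den_poly)

context special_family
begin

text \<open>The reduced map \<open>a\<^sub>d + H\<^sub>0/B\<^sub>0\<close> is unramified outside the fibre over \<open>a\<^sub>d\<close>, which
  the orbit of \<open>a\<^sub>d\<close> does not meet again.\<close>

definition good :: bool where
  "good \<longleftrightarrow> orbit_defined \<and> (\<forall>k<N. orb0 k \<noteq> orb0 N) \<and> a 0 = a 1 \<and>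
     (\<forall>r. \<not> ((\<Prod>i<d. r - a i) = 0 \<and> den_eval d b0 r = 0)) \<and>
     (\<forall>r x. r \<noteq> a d \<longrightarrow> poly (fibre_poly d a b0 (a d - r)) x = 0 \<longrightarrow>
        poly (pderiv (fibre_poly d a b0 (a d - r))) x \<noteq> 0)"

end

section \<open>Vertices as power series and their residues\<close>

locale good_embedding = special_embedding +
  assumes good: good
begin

lemma no_common_root: "(\<Prod>i<d. r - a i) = 0 \<Longrightarrow> den_eval d b0 r \<noteq> 0"
  using good by (simp only: good_def) blast

text \<open>A common zero corresponds to some \<open>y i\<close>, and reducing it gives a common
  zero of the residual numerator and denominator, which \<open>good\<close> forbids.\<close>

lemma gen_coprime_holds: "gen_coprime TYPE('a) ph d"
  unfolding gen_coprime_def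
proof (intro allI notI)
  fix x :: "'a ratfun alg_closure"
  assume x: "num_eval d gen_num x = 0 \<and> den_eval d (gen_den ph d) x = 0"
  have den: "den_eval d (\<lambda>j. em (b j)) (f x + em t) = 0"
    using f_den_eval[of x] x em_inverse_c_nonzero by (simp add: unital_hom.zero[OF f])
  have "(\<Prod>i<d. f x + em t - em (y i)) = 0"
    using f_num_eval[of x] x em_inverse_c_nonzero by (simp add: unital_hom.zero[OF f] den)
  then obtain i where i: "i < d" "f x + em t = em (y i)"
    by auto
  then have "em (den_eval d b (y i)) = 0"
    using den by (simp add: unital_hom_den_eval[OF unital_hom_em])
  then have "den_eval d b (y i) = 0"
    using em_eq_iff[of "den_eval d b (y i)" 0] by simp
  then have "den_eval d b0 (a i) = 0"
    using res_den_eval[of "y i" "a i"] by (simp add: y_def res_var)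
  moreover have "(\<Prod>j<d. a i - a j) = 0"
    using i(1) by auto
  ultimately show False
    using no_common_root by blast
qed

lemma em_sp_child_iff: "em x \<in> sp_child (em w) \<longleftrightarrow> (\<Prod>i<d. x - y i) = (w - v) * den_eval d b x"
proof -
  have "em x \<in> sp_child (em w) \<longleftrightarrow> em (\<Prod>i<d. x - y i) = em ((w - v) * den_eval d b x)"
    by (simp add: sp_child_def unital_hom_den_eval[OF unital_hom_em])
  then show ?thesis
    by (simp only: em_eq_iff)
qed

lemma residue_parent:
  assumes "em x \<in> sp_child (em w)" "res x = cst \<rho>" "res w = cst r"
  shows "(\<Prod>i<d. \<rho> - a i) = (r - a d) * den_eval d b0 \<rho>" "den_eval d b0 \<rho> \<noteq> 0"
proof -
  have "res (\<Prod>i<d. x - y i) = res ((w - v) * den_eval d b x)"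
    using assms(1) by (simp only: em_sp_child_iff)
  then have "cst (\<Prod>i<d. \<rho> - a i) = cst ((r - a d) * den_eval d b0 \<rho>)"
    unfolding res_prod[OF assms(2)] fps_mult_nth_0 res_den_eval[OF assms(2)] fps_sub_nth assms(3)
      unital_hom.mult[OF unital_hom_cst] unital_hom.diff[OF unital_hom_cst]
    by (simp add: v_def res_var)
  then show *: "(\<Prod>i<d. \<rho> - a i) = (r - a d) * den_eval d b0 \<rho>"
    by simp
  then show "den_eval d b0 \<rho> \<noteq> 0"
    using no_common_root[of \<rho>] by auto
qed

text \<open>Over \<open>r \<noteq> a d\<close> the residual fibre has \<open>d\<close> simple
  points. Their Hensel lifts are distinct, and a nonzero polynomial of degree at most
  \<open>d\<close> has no further roots, so every child is a power series.\<close>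

lemma hensel_children:
  assumes w: "res w = cst r" and r: "r \<noteq> a d"
  obtains Z g where "card Z = d" "\<And>\<rho>. \<rho> \<in> Z \<Longrightarrow> res (g \<rho>) = cst \<rho>" "sp_child (em w) = (\<lambda>\<rho>. em (g \<rho>)) ` Z"
    "inj_on (\<lambda>\<rho>. em (g \<rho>)) Z"
proof -
  define Q where "Q = fibre_poly d a b0 (a d - r)"
  define P where "P = fibre_poly d y b (v - w)"
  define Z where "Z = {x. poly Q x = 0}"
  have Qd: "coeff Q d = 1"
    by (simp add: Q_def coeff_fibre_poly_top b0_top)
  have degQ: "degree Q = d"
    unfolding Q_def using degree_fibre_poly_le le_degree[of Q d] Qd
    by (metis Q_def le_antisym zero_neq_one)
  have sep: "poly Q x = 0 \<Longrightarrow> poly (pderiv Q) x \<noteq> 0" for x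
    using good r unfolding good_def Q_def by blast
  have "card Z = degree Q"
    unfolding Z_def using Qd by (intro card_roots_separable sep) auto
  then have cZ: "card Z = d"
    by (simp add: degQ)
  have red: "map_poly (\<lambda>w. res w) P = map_poly cst Q"
  proof -
    have "map_poly (\<lambda>w. res w) P = fibre_poly d (\<lambda>i. res (y i)) (\<lambda>j. res (b j)) (res (v - w))"
      unfolding P_def by (rule map_poly_fibre_poly[OF unital_hom_fps_nth_0])
    also have "\<dots> = fibre_poly d (\<lambda>i. cst (a i)) (\<lambda>j. cst (b0 j)) (cst (a d - r))"
      by (simp add: y_def res_var res_b v_def w unital_hom.diff[OF unital_hom_cst])
    also have "\<dots> = map_poly cst Q"
      unfolding Q_def by (rule map_poly_fibre_poly[OF unital_hom_cst, symmetric])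
    finally show ?thesis .
  qed
  have ex: "\<exists>x. poly P x = 0 \<and> res x = cst \<rho>" if "\<rho> \<in> Z" for \<rho>
  proof (rule fps_hensel)
    show "poly (map_poly (\<lambda>w. res w) P) (cst \<rho>) = 0"
      using that by (simp add: red unital_hom.poly_map_poly[OF unital_hom_cst] Z_def)
    show "poly (pderiv (map_poly (\<lambda>w. res w) P)) (cst \<rho>) \<noteq> 0"
      using that sep[of \<rho>]
      by (simp add: red map_poly_pderiv[OF unital_hom_cst, symmetric]
          unital_hom.poly_map_poly[OF unital_hom_cst] Z_def)
  qed
  define g where "g \<rho> = (SOME x. poly P x = 0 \<and> res x = cst \<rho>)" for \<rho>
  have g: "poly P (g \<rho>) = 0" "res (g \<rho>) = cst \<rho>" if "\<rho> \<in> Z" for \<rho>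
    using someI_ex[OF ex[OF that]] unfolding g_def by simp_all
  define mp where "mp = map_poly em P"
  have "coeff P d \<noteq> 0"
  proof
    assume "coeff P d = 0"
    then have "res (1 + (v - w) * b d) = 0"
      by (simp add: P_def coeff_fibre_poly_top)
    then show False
      by (simp add: res_b b0_top unital_hom.zero[OF unital_hom_cst])
  qed
  then have "coeff mp d \<noteq> 0"
    using em_eq_iff[of "coeff P d" 0] by (simp add: mp_def coeff_map_poly)
  then have mp0: "mp \<noteq> 0"
    by auto
  have mpeq: "mp = fibre_poly d (\<lambda>i. em (y i)) (\<lambda>j. em (b j)) (em (v - w))"
    unfolding mp_def P_def by (rule map_poly_fibre_poly[OF unital_hom_em])
  have degmp: "degree mp \<le> d"
    unfolding mpeq by (rule degree_fibre_poly_le)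
  have child: "sp_child (em w) = {x. poly mp x = 0}"
    unfolding sp_child_def mpeq poly_fibre_poly by (auto simp: algebra_simps)
  have sub: "(\<lambda>\<rho>. em (g \<rho>)) ` Z \<subseteq> {x. poly mp x = 0}"
    using g(1) by (auto simp: mp_def)
  have inj: "inj_on (\<lambda>\<rho>. em (g \<rho>)) Z"
  proof (rule inj_onI)
    fix \<rho> \<rho>' assume "\<rho> \<in> Z" "\<rho>' \<in> Z" "em (g \<rho>) = em (g \<rho>')"
    then have "cst \<rho> = cst \<rho>'"
      using g(2) by (metis em_eq_iff)
    then show "\<rho> = \<rho>'"
      by simp
  qed
  have fin: "finite {x. poly mp x = 0}"
    using mp0 by (rule poly_roots_finite)
  have "card {x. poly mp x = 0} \<le> degree mp"
    using mp0 by (rule card_poly_roots_bound)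
  then have "card {x. poly mp x = 0} \<le> card ((\<lambda>\<rho>. em (g \<rho>)) ` Z)"
    using degmp by (simp add: card_image[OF inj] cZ)
  then have "(\<lambda>\<rho>. em (g \<rho>)) ` Z = {x. poly mp x = 0}"
    using card_seteq[OF fin sub] by simp
  then show thesis
    using that[of Z g] cZ g(2) child inj by simp
qed

lemma sibling_residue_unique:
  assumes "res w = cst r" "r \<noteq> a d" "em x \<in> sp_child (em w)" "em x' \<in> sp_child (em w)"
    "res x = res x'"
  shows "x = x'"
proof (rule hensel_children[OF assms(1,2)])
  fix Z g assume g: "\<And>\<rho>. \<rho> \<in> Z \<Longrightarrow> res (g \<rho>) = cst \<rho>" "sp_child (em w) = (\<lambda>\<rho>. em (g \<rho>)) ` Z"
  obtain \<rho> where \<rho>: "\<rho> \<in> Z" "x = g \<rho>"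
    using assms(3) unfolding g(2) by auto
  obtain \<rho>' where \<rho>': "\<rho>' \<in> Z" "x' = g \<rho>'"
    using assms(4) unfolding g(2) by auto
  have "cst \<rho> = cst \<rho>'"
    using assms(5) g(1)[OF \<rho>(1)] g(1)[OF \<rho>'(1)] by (simp add: \<rho>(2) \<rho>'(2))
  then show "x = x'"
    by (simp add: \<rho>(2) \<rho>'(2))
qed

lemma child_residue:
  assumes "res w = cst r" "r \<noteq> a d" "V \<in> sp_child (em w)"
  shows "\<exists>x \<rho>. V = em x \<and> res x = cst \<rho>"
proof (rule hensel_children[OF assms(1,2)])
  fix Z g assume g: "\<And>\<rho>. \<rho> \<in> Z \<Longrightarrow> res (g \<rho>) = cst \<rho>" "sp_child (em w) = (\<lambda>\<rho>. em (g \<rho>)) ` Z"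
  show ?thesis
    using assms(3) g(1) unfolding g(2) by auto
qed

lemma res_t: "res t = cst (orb0 N)"
  unfolding t_def by (rule res_orb[OF orbit]) simp

text \<open>Each step to the parent advances the residue along the residual orbit, and
  \<open>k\<close> steps end at the root \<open>t\<close>, whose residue is \<open>orb0 N\<close>.
  With \<open>i = 0\<close> and an orbit without returns this forces \<open>k = N\<close>. The first
  premise is what the induction in \<open>slev_structure\<close> supplies.\<close>

lemma forward_orbit:
  assumes "\<And>j V. j < k \<Longrightarrow> V \<in> slev j \<Longrightarrow> \<exists>x \<rho>. V = em x \<and> res x = cst \<rho>"
    and "em w \<in> slev k" "res w = cst (orb0 i)" "i + k \<le> N"
  shows "orb0 (i + k) = orb0 N"
  using assms
proof (induction k arbitrary: w i)
  case 0
  then show ?case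
    using res_t by simp
next
  case (Suc k)
  obtain Y where Y: "Y \<in> slev k" "em w \<in> sp_child Y"
    using Suc.prems(2) by auto
  obtain x \<rho> where x: "Y = em x" "res x = cst \<rho>"
    using Suc.prems(1)[of k Y] Y(1) by auto
  have "(\<Prod>l<d. orb0 i - a l) = (\<rho> - a d) * den_eval d b0 (orb0 i)" "den_eval d b0 (orb0 i) \<noteq> 0"
    using residue_parent[OF _ Suc.prems(3) x(2)] Y(2) unfolding x(1) by simp_all
  then have "orb0 (Suc i) = \<rho>"
    by simp
  then have "res x = cst (orb0 (Suc i))"
    using x(2) by (simp only:)
  have "orb0 (Suc i + k) = orb0 N"
  proof (rule Suc.IH)
    show "\<exists>x \<rho>. V = em x \<and> res x = cst \<rho>" if "j < k" "V \<in> slev j" for j V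
      using Suc.prems(1)[OF _ that(2)] that(1) by simp
    show "em x \<in> slev k" "Suc i + k \<le> N"
      using Y(1) Suc.prems(4) unfolding x(1) by simp_all
  qed fact
  then show ?case
    by simp
qed

text \<open>No vertex before level \<open>N\<close> has residue \<open>a d\<close>, by
  \<open>forward_orbit\<close>, so Hensel lifting applies to its children. Since the residue of a
  child determines that of its parent, uniqueness passes from one level to the next.\<close>

lemma slev_structure:
  assumes "k \<le> N"
  shows "(\<forall>V\<in>slev k. \<exists>x \<rho>. V = em x \<and> res x = cst \<rho>) \<and>
    (\<forall>x x' \<rho>. em x \<in> slev k \<longrightarrow> em x' \<in> slev k \<longrightarrow> res x = cst \<rho> \<longrightarrow> res x' = cst \<rho> \<longrightarrow> x = x')"
  using assms
proof (induction k rule: less_induct)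
  case (less k)
  show ?case
  proof (cases k)
    case 0
    then show ?thesis
      using res_t by simp
  next
    case (Suc j)
    have sub: "\<exists>x \<rho>. V = em x \<and> res x = cst \<rho>" if "i < k" "V \<in> slev i" for i V
      using less.IH[of i] less.prems that by simp
    have uniq: "x = x'" if "em x \<in> slev j" "em x' \<in> slev j" "res x = cst \<rho>" "res x' = cst \<rho>" for x x' \<rho>
    proof -
      have *: "\<forall>x x' \<rho>. em x \<in> slev j \<longrightarrow> em x' \<in> slev j \<longrightarrow> res x = cst \<rho> \<longrightarrow> res x' = cst \<rho> \<longrightarrow> x = x'"
        using less.IH[of j] less.prems Suc by simp
      show ?thesis
        using *[rule_format, OF that] .
    qed
    have ne: "r \<noteq> a d" if "em w \<in> slev j" "res w = cst r" for w r
    proof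
      assume "r = a d"
      have "orb0 (0 + j) = orb0 N"
      proof (rule forward_orbit)
        show "\<exists>x \<rho>. V = em x \<and> res x = cst \<rho>" if "i < j" "V \<in> slev i" for i V
          using sub[OF _ that(2)] that(1) Suc by simp
        show "em w \<in> slev j" "res w = cst (orb0 0)" "0 + j \<le> N"
          using that \<open>r = a d\<close> less.prems Suc by simp_all
      qed
      moreover have "j < N"
        using less.prems Suc by simp
      ultimately show False
        using good unfolding good_def by simp
    qed
    have parent: "\<exists>w r. em w \<in> slev j \<and> res w = cst r \<and> r \<noteq> a d \<and> V \<in> sp_child (em w)" if "V \<in> slev k" for V
    proof -
      obtain Y where Y: "Y \<in> slev j" "V \<in> sp_child Y"
        using \<open>V \<in> slev k\<close> Suc by auto
      obtain w r where w: "Y = em w" "res w = cst r"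
        using sub[of j Y] Y(1) Suc by auto
      then show ?thesis
        using Y ne[of w r] by auto
    qed
    show ?thesis
    proof (intro conjI ballI allI impI)
      fix V assume "V \<in> slev k"
      then obtain w r where "res w = cst r" "r \<noteq> a d" "V \<in> sp_child (em w)"
        using parent by blast
      then show "\<exists>x \<rho>. V = em x \<and> res x = cst \<rho>"
        by (rule child_residue)
    next
      fix x x' \<rho> assume x: "em x \<in> slev k" "em x' \<in> slev k" "res x = cst \<rho>" "res x' = cst \<rho>"
      obtain w r where w: "em w \<in> slev j" "res w = cst r" "r \<noteq> a d" "em x \<in> sp_child (em w)"
        using parent[OF x(1)] by blast
      obtain w' r' where w': "em w' \<in> slev j" "res w' = cst r'" "r' \<noteq> a d" "em x' \<in> sp_child (em w')"
        using parent[OF x(2)] by blast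
      have "(r - a d) * den_eval d b0 \<rho> = (r' - a d) * den_eval d b0 \<rho>" "den_eval d b0 \<rho> \<noteq> 0"
        using residue_parent[OF w(4) x(3) w(2)] residue_parent[OF w'(4) x(4) w'(2)] by simp_all
      then have "r = r'"
        by simp
      then have "w = w'"
        using uniq[OF w(1) w'(1) w(2)] w'(2) by simp
      then show "x = x'"
        using sibling_residue_unique[OF w(2,3,4)] w'(4) x(3,4) by simp
    qed
  qed
qed

lemma slev_residue: "k \<le> N \<Longrightarrow> Z \<in> slev k \<Longrightarrow> \<exists>w r. Z = em w \<and> res w = cst r"
  using slev_structure by blast

lemma v_unique:
  assumes "k \<le> N" "em w \<in> slev k" "res w = cst (a d)"
  shows "k = N" "w = v"
proof -
  have "orb0 (0 + k) = orb0 N"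
  proof (rule forward_orbit)
    show "\<exists>x \<rho>. V = em x \<and> res x = cst \<rho>" if "i < k" "V \<in> slev i" for i V
      using slev_residue[OF _ that(2)] that(1) assms(1) by simp
    show "em w \<in> slev k" "res w = cst (orb0 0)" "0 + k \<le> N"
      using assms by simp_all
  qed
  then show k: "k = N"
    using good assms(1) unfolding good_def by (metis add_0 le_neq_implies_less)
  have *: "\<forall>x x' \<rho>. em x \<in> slev N \<longrightarrow> em x' \<in> slev N \<longrightarrow> res x = cst \<rho> \<longrightarrow> res x' = cst \<rho> \<longrightarrow> x = x'"
    using slev_structure[of N] by simp
  show "w = v"
    by (rule *[rule_format, of w v "a d"]) (use assms k v_slev in \<open>simp_all add: v_def res_var\<close>)
qed

lemma card_sp_child:
  assumes "k \<le> N" "Y \<in> slev k"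
  shows "card (sp_child Y) = d"
proof -
  obtain w r where w: "Y = em w" "res w = cst r"
    using slev_residue[OF assms] by blast
  show ?thesis
  proof (cases "r = a d")
    case True
    then have "w = v"
      using v_unique(2)[OF assms(1)] assms(2) w by simp
    then have "sp_child Y = (\<lambda>i. em (y i)) ` {..<d}"
      using sp_child_v w(1) by auto
    moreover have "inj_on (\<lambda>i. em (y i)) {..<d}"
      by (rule inj_onI) (simp add: y_inj)
    ultimately show ?thesis
      by (simp add: card_image)
  next
    case False
    show ?thesis
    proof (rule hensel_children[OF w(2) False])
      fix Z g assume "card Z = d" "sp_child (em w) = (\<lambda>\<rho>. em (g \<rho>)) ` Z" "inj_on (\<lambda>\<rho>. em (g \<rho>)) Z"
      then show ?thesis
        using w(1) by (simp add: card_image)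
    qed
  qed
qed

lemma card_gen_child:
  assumes "k \<le> N" "z \<in> lev k"
  shows "card (gen_child ph d z) = d"
proof -
  have "(\<lambda>x. f x + em t) ` gen_child ph d z = sp_child (f z + em t)"
  proof (intro equalityI subsetI)
    fix V assume "V \<in> sp_child (f z + em t)"
    then show "V \<in> (\<lambda>x. f x + em t) ` gen_child ph d z"
      by (rule child_lift[OF gen_coprime_holds]) auto
  qed (auto simp: child_iff)
  moreover have "inj_on (\<lambda>x. f x + em t) (gen_child ph d z)"
    by (rule inj_onI) (simp add: inj_eq[OF unital_hom_inj[OF f]])
  ultimately show ?thesis
    using card_sp_child[OF assms(1) lev_transfer[OF assms(2)]] by (metis card_image)
qed

lemma lev_residue:
  assumes "k \<le> Suc N" "z \<in> lev k"
  shows "\<exists>w r. f z + em t = em w \<and> res w = cst r"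
proof (cases "k \<le> N")
  case True
  then show ?thesis
    using slev_residue lev_transfer[OF assms(2)] by blast
next
  case False
  then have k: "k = Suc N"
    using assms(1) by simp
  have "f z + em t \<in> slev (Suc N)"
    using lev_transfer[OF assms(2)] unfolding k .
  then obtain Y where Y: "Y \<in> slev N" "f z + em t \<in> sp_child Y"
    by auto
  obtain w r where w: "Y = em w" "res w = cst r"
    using slev_residue[OF order_refl Y(1)] by blast
  show ?thesis
  proof (cases "r = a d")
    case True
    then have "w = v"
      using v_unique(2)[of N w] Y(1) w by simp
    then obtain i where "f z + em t = em (y i)"
      using Y(2) sp_child_v w(1) by auto
    then show ?thesis
      using res_var[of i] unfolding y_def by blast
  next
    case False
    then show ?thesis
      using child_residue[OF w(2) False, of "f z + em t"] Y(2) w(1) by simp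
  qed
qed

text \<open>Equality would make \<open>z\<close> the value of the map at infinity. Since
  \<open>b d\<close> has residue \<open>0\<close>, the corresponding product of power series has
  residue \<open>0\<close>, not \<open>1\<close>.\<close>

lemma lev_not_pole:
  assumes "k \<le> Suc N" "z \<in> lev k"
  shows "z * gen_den ph d d \<noteq> 1"
proof
  assume "z * gen_den ph d d = 1"
  then have 1: "f z * em (coeff denP d) = 1"
    using unital_hom.mult[OF f, of z "gen_den ph d d"] f_den[of d] unital_hom.one[OF f] by simp
  obtain w r where w: "f z + em t = em w"
    using lev_residue[OF assms] by blast
  have "f z = em (w - t)"
    using w by (simp add: algebra_simps)
  then have "em ((w - t) * coeff denP d) = em 1"
    using 1 by simp
  then have "(w - t) * coeff denP d = 1"
    by (simp only: em_eq_iff)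
  moreover have "coeff denP d = inverse c * b d"
    unfolding denP_def
    by (simp add: coeff_pcompose_linear_top(1)[OF degree_den_poly] coeff_den_poly)
  ultimately have "res ((w - t) * (inverse c * b d)) = 1"
    by simp
  then show False
    by (simp add: res_b b0_top unital_hom.zero[OF unital_hom_cst])
qed

text \<open>Transpose the indeterminates of \<open>y 0\<close> and \<open>y 1\<close>. By induction
  on the level, \<open>T\<close> sends a vertex to a sibling with the same residue, hence fixes it.
  On level \<open>N + 1\<close> only the fibre over \<open>v\<close> escapes this argument, and
  there just the two chosen roots move.\<close>

lemma swap_exists:
  "\<exists>x\<in>lev N. \<exists>p\<in>gen_child ph d x. \<exists>q\<in>gen_child ph d x. p \<noteq> q \<and>
     (\<exists>\<sigma>\<in>ac_auts. \<sigma> p = q \<and> \<sigma> q = p \<and> (\<forall>z\<in>lev (Suc N) - {p, q}. \<sigma> z = z))"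
proof -
  note cop = gen_coprime_holds
  obtain x where x: "x \<in> lev N" "em v = f x + em t"
    using slev_lift[OF cop v_slev] by blast
  have "em (y 0) \<in> sp_child (f x + em t)" "em (y 1) \<in> sp_child (f x + em t)"
    using d_gt_1 unfolding x(2)[symmetric] sp_child_v by auto
  then obtain p q where p: "p \<in> gen_child ph d x" "em (y 0) = f p + em t"
    and q: "q \<in> gen_child ph d x" "em (y 1) = f q + em t"
    using child_lift[OF cop] by metis
  have finj: "p = q" if "f p + em t = f q + em t" for p q
    using that by (simp add: inj_eq[OF unital_hom_inj[OF f]])
  have pq: "p \<noteq> q"
  proof
    assume "p = q"
    then have "y 0 = y 1"
      using p(2) q(2) by (metis em_eq_iff)
    then show False
      using y_inj[of 0 1] by simp
  qed
  define \<pi> where "\<pi> = Transposition.transpose (0::nat) 1"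
  have \<pi>1: "bij \<pi>"
    by (simp add: \<pi>_def)
  have \<pi>2: "\<pi> i = i" if "i \<ge> d" for i
    using that d_gt_1 by (simp add: \<pi>_def Transposition.transpose_def)
  have a01: "a 0 = a 1"
    using good by (simp add: good_def)
  have \<pi>3: "a (\<pi> i) = a i" if "i < d" for i
    using a01 by (simp add: \<pi>_def Transposition.transpose_def)
  show ?thesis
  proof (rule perm_aut[OF \<pi>1 \<pi>2 \<pi>3])
    fix T \<sigma>
    assume T: "unital_hom T" "\<sigma> \<in> ac_auts" "\<And>i. i < d \<Longrightarrow> T (y i) = y (\<pi> i)"
      "\<And>x w. f x + em t = em w \<Longrightarrow> f (\<sigma> x) + em t = em (T w)"
      "\<And>w r. res w = cst r \<Longrightarrow> res (T w) = cst r"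
      "T v = v" "\<And>j. T (b j) = b j" "T t = t"
      "(\<lambda>w. \<Prod>i<d. w - T (y i)) = (\<lambda>w. \<Prod>i<d. w - y i)"
    interpret T: unital_hom T by (rule T(1))
    have Tchild: "em (T x) \<in> sp_child (em (T w))" if "em x \<in> sp_child (em w)" for x w
    proof -
      have "T (\<Prod>i<d. x - y i) = T ((w - v) * den_eval d b x)"
        using that by (simp only: em_sp_child_iff)
      then have "(\<Prod>i<d. T x - T (y i)) = (T w - v) * den_eval d b (T x)"
        by (simp add: unital_hom_den_eval[OF T(1)] T(6,7))
      then show ?thesis
        unfolding em_sp_child_iff using fun_cong[OF T(9), of "T x"] by simp
    qed
    have Tfix: "T z = z" if h: "em z \<in> sp_child (em w)" "res w = cst r" "r \<noteq> a d" "T w = w" for z w r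
    proof -
      obtain z' \<rho> where "em z = em z'" "res z' = cst \<rho>"
        using child_residue[OF h(2,3,1)] by blast
      then have z: "res z = cst \<rho>"
        by simp
      have "em (T z) \<in> sp_child (em w)"
        using Tchild[OF h(1)] h(4) by simp
      then show ?thesis
        by (rule sibling_residue_unique[OF h(2,3) _ h(1)]) (simp only: T(5)[OF z] z)
    qed
    have Tlev: "T w = w" if "k \<le> N" "em w \<in> slev k" for k w
      using that
    proof (induction k arbitrary: w)
      case 0
      then show ?case
        using T(8) by simp
    next
      case (Suc k)
      then obtain Y where Y: "Y \<in> slev k" "em w \<in> sp_child Y"
        by auto
      obtain z r where z: "Y = em z" "res z = cst r"
        using slev_residue[of k Y] Suc.prems Y(1) by auto
      have "r \<noteq> a d"
        using v_unique(1)[of k z] Suc.prems Y(1) z by auto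
      then show ?case
        using Tfix[of w z r] Y(2) z Suc.IH[of z] Suc.prems Y(1) by simp
    qed
    have \<sigma>p: "\<sigma> p = q"
      using T(4)[OF p(2)[symmetric]] T(3)[of 0] d_gt_1 q(2) finj by (simp add: \<pi>_def)
    have \<sigma>q: "\<sigma> q = p"
      using T(4)[OF q(2)[symmetric]] T(3)[of 1] d_gt_1 p(2) finj by (simp add: \<pi>_def)
    have \<sigma>z: "\<sigma> z = z" if z: "z \<in> lev (Suc N)" "z \<noteq> p" "z \<noteq> q" for z
    proof -
      have "f z + em t \<in> slev (Suc N)"
        by (rule lev_transfer[OF z(1)])
      then obtain Y where Y: "Y \<in> slev N" "f z + em t \<in> sp_child Y"
        by auto
      obtain u r where u: "Y = em u" "res u = cst r"
        using slev_residue[OF order_refl Y(1)] by blast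
      obtain w where w: "f z + em t = em w"
        using lev_residue[OF order_refl z(1)] by blast
      have "T w = w"
      proof (cases "r = a d")
        case True
        then have "u = v"
          using v_unique(2)[of N u] Y(1) u by simp
        then obtain i where i: "i < d" "w = y i"
          using Y(2) sp_child_v u(1) w by auto
        have "i \<noteq> 0"
        proof
          assume "i = 0"
          then have "z = p"
            using w p(2) i(2) by (intro finj) simp
          with z(2) show False ..
        qed
        moreover have "i \<noteq> 1"
        proof
          assume "i = 1"
          then have "z = q"
            using w q(2) i(2) by (intro finj) simp
          with z(3) show False ..
        qed
        ultimately show ?thesis
          using T(3)[OF i(1)] i(2) by (simp add: \<pi>_def Transposition.transpose_def)
      next
        case False
        then show ?thesis
          using Tfix[of w u r] Tlev[of N u] Y u w by simp
      qed
      then show ?thesis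
        using T(4)[OF w] w by (intro finj) simp
    qed
    show ?thesis
      by (rule bexI[OF _ x(1)], rule bexI[OF _ p(1)], rule bexI[OF _ q(1)], rule conjI[OF pq],
          rule bexI[OF _ T(2)]) (simp add: \<sigma>p \<sigma>q \<sigma>z)
  qed
qed

end

section \<open>Existence of good specialisations\<close>

lemma infinite_alg_closed: "infinite (UNIV :: 'a::alg_closed_field set)"
proof
  assume fin: "finite (UNIV :: 'a set)"
  define p :: "'a poly" where "p = (\<Prod>x\<in>UNIV. [:- x, 1:])"
  have px: "poly p x = 0" for x
    using fin by (simp add: p_def poly_prod)
  have "degree p = card (UNIV :: 'a set)"
    unfolding p_def by (simp add: degree_prod_sum_eq)
  then have "degree p > 0"
    using fin by (simp add: card_gt_0_iff)
  then have "degree (p + 1) > 0"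
    by (subst degree_add_eq_left) simp_all
  then obtain x where "poly (p + 1) x = 0"
    using alg_closed_imp_poly_has_root by blast
  then show False
    by (simp add: px)
qed

lemma avoid_roots:
  assumes "finite P" "\<And>p. p \<in> P \<Longrightarrow> p \<noteq> (0 :: 'a::alg_closed_field poly)"
  shows "\<exists>x. \<forall>p\<in>P. poly p x \<noteq> 0"
proof -
  have "finite (\<Union>p\<in>P. {x. poly p x = 0})"
    using assms by (auto intro: poly_roots_finite)
  then obtain x where "x \<notin> (\<Union>p\<in>P. {x. poly p x = 0})"
    using ex_new_if_finite[OF infinite_alg_closed] by blast
  then show ?thesis
    by blast
qed

section \<open>Orbits that do not return\<close>

fun aff_orb :: "('a::field \<Rightarrow> 'a) \<Rightarrow> 'a \<Rightarrow> nat \<Rightarrow> 'a" where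
  "aff_orb g v 0 = v"
| "aff_orb g v (Suc k) = v + g (aff_orb g v k)"

text \<open>Treat \<open>v\<close> as an unknown: the orbit points are polynomials
  \<open>q k\<close> in \<open>v\<close> of degree \<open>d ^ k\<close>, pairwise distinct since
  \<open>d > 1\<close>, so only finitely many values of \<open>v\<close> have to be avoided.\<close>

lemma poly_orbit_distinct:
  fixes \<alpha> :: "nat \<Rightarrow> 'a::alg_closed_field"
  assumes "d > 1"
  obtains v where "\<And>k. k < N \<Longrightarrow> aff_orb (\<lambda>x. \<Prod>i<d. x - \<alpha> i) v k \<noteq> aff_orb (\<lambda>x. \<Prod>i<d. x - \<alpha> i) v N"
proof -
  let ?g = "\<lambda>x. \<Prod>i<d. x - \<alpha> i"
  define q where "q = rec_nat [:0, 1:] (\<lambda>_ q. [:0, 1:] + (\<Prod>i<d. q - [:\<alpha> i:]))"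
  have q_0: "q 0 = [:0, 1:]" and q_Suc: "q (Suc k) = [:0, 1:] + (\<Prod>i<d. q k - [:\<alpha> i:])" for k
    by (simp_all add: q_def)
  have eval: "poly (q k) v = aff_orb ?g v k" for k v
    by (induction k) (simp_all add: q_0 q_Suc poly_prod)
  have deg: "degree (q k) = d ^ k" for k
  proof (induction k)
    case (Suc k)
    have pos: "degree (q k) > 0"
      using assms by (simp add: Suc)
    have fac: "degree (q k - [:\<alpha> i:]) = degree (q k)" for i
      using pos degree_add_eq_left[of "[:- \<alpha> i:]" "q k"] by (simp add: diff_conv_add_uminus del: add_uminus_conv_diff)
    have nz: "q k - [:\<alpha> i:] \<noteq> 0" for i
      using pos fac[of i] by (metis degree_0 less_numeral_extra(3))
    have pr: "degree (\<Prod>i<d. q k - [:\<alpha> i:]) = d * d ^ k"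
      using nz by (simp add: degree_prod_sum_eq fac Suc)
    moreover have "1 < d * d ^ k"
      using assms by (metis less_le_trans mult.right_neutral nat_mult_le_cancel_disj one_le_power order.strict_implies_order)
    ultimately have "degree (q (Suc k)) = d * d ^ k"
      unfolding q_Suc by (subst degree_add_eq_right) simp_all
    then show ?case by simp
  qed (simp add: q_0)
  have "q N - q k \<noteq> 0" if "k < N" for k
  proof
    assume "q N - q k = 0"
    then have "d ^ N = d ^ k"
      using deg by (metis eq_iff_diff_eq_0)
    then show False
      using that assms by simp
  qed
  then have "\<exists>v. \<forall>p\<in>(\<lambda>k. q N - q k) ` {..<N}. poly p v \<noteq> 0"
    by (intro avoid_roots) auto
  then obtain v where v: "\<forall>p\<in>(\<lambda>k. q N - q k) ` {..<N}. poly p v \<noteq> 0"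
    by (rule exE)
  show thesis
  proof (rule that)
    fix k assume "k < N"
    then have "poly (q N - q k) v \<noteq> 0"
      using v by simp
    then show "aff_orb ?g v k \<noteq> aff_orb ?g v N"
      by (simp add: eval)
  qed
qed

text \<open>A deformation from \<open>e = 0\<close>. With \<open>v\<close> good for
  \<open>x ^ d\<close>, each orbit condition says that some polynomial in \<open>e\<close> does not
  vanish, and these polynomials are nonzero because they do not vanish at \<open>e = 0\<close>.
  Hence some nonzero \<open>e\<close> satisfies all conditions.\<close>

lemma rational_orbit_distinct:
  assumes "d > 1"
  obtains v e :: "'a::alg_closed_field"
  where "if of_nat d = (0 :: 'a) then e \<noteq> 0 else e = 0"
    "\<And>k. k < N \<Longrightarrow> 1 + e * aff_orb (\<lambda>x. x ^ d / (1 + e * x)) v k \<noteq> 0"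
    "\<And>k. k < N \<Longrightarrow> aff_orb (\<lambda>x. x ^ d / (1 + e * x)) v k \<noteq> aff_orb (\<lambda>x. x ^ d / (1 + e * x)) v N"
proof -
  obtain v :: 'a where v: "\<And>k. k < N \<Longrightarrow> aff_orb (\<lambda>x. \<Prod>i<d. x - 0) v k \<noteq> aff_orb (\<lambda>x. \<Prod>i<d. x - 0) v N"
    using poly_orbit_distinct[OF assms, of N "\<lambda>_. 0"] by blast
  then have v: "aff_orb (\<lambda>x. x ^ d) v k \<noteq> aff_orb (\<lambda>x. x ^ d) v N" if "k < N" for k
    using that by simp
  show thesis
  proof (cases "of_nat d = (0 :: 'a)")
    case False
    then show thesis
      using that[of 0 v] v by simp
  next
    case True
    \<comment> \<open>Numerators and denominators of the orbit points as polynomials in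
      \<open>e\<close>. The recursion clears denominators in
      \<open>(n / m) ^ d / (1 + e * (n / m))\<close>, which equals \<open>n ^ d\<close> over
      \<open>m ^ (d - 1) * (m + e * n)\<close>.\<close>
    define nm where "nm = rec_nat ([:v:], 1) (\<lambda>_ (n, m). let m' = m ^ (d - 1) * (m + [:0, 1:] * n) in (smult v m' + n ^ d, m'))"
    define n where "n k = fst (nm k)" for k
    define m where "m k = snd (nm k)" for k
    have n0: "n 0 = [:v:]" and m0: "m 0 = 1"
      by (simp_all add: n_def m_def nm_def)
    have mS: "m (Suc k) = m k ^ (d - 1) * (m k + [:0, 1:] * n k)"
      and nS: "n (Suc k) = smult v (m (Suc k)) + n k ^ d" for k
      by (simp_all add: n_def m_def nm_def Let_def split: prod.splits)
    have at0: "poly (m k) 0 = 1 \<and> poly (n k) 0 = aff_orb (\<lambda>x. x ^ d) v k" for k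
      by (induction k) (simp_all add: n0 m0 mS nS)
    have mdvd: "poly (m N) e \<noteq> 0 \<Longrightarrow> k \<le> N \<Longrightarrow> poly (m k) e \<noteq> 0" for k e
    proof (induction "N - k" arbitrary: k)
      case (Suc j)
      have "poly (m (Suc k)) e \<noteq> 0"
        by (rule Suc.hyps(1)) (use Suc.hyps(2) Suc.prems in simp_all)
      then show ?case
        using assms by (auto simp: mS)
    qed simp
    have orbit: "aff_orb (\<lambda>x. x ^ d / (1 + e * x)) v k = poly (n k) e / poly (m k) e"
      if e: "poly (m N) e \<noteq> 0" and "k \<le> N" for k e
      using that(2)
    proof (induction k)
      case 0
      show ?case by (simp add: n0 m0)
    next
      case (Suc k)
      have mk: "poly (m k) e \<noteq> 0" and mk': "poly (m (Suc k)) e \<noteq> 0"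
        using mdvd[OF e] Suc.prems by auto
      then have s: "poly (m k) e + e * poly (n k) e \<noteq> 0"
        by (auto simp: mS)
      have pw: "poly (m k) e ^ d = poly (m k) e ^ (d - 1) * poly (m k) e"
        using assms by (metis less_imp_le Suc_diff_1 less_trans power_Suc2 zero_less_one)
      have key: "(poly (n k) e / poly (m k) e) ^ d / (1 + e * (poly (n k) e / poly (m k) e))
          = poly (n k) e ^ d / poly (m (Suc k)) e"
      proof -
        have "1 + e * (poly (n k) e / poly (m k) e) = (poly (m k) e + e * poly (n k) e) / poly (m k) e"
          using mk by (simp add: field_simps)
        then show ?thesis
          using mk s by (simp add: power_divide pw mS)
      qed
      have "aff_orb (\<lambda>x. x ^ d / (1 + e * x)) v k = poly (n k) e / poly (m k) e"
        using Suc by simp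
      then have "aff_orb (\<lambda>x. x ^ d / (1 + e * x)) v (Suc k) = v + poly (n k) e ^ d / poly (m (Suc k)) e"
        by (simp only: aff_orb.simps key)
      also have "\<dots> = poly (n (Suc k)) e / poly (m (Suc k)) e"
        using mk' by (simp add: nS add_divide_distrib)
      finally show ?case .
    qed
    \<comment> \<open>\<open>[:0, 1:]\<close> excludes \<open>e = 0\<close>. Every earlier
      \<open>m k\<close> divides \<open>m N\<close>, so this one polynomial takes care of all poles;
      the differences keep the last orbit point apart from the others.\<close>
    define P where "P = insert [:0, 1:] (insert (m N) ((\<lambda>k. n N * m k - n k * m N) ` {..<N}))"
    have "p \<noteq> 0" if "p \<in> P" for p
    proof -
      have "m N \<noteq> 0"
        using at0[of N] by auto
      moreover have "n N * m k - n k * m N \<noteq> 0" if "k < N" for k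
      proof
        assume "n N * m k - n k * m N = 0"
        then have "poly (n N * m k - n k * m N) 0 = 0"
          by simp
        then show False
          using v[OF that] at0 by simp
      qed
      ultimately show ?thesis
        using that by (auto simp: P_def)
    qed
    moreover have "finite P"
      by (simp add: P_def)
    ultimately have "\<exists>e. \<forall>p\<in>P. poly p e \<noteq> 0"
      by (intro avoid_roots)
    then obtain e where "\<forall>p\<in>P. poly p e \<noteq> 0"
      by (rule exE)
    then have e: "poly p e \<noteq> 0" if "p \<in> P" for p
      using that by (rule bspec)
    have mN: "poly (m N) e \<noteq> 0" and e0: "e \<noteq> 0"
      using e[of "m N"] e[of "[:0, 1:]"] by (simp_all add: P_def)
    show thesis
    proof (rule that[of e v])
      show "if of_nat d = (0 :: 'a) then e \<noteq> 0 else e = 0"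
        using True e0 by simp
    next
      fix k assume k: "k < N"
      have mk: "poly (m k) e \<noteq> 0" and "poly (m (Suc k)) e \<noteq> 0"
        using mdvd[OF mN] k by auto
      then have "poly (m k) e + e * poly (n k) e \<noteq> 0"
        by (auto simp: mS)
      then show "1 + e * aff_orb (\<lambda>x. x ^ d / (1 + e * x)) v k \<noteq> 0"
        using mk k unfolding orbit[OF mN less_imp_le[OF k]] by (simp add: field_simps)
      have "poly (n N * m k - n k * m N) e \<noteq> 0"
        using k by (intro e) (simp add: P_def)
      then show "aff_orb (\<lambda>x. x ^ d / (1 + e * x)) v k \<noteq> aff_orb (\<lambda>x. x ^ d / (1 + e * x)) v N"
        using mk mN unfolding orbit[OF mN less_imp_le[OF k]] orbit[OF mN order_refl] by (simp add: field_simps)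
    qed
  qed
qed

section \<open>Ramification of the reduced maps\<close>

context special_family
begin

lemma orb0_conv_aff_orb:
  assumes "\<And>x. g x = (\<Prod>i<d. x - a i) / den_eval d b0 x"
  shows "orb0 k = aff_orb g (a d) k"
  by (induction k) (simp_all add: assms)

lemma b0_eval:
  assumes "ph \<Longrightarrow> a (d + 1) = 1 \<and> a (d + 2) = e \<and> (\<forall>j>1. a (d + 1 + j) = 0)" "\<not> ph \<Longrightarrow> e = 0"
  shows "den_poly d b0 = [:1, e:]" "den_eval d b0 x = 1 + e * x"
proof -
  have "coeff (den_poly d b0) j = coeff [:1, e:] j" for j
  proof (cases ph)
    case True
    consider "j = 0" | "j = 1" | "j > 1"
      by linarith
    then show ?thesis
    proof cases
      case 3
      then have "coeff [:1, e:] j = 0"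
        by (simp add: coeff_eq_0)
      then show ?thesis
        using assms(1)[OF True] 3 unfolding coeff_den_poly b0_def by simp
    qed (use assms(1)[OF True] d_gt_1 in \<open>unfold coeff_den_poly b0_def, simp_all add: True\<close>)
  next
    case False
    then show ?thesis
      using assms(2) unfolding coeff_den_poly b0_def by (simp add: coeff_pCons split: nat.splits)
  qed
  then show "den_poly d b0 = [:1, e:]"
    by (rule poly_eqI)
  then show "den_eval d b0 x = 1 + e * x"
    using poly_den_poly[of d b0 x] by (simp add: mult.commute)
qed

text \<open>A residual fibre polynomial has derivative
  \<open>of_nat d * x ^ (d - 1) + (a d - r) * e\<close>. If \<open>of_nat d\<close> is nonzero then
  \<open>e = 0\<close> and only \<open>x = 0\<close> is critical, which lies over
  \<open>a d\<close>; otherwise the derivative is a nonzero constant for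
  \<open>r \<noteq> a d\<close>.\<close>

lemma good_pure_power:
  assumes a: "\<And>i. i < d \<Longrightarrow> a i = 0"
    and b: "ph \<Longrightarrow> a (d + 1) = 1 \<and> a (d + 2) = e \<and> (\<forall>j>1. a (d + 1 + j) = 0)" "\<not> ph \<Longrightarrow> e = 0"
    and e: "if of_nat d = (0 :: 'k alg_closure) then e \<noteq> 0 else e = 0"
    and orbit: "\<And>k. k < N \<Longrightarrow> 1 + e * aff_orb (\<lambda>x. x ^ d / (1 + e * x)) (a d) k \<noteq> 0"
      "\<And>k. k < N \<Longrightarrow> aff_orb (\<lambda>x. x ^ d / (1 + e * x)) (a d) k \<noteq> aff_orb (\<lambda>x. x ^ d / (1 + e * x)) (a d) N"
  shows good
proof -
  note B = b0_eval[OF b]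
  have H: "(\<Prod>i<d. x - a i) = x ^ d" for x
    using a by simp
  have orb: "orb0 k = aff_orb (\<lambda>x. x ^ d / (1 + e * x)) (a d) k" for k
    by (rule orb0_conv_aff_orb) (simp add: H B)
  have lin: "lin_prod d a = monom 1 d"
  proof -
    have "lin_prod d a = (\<Prod>i<d. [:0, 1:])"
      unfolding lin_prod_def by (rule prod.cong) (simp_all add: a)
    then show ?thesis
      by (simp add: monom_altdef)
  qed
  have sep: "poly (pderiv (fibre_poly d a b0 (a d - r))) x \<noteq> 0"
    if r: "r \<noteq> a d" and root: "poly (fibre_poly d a b0 (a d - r)) x = 0" for r x
  proof
    assume der: "poly (pderiv (fibre_poly d a b0 (a d - r))) x = 0"
    have der': "of_nat d * x ^ (d - 1) + (a d - r) * e = 0"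
      using der by (simp add: fibre_poly_def lin B(1) pderiv_add pderiv_smult pderiv_monom pderiv_pCons poly_monom)
    have root': "x ^ d + (a d - r) * (1 + e * x) = 0"
      using root by (simp add: fibre_poly_def lin B(1) poly_monom algebra_simps)
    show False
    proof (cases "of_nat d = (0 :: 'k alg_closure)")
      case True
      then show False
        using der' e r by simp
    next
      case False
      then have "x = 0"
        using der' e by simp
      then show False
        using root' r d_gt_1 by (simp add: power_0_left)
    qed
  qed
  show ?thesis
    unfolding good_def orbit_defined_def
    using orbit sep d_gt_1 a by (auto simp: orb B H power_0_left)
qed

text \<open>In the polynomial case with \<open>p\<close> dividing \<open>d\<close> the reduced map is \<open>a\<^sub>d + x\<^sup>d - x\<^sup>d\<^sup>-\<^sup>1\<close>.\<close>

lemma good_trinomial: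
  assumes ph: "\<not> ph" and d: "d > 2" "of_nat d = (0 :: 'k alg_closure)"
    and a: "\<And>i. i < d - 1 \<Longrightarrow> a i = 0" "a (d - 1) = 1"
    and orbit: "\<And>k. k < N \<Longrightarrow> aff_orb (\<lambda>x. \<Prod>i<d. x - a i) (a d) k \<noteq> aff_orb (\<lambda>x. \<Prod>i<d. x - a i) (a d) N"
  shows good
proof -
  have B: "den_poly d b0 = [:1, 0:]" "den_eval d b0 x = 1 + 0 * x" for x
    using b0_eval[where e = 0] ph by simp_all
  have dS: "d = Suc (d - 1)"
    using d by simp
  have lin: "lin_prod d a = monom 1 (d - 1) * [:- 1, 1:]"
  proof -
    have "lin_prod d a = (\<Prod>i<d - 1. [:- a i, 1:]) * [:- a (d - 1), 1:]"
      unfolding lin_prod_def by (subst dS) (simp add: prod.lessThan_Suc)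
    also have "(\<Prod>i<d - 1. [:- a i, 1:]) = (\<Prod>i<d - 1. [:0, 1:])"
      by (rule prod.cong) (simp_all add: a(1))
    finally show ?thesis
      by (simp only: monom_altdef a(2) prod_constant card_lessThan smult_1_left)
  qed
  have orb: "orb0 k = aff_orb (\<lambda>x. \<Prod>i<d. x - a i) (a d) k" for k
    by (rule orb0_conv_aff_orb) (simp add: B)
  have d1: "of_nat (d - 1) = (- 1 :: 'k alg_closure)"
  proof -
    have "of_nat (Suc (d - 1)) = (0 :: 'k alg_closure)"
      using d(2) dS by simp
    then show ?thesis
      by (simp add: eq_neg_iff_add_eq_0 add.commute)
  qed
  have sep: "poly (pderiv (fibre_poly d a b0 (a d - r))) x \<noteq> 0"
    if r: "r \<noteq> a d" and root: "poly (fibre_poly d a b0 (a d - r)) x = 0" for r x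
  proof
    assume der: "poly (pderiv (fibre_poly d a b0 (a d - r))) x = 0"
    have root': "x ^ (d - 1) * (x - 1) + (a d - r) = 0"
      using root by (simp add: fibre_poly_def lin B(1) poly_monom algebra_simps)
    \<comment> \<open>Since \<open>of_nat d\<close> vanishes, \<open>x ^ d - x ^ (d - 1)\<close> has
      derivative \<open>x ^ (d - 2)\<close>; it appears here in the form given by the product
      rule.\<close>
    have "x ^ (d - 1) + (- 1) * x ^ (d - 1 - 1) * (x - 1) = 0"
      using der unfolding fibre_poly_def lin B(1) pderiv_add pderiv_mult pderiv_smult pderiv_monom d1
      by (simp add: pderiv_pCons poly_monom algebra_simps)
    moreover have "x ^ (d - 1) = x ^ (d - 1 - 1) * x"
      using d(1) by (metis Suc_diff_1 power_Suc2 zero_less_diff less_trans one_less_numeral_iff semiring_norm(76))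
    ultimately have "x ^ (d - 1 - 1) = 0"
      by (simp add: algebra_simps)
    then have "x = 0"
      by simp
    then show False
      using root' r d(1) by (simp add: power_0_left)
  qed
  show ?thesis
    unfolding good_def orbit_defined_def
    using orbit sep d a by (auto simp: orb B)
qed

end

definition std_param :: "nat \<Rightarrow> (nat \<Rightarrow> 'a) \<Rightarrow> 'a \<Rightarrow> 'a \<Rightarrow> nat \<Rightarrow> 'a::field" where
  "std_param d \<alpha> v e i = (if i < d then \<alpha> i else if i = d then v else if i = d + 1 then 1
     else if i = d + 2 then e else 0)"

lemma special_family_std_param: "d > 1 \<Longrightarrow> special_family ph d (std_param d \<alpha> v e)"
  by unfold_locales (auto simp: std_param_def)

lemma good_exists_pure:
  assumes "d > 1" and "ph \<or> of_nat d \<noteq> (0 :: 'k::field alg_closure)"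
  shows "\<exists>a :: nat \<Rightarrow> 'k alg_closure. special_family ph d a \<and> special_family.good ph d N a \<and> (\<forall>i<d. a i = a 0)"
proof (rule rational_orbit_distinct[OF assms(1)])
  fix v e :: "'k alg_closure"
  assume e: "if of_nat d = (0 :: 'k alg_closure) then e \<noteq> 0 else e = 0"
    and orb: "\<And>k. k < N \<Longrightarrow> 1 + e * aff_orb (\<lambda>x. x ^ d / (1 + e * x)) v k \<noteq> 0"
    "\<And>k. k < N \<Longrightarrow> aff_orb (\<lambda>x. x ^ d / (1 + e * x)) v k \<noteq> aff_orb (\<lambda>x. x ^ d / (1 + e * x)) v N"
  define a where "a = std_param d (\<lambda>_. 0) v e"
  interpret special_family ph d N a
    unfolding a_def by (rule special_family_std_param[OF assms(1)])
  have ad: "a d = v" and ai: "i < d \<Longrightarrow> a i = 0" for i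
    by (simp_all add: a_def std_param_def)
  have good
  proof (rule good_pure_power[where e = e])
    show "\<not> ph \<Longrightarrow> e = 0"
      using assms(2) e by simp
    show "a (d + 1) = 1 \<and> a (d + 2) = e \<and> (\<forall>j>1. a (d + 1 + j) = 0)"
      by (simp add: a_def std_param_def)
  qed (use e orb in \<open>simp_all add: ad ai\<close>)
  then show ?thesis
    using special_family_axioms ai assms(1) by auto
qed

lemma good_exists_trinomial:
  assumes "d > 2" "of_nat d = (0 :: 'k::field alg_closure)"
  shows "\<exists>a :: nat \<Rightarrow> 'k alg_closure. special_family False d a \<and> special_family.good False d N a"
proof -
  define \<alpha> :: "nat \<Rightarrow> 'k alg_closure" where "\<alpha> i = (if i = d - 1 then 1 else 0)" for i
  have d: "d > 1" using assms(1) by simp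
  obtain v where v: "\<And>k. k < N \<Longrightarrow> aff_orb (\<lambda>x. \<Prod>i<d. x - \<alpha> i) v k \<noteq> aff_orb (\<lambda>x. \<Prod>i<d. x - \<alpha> i) v N"
    using poly_orbit_distinct[OF d, of N \<alpha>] by blast
  define a where "a = std_param d \<alpha> v 0"
  interpret special_family False d N a
    unfolding a_def by (rule special_family_std_param[OF d])
  have ad: "a d = v" and ai: "i < d \<Longrightarrow> a i = \<alpha> i" for i
    by (simp_all add: a_def std_param_def)
  have pr: "(\<Prod>i<d. x - a i) = (\<Prod>i<d. x - \<alpha> i)" for x
    by (rule prod.cong) (simp_all add: ai)
  have good
    by (rule good_trinomial) (use assms v d in \<open>simp_all add: pr ad ai \<alpha>_def\<close>)
  then show ?thesis
    using special_family_axioms by blast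
qed

section \<open>The action on the generic tree\<close>

abbreviation gen_lev :: "bool \<Rightarrow> nat \<Rightarrow> nat \<Rightarrow> 'k::field ratfun alg_closure set" where
  "gen_lev ph d \<equiv> tree_lev (gen_child ph d) 0"

lemma tree_lev_chain:
  assumes "x \<in> tree_lev ch r j"
  shows "\<exists>\<omega>. \<omega> 0 = x \<and> \<omega> j = r \<and> (\<forall>k<j. \<omega> k \<in> ch (\<omega> (Suc k)))"
  using assms
proof (induction j arbitrary: x)
  case 0
  then show ?case by (intro exI[of _ "\<lambda>_. r"]) simp
next
  case (Suc j)
  then obtain z where z: "z \<in> tree_lev ch r j" "x \<in> ch z"
    by auto
  obtain \<omega> where \<omega>: "\<omega> 0 = z" "\<omega> j = r" "\<forall>k<j. \<omega> k \<in> ch (\<omega> (Suc k))"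
    using Suc.IH[OF z(1)] by blast
  show ?case
    by (rule exI[of _ "\<lambda>k. case k of 0 \<Rightarrow> x | Suc k \<Rightarrow> \<omega> k"])
       (use \<omega> z(2) in \<open>auto split: nat.splits simp: less_Suc_eq_0_disj\<close>)
qed

lemma special_embedding_exists:
  fixes a :: "nat \<Rightarrow> 'k::field alg_closure"
  assumes "special_family ph d a" "special_family.orbit_defined ph d N a"
    and cop: "N = 0 \<or> gen_coprime TYPE('k) ph d"
    and ne: "gen_lev ph d N \<noteq> ({} :: 'k ratfun alg_closure set)"
    and pole: "\<And>z :: 'k ratfun alg_closure. z \<in> gen_lev ph d N \<Longrightarrow> z * gen_den ph d d \<noteq> 1"
  shows "\<exists>f. special_embedding ph d N a f"
proof -
  interpret special_family ph d N a by fact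
  obtain z :: "'k ratfun alg_closure" where z: "z \<in> gen_lev ph d N"
    using ne by blast
  obtain \<omega> where \<omega>: "\<omega> 0 = z" "\<omega> N = 0" "\<forall>k<N. \<omega> k \<in> gen_child ph d (\<omega> (Suc k))"
    using tree_lev_chain[OF z] by blast
  have chain: "num_eval d gen_num (\<omega> k) = \<omega> (Suc k) * den_eval d (gen_den ph d) (\<omega> k)" if "k < N" for k
    using \<omega>(3) that by (simp add: gen_child_def preimages_def)
  have "inj \<iota>"
  proof (rule inj_\<iota>[OF assms(2) chain _ \<omega>(2)])
    show "den_eval d (gen_den ph d) (\<omega> k) \<noteq> 0" if "k < N" for k
    proof
      assume 0: "den_eval d (gen_den ph d) (\<omega> k) = 0"
      then have "num_eval d gen_num (\<omega> k) = 0"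
        using chain[OF that] by simp
      then show False
        using 0 cop that unfolding gen_coprime_def by blast
    qed
    show "\<omega> 0 * gen_den ph d d \<noteq> 1"
      using pole[OF z] \<omega>(1) by simp
  qed
  then have "inj (\<lambda>p. em (\<iota> p))"
    by (simp add: inj_def)
  moreover have "unital_hom (\<lambda>p. em (\<iota> p))"
    by (rule unital_hom_comp[OF unital_hom_em unital_hom_\<iota>])
  ultimately obtain f where "unital_hom f" "\<And>p. f (to_ac (frac_of p)) = em (\<iota> p)"
    using idom_hom_ext by blast
  then have "special_embedding ph d N a f"
    using assms(2) by (intro special_embedding.intro special_family_axioms special_embedding_axioms.intro)
  then show ?thesis by blast
qed

text \<open>A vertex on level \<open>N\<close> away from the value at infinity yields the embedding;
  the embedding yields children and excludes that value on level \<open>N + 1\<close>. The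
  alternative \<open>N = 0\<close> starts the induction: the path then has no steps, and coprimality
  comes out of the first embedding.\<close>

lemma good_embedding_exists:
  assumes ex: "\<And>N. \<exists>a :: nat \<Rightarrow> 'k::field alg_closure. special_family ph d a \<and> special_family.good ph d N a"
  shows "gen_lev ph d N \<noteq> ({} :: 'k ratfun alg_closure set) \<and>
    (\<forall>z \<in> gen_lev ph d N. z * gen_den ph d d \<noteq> (1 :: 'k ratfun alg_closure)) \<and>
    (N = 0 \<or> gen_coprime TYPE('k) ph d) \<and>
    (\<forall>a :: nat \<Rightarrow> 'k alg_closure. special_family ph d a \<longrightarrow> special_family.good ph d N a \<longrightarrow>
       (\<exists>f. good_embedding ph d N a f))"
proof (induction N)
  have step: "\<exists>f. good_embedding ph d N a f"
    if h: "special_family ph d a" "special_family.good ph d N a" "N = 0 \<or> gen_coprime TYPE('k) ph d"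
      "gen_lev ph d N \<noteq> ({} :: 'k ratfun alg_closure set)"
      "\<forall>z \<in> gen_lev ph d N. z * gen_den ph d d \<noteq> (1 :: 'k ratfun alg_closure)"
    for N and a :: "nat \<Rightarrow> 'k alg_closure"
  proof -
    have "special_family.orbit_defined ph d N a"
      using h(1,2) by (simp add: special_family.good_def)
    then obtain f where "special_embedding ph d N a f"
      using special_embedding_exists[OF h(1) _ h(3,4)] h(5) by blast
    then have "good_embedding ph d N a f"
      using h(2) by (simp add: good_embedding_def good_embedding_axioms_def)
    then show ?thesis by blast
  qed
  {
    case 0
    show ?case
      using step[of _ 0] by simp
  next
    case (Suc N)
    obtain a :: "nat \<Rightarrow> 'k alg_closure" where a: "special_family ph d a" "special_family.good ph d N a"
      using ex by blast
    then obtain f where "good_embedding ph d N a f"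
      using Suc.IH by blast
    then interpret good_embedding ph d N a f .
    obtain z :: "'k ratfun alg_closure" where z: "z \<in> gen_lev ph d N"
      using Suc.IH by blast
    have "card (gen_child ph d z) = d"
      by (rule card_gen_child[OF order_refl z])
    then have "gen_child ph d z \<noteq> {}"
      using d_gt_1 by auto
    then have 1: "gen_lev ph d (Suc N) \<noteq> ({} :: 'k ratfun alg_closure set)"
      using z by auto
    have 2: "\<forall>z \<in> gen_lev ph d (Suc N). z * gen_den ph d d \<noteq> (1 :: 'k ratfun alg_closure)"
      using lev_not_pole[OF order_refl] by blast
    show ?case
      using 1 2 gen_coprime_holds step[of _ "Suc N"] by simp
  }
qed

lemma ac_auts_group:
  shows "id \<in> ac_auts" "\<sigma> \<in> ac_auts \<Longrightarrow> \<tau> \<in> ac_auts \<Longrightarrow> \<sigma> \<circ> \<tau> \<in> ac_auts"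
    "\<sigma> \<in> ac_auts \<Longrightarrow> inv_into UNIV \<sigma> \<in> ac_auts"
proof -
  show "id \<in> ac_auts"
    by (simp add: ac_auts_def unital_hom_def)
  show "\<sigma> \<circ> \<tau> \<in> ac_auts" if "\<sigma> \<in> ac_auts" "\<tau> \<in> ac_auts"
    using that unital_hom_comp[of \<sigma> \<tau>] bij_comp[of \<tau> \<sigma>] by (simp add: ac_auts_def comp_def)
  show "inv_into UNIV \<sigma> \<in> ac_auts" if \<sigma>: "\<sigma> \<in> ac_auts"
  proof -
    have b: "bij \<sigma>" and h: "unital_hom \<sigma>" and k: "\<And>k. \<sigma> (to_ac k) = to_ac k"
      using \<sigma> by (simp_all add: ac_auts_def)
    have eqI: "inv_into UNIV \<sigma> x = z" if "x = \<sigma> z" for x z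
      using that b by (simp add: bij_is_inj)
    have r: "\<sigma> (inv_into UNIV \<sigma> x) = x" for x
      using b by (simp add: bij_is_surj surj_f_inv_f)
    have "unital_hom (inv_into UNIV \<sigma>)"
      by unfold_locales
         (rule eqI, simp add: unital_hom.one[OF h] unital_hom.add[OF h] unital_hom.mult[OF h] r)+
    moreover have "inv_into UNIV \<sigma> (to_ac k) = to_ac k" for k
      by (rule eqI) (simp add: k)
    ultimately show ?thesis
      using b by (simp add: ac_auts_def bij_imp_bij_inv)
  qed
qed

lemma gen_child_ac_auts:
  assumes \<sigma>: "\<sigma> \<in> ac_auts" and x: "x \<in> gen_child ph d z"
  shows "\<sigma> x \<in> gen_child ph d (\<sigma> z)"
proof -
  have h: "unital_hom \<sigma>" and k: "\<And>k. \<sigma> (to_ac k) = to_ac k"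
    using \<sigma> by (simp_all add: ac_auts_def)
  have num: "\<sigma> (gen_num i) = gen_num i" for i
    by (simp add: gen_num_def k)
  have den: "\<sigma> (gen_den ph d j) = gen_den ph d j" for j
    by (simp add: gen_den_def k unital_hom.one[OF h] unital_hom.zero[OF h])
  have "\<sigma> (num_eval d gen_num x) = \<sigma> (z * den_eval d (gen_den ph d) x)"
    using x by (simp add: gen_child_def preimages_def)
  then show ?thesis
    unfolding unital_hom_num_eval[OF h] unital_hom.mult[OF h] unital_hom_den_eval[OF h] num den
    by (simp add: gen_child_def preimages_def)
qed

text \<open>Two families of parameters: \<open>ex\<close> supplies the swaps and counts the
  children, \<open>ex_eq\<close> supplies double transitivity. For the polynomial with
  \<open>p\<close> dividing \<open>d\<close> one family cannot do both, since equal residues make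
  the reduced map inseparable.\<close>

lemma generic_tree_action:
  assumes d: "d > 1"
    and ex: "\<And>N. \<exists>a :: nat \<Rightarrow> 'k::field alg_closure. special_family ph d a \<and> special_family.good ph d N a"
    and ex_eq: "\<And>N. \<exists>a :: nat \<Rightarrow> 'k alg_closure. special_family ph d a \<and>
      special_family.orbit_defined ph d N a \<and> (\<forall>i<d. a i = a 0)"
  shows "tree_action (0 :: 'k ratfun alg_closure) (gen_child ph d) d n ac_auts (gen_lev ph d)"
    and "gen_coprime TYPE('k) ph d"
    and "\<And>N (z :: 'k ratfun alg_closure). z \<in> gen_lev ph d N \<Longrightarrow> z * gen_den ph d d \<noteq> 1"
proof -
  note facts = good_embedding_exists[OF ex]
  have emb: "\<exists>(a :: nat \<Rightarrow> 'k alg_closure) f. good_embedding ph d N a f" for N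
  proof -
    obtain a :: "nat \<Rightarrow> 'k alg_closure" where "special_family ph d a" "special_family.good ph d N a"
      using ex by blast
    then show ?thesis
      using facts[of N] by blast
  qed
  obtain a0 :: "nat \<Rightarrow> 'k alg_closure" and f0 where "good_embedding ph d 0 a0 f0"
    using emb by blast
  then show cop: "gen_coprime TYPE('k) ph d"
    by (rule good_embedding.gen_coprime_holds)
  show "z * gen_den ph d d \<noteq> 1" if "z \<in> gen_lev ph d N" for N and z :: "'k ratfun alg_closure"
    using facts[of N] that by blast
  show "tree_action (0 :: 'k ratfun alg_closure) (gen_child ph d) d n ac_auts (gen_lev ph d)"
  proof
    fix j and z :: "'k ratfun alg_closure" assume "z \<in> gen_lev ph d j"
    moreover obtain a :: "nat \<Rightarrow> 'k alg_closure" and f where "good_embedding ph d j a f"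
      using emb by blast
    ultimately show "card (gen_child ph d z) = d"
      using good_embedding.card_gen_child[of ph d j a f j z] by simp
  next
    fix x z z' :: "'k ratfun alg_closure"
    assume "x \<in> gen_child ph d z" "x \<in> gen_child ph d z'"
    then have *: "num_eval d gen_num x = z * den_eval d (gen_den ph d) x"
      "num_eval d gen_num x = z' * den_eval d (gen_den ph d) x"
      by (simp_all add: gen_child_def preimages_def)
    then have "den_eval d (gen_den ph d) x \<noteq> 0"
      using cop unfolding gen_coprime_def by auto
    then show "z = z'"
      using * by simp
  next
    fix j
    obtain a :: "nat \<Rightarrow> 'k alg_closure" and f where "good_embedding ph d j a f"
      using emb by blast
    then show "\<exists>v\<in>gen_lev ph d j. \<exists>a\<in>gen_child ph d v. \<exists>b\<in>gen_child ph d v. a \<noteq> b \<and>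
          (\<exists>\<sigma>\<in>ac_auts. \<sigma> a = b \<and> \<sigma> b = a \<and> (\<forall>x\<in>gen_lev ph d (Suc j) - {a, b}. \<sigma> x = (x :: 'k ratfun alg_closure)))"
      by (rule good_embedding.swap_exists)
  next
    fix j
    obtain a :: "nat \<Rightarrow> 'k alg_closure" where a: "special_family ph d a"
        "special_family.orbit_defined ph d j a" "\<forall>i<d. a i = a 0"
      using ex_eq by blast
    obtain f where f: "special_embedding ph d j a f"
      using special_embedding_exists[OF a(1,2)] cop facts[of j] by blast
    show "\<exists>v\<in>gen_lev ph d j. \<forall>a\<in>gen_child ph d v. \<forall>b\<in>gen_child ph d v. \<forall>a'\<in>gen_child ph d v.
        \<forall>b'\<in>gen_child ph d v. a \<noteq> b \<longrightarrow> a' \<noteq> b' \<longrightarrow> (\<exists>\<sigma>\<in>ac_auts. \<sigma> a = a' \<and> \<sigma> b = (b' :: 'k ratfun alg_closure))"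
      by (rule special_embedding.double_transitivity[OF f cop]) (use a(3) in blast)
  next
    show "\<sigma> 0 = (0 :: 'k ratfun alg_closure)" if "\<sigma> \<in> ac_auts" for \<sigma>
      using that by (simp add: ac_auts_def unital_hom.zero)
    show "bij (\<sigma> :: 'k ratfun alg_closure \<Rightarrow> _)" if "\<sigma> \<in> ac_auts" for \<sigma>
      using that by (simp add: ac_auts_def)
  qed (use d in \<open>simp_all add: ac_auts_group gen_child_ac_auts\<close>)
qed

lemma generic_tree_action_Phi:
  assumes d: "d > 1"
  shows "tree_action (0 :: 'k::field ratfun alg_closure) (gen_child True d) d n ac_auts (gen_lev True d)"
    and "gen_coprime TYPE('k) True d"
    and "\<And>N (z :: 'k ratfun alg_closure). z \<in> gen_lev True d N \<Longrightarrow> z * gen_den True d d \<noteq> 1"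
proof -
  have ex: "\<exists>a :: nat \<Rightarrow> 'k alg_closure. special_family True d a \<and> special_family.good True d N a \<and> (\<forall>i<d. a i = a 0)" for N
    by (rule good_exists_pure[OF d]) simp
  then have 1: "\<exists>a :: nat \<Rightarrow> 'k alg_closure. special_family True d a \<and> special_family.good True d N a" for N
    by blast
  have 2: "\<exists>a :: nat \<Rightarrow> 'k alg_closure. special_family True d a \<and>
      special_family.orbit_defined True d N a \<and> (\<forall>i<d. a i = a 0)" for N
  proof -
    obtain a :: "nat \<Rightarrow> 'k alg_closure" where a: "special_family True d a"
        "special_family.good True d N a" "\<forall>i<d. a i = a 0"
      using ex[of N] by (elim exE conjE) (rule that; assumption)
    have "special_family.orbit_defined True d N a"
      using a(2) unfolding special_family.good_def[OF a(1)] by (rule conjunct1)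
    then show ?thesis
      using a(1,3) by (intro exI[of _ a] conjI)
  qed
  show "tree_action (0 :: 'k ratfun alg_closure) (gen_child True d) d n ac_auts (gen_lev True d)"
    "gen_coprime TYPE('k) True d"
    "\<And>N (z :: 'k ratfun alg_closure). z \<in> gen_lev True d N \<Longrightarrow> z * gen_den True d d \<noteq> 1"
    using generic_tree_action[OF d 1 2] by blast+
qed

lemma generic_tree_action_G:
  assumes d: "d > 1" and char: "(d, CHAR('k::field)) \<noteq> (2, 2)"
  shows "tree_action (0 :: 'k ratfun alg_closure) (gen_child False d) d n ac_auts (gen_lev False d)"
proof -
  have 1: "\<exists>a :: nat \<Rightarrow> 'k alg_closure. special_family False d a \<and> special_family.good False d N a" for N
  proof (cases "of_nat d = (0 :: 'k alg_closure)")
    case True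
    then have dvd: "CHAR('k) dvd d"
      using of_nat_eq_0_iff_char_dvd[where 'a = "'k alg_closure"] by simp
    have "d \<noteq> 2"
    proof
      assume d2: "d = 2"
      have "CHAR('k) \<noteq> 1"
        by simp
      then have "CHAR('k) = 2"
        using dvd two_is_prime_nat unfolding d2 prime_nat_iff by blast
      then show False
        using char d2 by simp
    qed
    then show ?thesis
      using good_exists_trinomial[OF _ True] d by simp
  next
    case False
    then show ?thesis
      using good_exists_pure[OF d, of False] by blast
  qed
  have 2: "\<exists>a :: nat \<Rightarrow> 'k alg_closure. special_family False d a \<and>
      special_family.orbit_defined False d N a \<and> (\<forall>i<d. a i = a 0)" for N
  proof -
    \<comment> \<open>The reduced map is \<open>x ^ d\<close>: all residues agree, and with
      denominator \<open>1\<close> the orbit meets no pole.\<close>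
    interpret special_family False d N "\<lambda>_. 0 :: 'k alg_closure"
      using d by unfold_locales simp_all
    have "den_eval d b0 x = 1 + 0 * x" for x
      by (rule b0_eval) simp_all
    then have "orbit_defined"
      by (simp add: orbit_defined_def)
    then show ?thesis
      using special_family_axioms by blast
  qed
  show ?thesis
    by (rule generic_tree_action(1)[OF d 1 2])
qed

section \<open>Zeros of the iterates\<close>

lemma unital_hom_eval: "unital_hom (\<lambda>p. poly (map_poly to_ac p) x)"
  by unfold_locales
     (simp_all add: unital_hom.map_poly_add[OF unital_hom_to_ac] unital_hom.map_poly_mult[OF unital_hom_to_ac])

lemma eval_smult: "poly (map_poly to_ac (smult c p)) x = to_ac c * poly (map_poly to_ac p) x"
  by (simp add: unital_hom.map_poly_smult[OF unital_hom_to_ac])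

lemma G_poly_conv: "G_poly d = num_poly d (s_var d)"
  by (simp add: G_poly_def num_poly_def)

lemma Phi_den_conv: "Phi_den d = den_poly d (u_var d)"
  by (simp add: Phi_den_def den_poly_def)

lemma map_poly_G_poly: "map_poly to_ac (G_poly d) = num_poly d gen_num"
  by (rule poly_eqI) (simp add: coeff_map_poly G_poly_conv coeff_num_poly gen_num_def s_var_def)

lemma map_poly_Phi_den: "map_poly to_ac (Phi_den d) = den_poly d (gen_den True d)"
  by (rule poly_eqI) (simp add: coeff_map_poly Phi_den_conv coeff_den_poly gen_den_def u_var_def)

lemma gen_den_poly_case: "den_eval d (gen_den False d) x = 1"
  by (simp add: den_eval_def gen_den_def if_distrib[of "\<lambda>c. c * _"] cong: if_cong)

lemma roots_G_iter:
  "{\<alpha>. poly (map_poly to_ac (G_iter d n)) \<alpha> = 0} = (gen_lev False d n :: 'k::field ratfun alg_closure set)"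
proof -
  let ?g = "num_eval d (gen_num :: nat \<Rightarrow> 'k ratfun alg_closure)"
  have eval: "poly (map_poly to_ac (G_iter d n)) x = (?g ^^ n) x" for x
  proof (induction n)
    case 0
    show ?case by (simp add: G_iter_def map_poly_pCons)
  next
    case (Suc n)
    have "(G_iter d (Suc n) :: 'k ratfun poly) = pcompose (G_poly d) (G_iter d n)"
      by (simp add: G_iter_def)
    then show ?case
      using Suc by (simp add: unital_hom.map_poly_pcompose[OF unital_hom_to_ac] poly_pcompose
          map_poly_G_poly poly_num_poly)
  qed
  have "x \<in> gen_lev False d n \<longleftrightarrow> (?g ^^ n) x = 0" for x
  proof (induction n arbitrary: x)
    case (Suc n)
    have "x \<in> gen_lev False d (Suc n) \<longleftrightarrow> ?g x \<in> gen_lev False d n"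
      by (auto simp: gen_child_def preimages_def gen_den_poly_case)
    also have "\<dots> \<longleftrightarrow> (?g ^^ n) (?g x) = 0"
      by (rule Suc.IH)
    finally show ?case
      by (simp add: funpow_swap1)
  qed simp
  then show ?thesis
    by (auto simp: eval)
qed

text \<open>\<open>\<Phi>\<close> in homogeneous coordinates on the projective line, the pair
  \<open>(p, q)\<close> standing for \<open>p / q\<close>. This is the recursion of
  \<open>Phi_iter\<close> evaluated at a point.\<close>

definition hom_step :: "nat \<Rightarrow> 'k ratfun alg_closure \<times> 'k ratfun alg_closure \<Rightarrow>
    'k::field ratfun alg_closure \<times> 'k ratfun alg_closure" where
  "hom_step d z = ((\<Sum>i\<le>d. coeff (num_poly d gen_num) i * (fst z ^ i * snd z ^ (d - i))),
     (\<Sum>i\<le>d. coeff (den_poly d (gen_den True d)) i * (fst z ^ i * snd z ^ (d - i))))"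

lemma Phi_iter_eval:
  "(poly (map_poly to_ac (fst (Phi_iter d m))) x, poly (map_poly to_ac (snd (Phi_iter d m))) x) =
     (hom_step d ^^ m) (x, 1)"
proof (induction m)
  case 0
  show ?case by (simp add: map_poly_pCons)
next
  case (Suc m)
  interpret ev: unital_hom "\<lambda>p. poly (map_poly to_ac p) x"
    by (rule unital_hom_eval)
  have c1: "to_ac (coeff (G_poly d) i) = coeff (num_poly d gen_num) i" for i
    using arg_cong[OF map_poly_G_poly[of d], of "\<lambda>p. coeff p i"] by (simp add: coeff_map_poly)
  have c2: "to_ac (coeff (Phi_den d) i) = coeff (den_poly d (gen_den True d)) i" for i
    using arg_cong[OF map_poly_Phi_den[of d], of "\<lambda>p. coeff p i"] by (simp add: coeff_map_poly)
  have "(hom_step d ^^ Suc m) (x, 1) = hom_step d ((hom_step d ^^ m) (x, 1))"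
    by simp
  then have step: "(hom_step d ^^ Suc m) (x, 1) = hom_step d (poly (map_poly to_ac (fst (Phi_iter d m))) x,
      poly (map_poly to_ac (snd (Phi_iter d m))) x)"
    by (simp only: Suc)
  show ?case
    unfolding step by (simp add: hom_step_def Let_def split_beta eval_smult c1 c2)
qed

lemma hom_step_scale:
  "hom_step d (c * p, c * q) = (c ^ d * fst (hom_step d (p, q)), c ^ d * snd (hom_step d (p, q)))"
proof -
  have "(c * p) ^ i * (c * q) ^ (d - i) = c ^ d * (p ^ i * q ^ (d - i))" if "i \<le> d" for i
  proof -
    have "(c * p) ^ i * (c * q) ^ (d - i) = (c ^ i * c ^ (d - i)) * (p ^ i * q ^ (d - i))"
      by (simp add: power_mult_distrib)
    also have "c ^ i * c ^ (d - i) = c ^ d"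
      using that by (simp flip: power_add)
    finally show ?thesis .
  qed
  then show ?thesis
    by (simp add: hom_step_def sum_distrib_left mult.left_commute)
qed

lemma hom_iter_scale:
  "(hom_step d ^^ m) (c * p, c * q) =
     (c ^ (d ^ m) * fst ((hom_step d ^^ m) (p, q)), c ^ (d ^ m) * snd ((hom_step d ^^ m) (p, q)))"
proof (induction m)
  case (Suc m)
  show ?case
    using hom_step_scale[of d "c ^ (d ^ m)" "fst ((hom_step d ^^ m) (p, q))" "snd ((hom_step d ^^ m) (p, q))"]
    by (simp add: Suc power_mult[symmetric] mult.commute)
qed simp

lemma hom_step_affine: "hom_step d (x, 1) = (num_eval d gen_num x, den_eval d (gen_den True d) x)"
proof -
  have deg: "degree (num_poly d (gen_num :: nat \<Rightarrow> 'a ratfun alg_closure)) \<le> d"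
    by (intro degree_le) (simp add: coeff_num_poly)
  show ?thesis
    by (simp add: hom_step_def flip: poly_conv_sum[OF degree_den_poly] poly_conv_sum[OF deg])
       (simp add: poly_num_poly poly_den_poly)
qed

lemma hom_step_infinity:
  assumes "d > 0"
  shows "hom_step d (1, 0) = (1, gen_den True d d)"
proof -
  have "(\<Sum>i\<le>d. h i * (1 ^ i * 0 ^ (d - i))) = h d" for h :: "nat \<Rightarrow> 'a ratfun alg_closure"
  proof -
    have "(\<Sum>i\<le>d. h i * (1 ^ i * 0 ^ (d - i))) = (\<Sum>i\<in>{d}. h i * (1 ^ i * 0 ^ (d - i)))"
      by (rule sum.mono_neutral_right) (auto simp: power_0_left)
    then show ?thesis by simp
  qed
  then show ?thesis
    by (simp add: hom_step_def coeff_num_poly coeff_den_poly)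
qed

context
  fixes d :: nat and ty :: "'k::field itself"
  assumes d: "d > 1"
begin

lemma hom_step_nonzero:
  assumes "hom_step d (p, q) = (0, 0 :: 'k ratfun alg_closure)"
  shows "p = 0 \<and> q = 0"
proof (cases "q = 0")
  case True
  have "hom_step d (p * 1, p * 0) = (p ^ d, p ^ d * gen_den True d d)"
    unfolding hom_step_scale using d by (simp add: hom_step_infinity)
  then have "p ^ d = 0"
    using assms True by simp
  then show ?thesis
    using True by simp
next
  case False
  have "hom_step d (q * (p / q), q * 1) = (q ^ d * num_eval d gen_num (p / q), q ^ d * den_eval d (gen_den True d) (p / q))"
    unfolding hom_step_scale hom_step_affine by simp
  moreover have "(q * (p / q), q * 1) = (p, q)"
    using False by simp
  ultimately have "num_eval d gen_num (p / q) = 0" "den_eval d (gen_den True d) (p / q) = 0"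
    using assms False by simp_all
  then show ?thesis
    using generic_tree_action_Phi(2)[OF d, where 'k = 'k] unfolding gen_coprime_def by blast
qed

lemma hom_iter_nonzero: "(hom_step d ^^ m) (x, 1) \<noteq> (0, 0 :: 'k ratfun alg_closure)"
proof (induction m)
  case (Suc m)
  show ?case
  proof
    assume "(hom_step d ^^ Suc m) (x, 1) = (0, 0)"
    then have "hom_step d (fst ((hom_step d ^^ m) (x, 1)), snd ((hom_step d ^^ m) (x, 1))) = (0, 0)"
      by simp
    then have "fst ((hom_step d ^^ m) (x, 1)) = 0 \<and> snd ((hom_step d ^^ m) (x, 1)) = 0"
      by (rule hom_step_nonzero)
    then show False
      using Suc by (simp add: prod_eq_iff)
  qed
qed simp

lemma gen_den_top_nonzero: "gen_den True d d \<noteq> (0 :: 'k ratfun alg_closure)"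
proof -
  have "mvar (d + d) \<noteq> (0 :: 'k mpoly)"
    unfolding mvar_def by (metis lookup_single_eq lookup_zero zero_neq_one)
  then show ?thesis
    by (simp add: gen_den_def indet_conv_mvar unital_hom_eq_0_iff[OF unital_hom_frac_of inj_frac_of])
qed

text \<open>At a pole the iteration passes through infinity and continues at \<open>1 / u\<close>,
  where \<open>u\<close> is the top coefficient of the denominator, whereas the tree has no vertex
  at a pole. Both sides agree because \<open>1 / u\<close> lies on no level, so the iteration never
  reaches \<open>0\<close> from there. The detour skips several levels, hence the strong
  induction.\<close>

lemma hom_iter_zero_iff:
  "fst ((hom_step d ^^ m) (x, 1)) = 0 \<longleftrightarrow> x \<in> (gen_lev True d m :: 'k ratfun alg_closure set)"
proof (induction m arbitrary: x rule: less_induct)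
  case (less m)
  show ?case
  proof (cases m)
    case 0
    then show ?thesis by simp
  next
    case (Suc k)
    let ?A = "num_eval d gen_num x" and ?B = "den_eval d (gen_den True d) x"
    have it: "(hom_step d ^^ m) (x, 1) = (hom_step d ^^ k) (?A, ?B)"
      unfolding Suc funpow_Suc_right comp_def hom_step_affine ..
    show ?thesis
    proof (cases "?B = 0")
      case False
      have "(hom_step d ^^ k) (?B * (?A / ?B), ?B * 1) = (?B ^ (d ^ k) * fst ((hom_step d ^^ k) (?A / ?B, 1)),
          ?B ^ (d ^ k) * snd ((hom_step d ^^ k) (?A / ?B, 1)))"
        by (rule hom_iter_scale)
      moreover have "(?B * (?A / ?B), ?B * 1) = (?A, ?B)"
        using False by simp
      ultimately have "fst ((hom_step d ^^ m) (x, 1)) = 0 \<longleftrightarrow> fst ((hom_step d ^^ k) (?A / ?B, 1)) = 0"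
        using False unfolding it by simp
      also have "\<dots> \<longleftrightarrow> ?A / ?B \<in> gen_lev True d k"
        using less.IH[of k] Suc by simp
      also have "\<dots> \<longleftrightarrow> x \<in> gen_lev True d m"
      proof -
        have "x \<in> gen_child True d z \<longleftrightarrow> z = ?A / ?B" for z
          using False by (auto simp: gen_child_def preimages_def)
        then show ?thesis
          unfolding Suc by simp
      qed
      finally show ?thesis .
    next
      case True
      have A: "?A \<noteq> 0"
        using generic_tree_action_Phi(2)[OF d, where 'k = 'k] True unfolding gen_coprime_def by blast
      have "x \<notin> gen_lev True d m"
        using A True unfolding Suc by (auto simp: gen_child_def preimages_def)
      moreover have "fst ((hom_step d ^^ k) (?A * 1, ?A * 0)) \<noteq> 0"
      proof -
        have "fst ((hom_step d ^^ k) (1, 0)) \<noteq> (0 :: 'k ratfun alg_closure)"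
        proof (cases k)
          case (Suc l)
          let ?u = "gen_den True d d :: 'k ratfun alg_closure"
          have u: "?u \<noteq> 0"
            by (rule gen_den_top_nonzero)
          have "(hom_step d ^^ k) (1, 0 :: 'k ratfun alg_closure) = (hom_step d ^^ l) (1, ?u)"
            unfolding Suc funpow_Suc_right comp_def using d by (simp add: hom_step_infinity)
          also have "(1, ?u) = (?u * (1 / ?u), ?u * 1)"
            using u by simp
          also have "(hom_step d ^^ l) \<dots> = (?u ^ (d ^ l) * fst ((hom_step d ^^ l) (1 / ?u, 1)),
              ?u ^ (d ^ l) * snd ((hom_step d ^^ l) (1 / ?u, 1)))"
            by (rule hom_iter_scale)
          finally have "fst ((hom_step d ^^ k) (1, 0 :: 'k ratfun alg_closure)) = 0 \<longleftrightarrow> fst ((hom_step d ^^ l) (1 / ?u, 1)) = 0"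
            using u by simp
          also have "\<dots> \<longleftrightarrow> 1 / ?u \<in> gen_lev True d l"
            using less.IH[of l] Suc \<open>m = Suc k\<close> by simp
          also have "\<not> \<dots>"
            using generic_tree_action_Phi(3)[OF d, of "1 / ?u" l] u by auto
          finally show ?thesis
            by simp
        qed simp
        then show ?thesis
          unfolding hom_iter_scale using A by simp
      qed
      ultimately show ?thesis
        unfolding it True by simp
    qed
  qed
qed

text \<open>Numerator and denominator from \<open>Phi_iter\<close> have no common zero in the
  closure. They are thus coprime already, and whatever \<open>SOME\<close> selects differs from
  \<open>N\<close> by a factor without zeros.\<close>

lemma roots_Phi_numer:
  "{\<alpha>. poly (map_poly to_ac (Phi_numer d n)) \<alpha> = 0} = (gen_lev True d n :: 'k ratfun alg_closure set)"
proof -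
  define N where "N = fst (Phi_iter d n :: 'k ratfun poly \<times> _)"
  define D where "D = snd (Phi_iter d n :: 'k ratfun poly \<times> _)"
  let ?ev = "\<lambda>p x. poly (map_poly to_ac (p :: 'k ratfun poly)) x"
  have evN: "?ev N x = fst ((hom_step d ^^ n) (x, 1))" and evD: "?ev D x = snd ((hom_step d ^^ n) (x, 1))" for x
    using Phi_iter_eval[of d n x] unfolding N_def D_def by (metis fst_conv snd_conv)+
  have nz: "\<not> (?ev N x = 0 \<and> ?ev D x = 0)" for x
    using hom_iter_nonzero[of n x] unfolding evN evD by (simp add: prod_eq_iff)
  have ev_mult: "?ev (p * q) x = ?ev p x * ?ev q x" for p q x
    using unital_hom.mult[OF unital_hom_eval] .
  have "coprime N D"
  proof (rule coprimeI)
    fix c assume c: "c dvd N" "c dvd D"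
    have no_root: "?ev c x \<noteq> 0" for x
    proof
      assume 0: "?ev c x = 0"
      obtain p q where "N = c * p" "D = c * q"
        using c by (elim dvdE)
      then have "?ev N x = 0 \<and> ?ev D x = 0"
        using 0 by (simp add: ev_mult)
      with nz show False by blast
    qed
    have "degree (map_poly to_ac c) = 0"
      using alg_closed_imp_poly_has_root[of "map_poly to_ac c"] no_root by blast
    moreover have "degree (map_poly to_ac c) = degree c"
      by (rule degree_map_poly) simp
    moreover have "c \<noteq> 0"
      using no_root[of 0] by auto
    ultimately show "is_unit c"
      by (simp add: is_unit_iff_degree)
  qed
  then have ex: "\<exists>N' g D'. N = g * N' \<and> D = g * D' \<and> coprime N' D'"
    by (intro exI[of _ N] exI[of _ 1] exI[of _ D]) simp
  have "Phi_numer d n = (SOME N'. \<exists>g D'. N = g * N' \<and> D = g * D' \<and> coprime N' D')"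
    by (simp add: Phi_numer_def N_def D_def split_beta Let_def)
  then have "\<exists>g D'. N = g * Phi_numer d n \<and> D = g * D' \<and> coprime (Phi_numer d n) D'"
    using someI_ex[OF ex] by simp
  then obtain g D' where gD: "N = g * Phi_numer d n" "D = g * D'"
    by blast
  have "?ev (Phi_numer d n) x = 0 \<longleftrightarrow> ?ev N x = 0" for x
    using nz[of x] arg_cong[OF gD(1), of "\<lambda>p. ?ev p x"] arg_cong[OF gD(2), of "\<lambda>p. ?ev p x"]
    by (auto simp: ev_mult)
  then show ?thesis
    by (auto simp: evN hom_iter_zero_iff)
qed

end

theorem theorem1p1:
  fixes k_type :: "'k::field itself" and d n :: nat
  assumes "d > 1" and "n \<ge> 1"
  shows "Gal_poly (base_Phi d :: 'k ratfun alg_closure set)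
            (map_poly to_ac (Phi_numer d n)) \<cong> wreath_power d n
       \<and> ((d, CHAR('k)) \<noteq> (2, 2) \<longrightarrow>
            Gal_poly (base_G d :: 'k ratfun alg_closure set)
              (map_poly to_ac (G_iter d n)) \<cong> wreath_power d n)"
proof (intro conjI impI)
  let ?C = "range cst \<union> s_var d ` {..<d} \<union> u_var d ` {..d} :: 'k ratfun set"
  interpret tree_galois d n gen_num "gen_den True d" ?C
  proof (rule tree_galois.intro)
    show "tree_action 0 (preimages d gen_num (gen_den True d)) d n ac_auts
       (tree_lev (preimages d gen_num (gen_den True d)) (0 :: 'k ratfun alg_closure))"
      using generic_tree_action_Phi(1)[OF assms(1)] unfolding gen_child_def .
    show "gen_num i \<in> gen_subfield (to_ac ` ?C)" if "i < d" for i
      using that by (intro subsetD[OF gen_subfield_superset]) (auto simp: gen_num_def s_var_def)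
    show "gen_den True d i \<in> gen_subfield (to_ac ` ?C)" if "i \<le> d" for i
      using that by (intro subsetD[OF gen_subfield_superset]) (auto simp: gen_den_def u_var_def)
  qed
  have "Gal_poly (base_Phi d :: 'k ratfun alg_closure set) (map_poly to_ac (Phi_numer d n)) = Gal_over K E"
    unfolding Gal_poly_def roots_Phi_numer[OF assms(1)] K_def E_def base_Phi_def gen_child_def ..
  then show "Gal_poly (base_Phi d :: 'k ratfun alg_closure set) (map_poly to_ac (Phi_numer d n)) \<cong> wreath_power d n"
    using Gal_iso_wreath_power by simp
next
  assume char: "(d, CHAR('k)) \<noteq> (2, 2)"
  let ?C = "range cst \<union> s_var d ` {..<d} :: 'k ratfun set"
  interpret tree_galois d n gen_num "gen_den False d" ?C
  proof (rule tree_galois.intro)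
    show "tree_action 0 (preimages d gen_num (gen_den False d)) d n ac_auts
       (tree_lev (preimages d gen_num (gen_den False d)) (0 :: 'k ratfun alg_closure))"
      using generic_tree_action_G[OF assms(1) char] unfolding gen_child_def .
    show "gen_num i \<in> gen_subfield (to_ac ` ?C)" if "i < d" for i
      using that by (intro subsetD[OF gen_subfield_superset]) (auto simp: gen_num_def s_var_def)
    show "gen_den False d i \<in> gen_subfield (to_ac ` ?C)" if "i \<le> d" for i
      using subfield_closedD(1,2)[OF subfield_closed_gen_subfield[of "to_ac ` ?C"]] by (simp add: gen_den_def)
  qed
  have "Gal_poly (base_G d :: 'k ratfun alg_closure set) (map_poly to_ac (G_iter d n)) = Gal_over K E"
    unfolding Gal_poly_def roots_G_iter K_def E_def base_G_def gen_child_def ..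
  then show "Gal_poly (base_G d :: 'k ratfun alg_closure set) (map_poly to_ac (G_iter d n)) \<cong> wreath_power d n"
    using Gal_iso_wreath_power by simp
qed

end
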